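(* Suppose that $\mathcal{E}$ is a category with finite limits, extensive (finite) coproducts, and a generating family of objects $\mathcal{G}$. Form the family of internal categories $\widehat{\mathcal{G}}:=\{\mathbf{2}_{\mathcal{E}}\times\mathbf{disc}(X)\mid X\in\mathcal{G}\}$. Then $\widehat{\mathcal{G}}$ is a generating family for the $2$-category $\mathbf{Cat}(\mathcal{E})$.
   Context: A category with pullbacks has extensive coproducts if it has finite coproducts and for all $A,B$ the functor $\mathcal{E}/A\times\mathcal{E}/B\to\mathcal{E}/(A+B)$ taking coproducts is an equivalence. $\mathbf{Cat}(\mathcal{E})$ is the $2$-category of categories, functors and natural transformations internal to $\mathcal{E}$. $\mathbf{disc}(X)$ is the discrete internal category on $X$ (objects and arrows both $X$, all structure maps identities). The essentially unique functor $F_{\mathcal{E}}:\mathbf{FinSet}\to\mathcal{E}$ preserving finite coproducts and the terminal object preserves finite limits; $\mathbf{2}_{\mathcal{E}}$ is the image of the free-living arrow category $\mathbf{2}\in\mathbf{Cat}(\mathbf{FinSet})$ under the induced $2$-functor $\mathbf{Cat}(F_{\mathcal{E}}):\mathbf{Cat}(\mathbf{FinSet})\to\mathbf{Cat}(\mathcal{E})$. A family of objects $\mathcal{G}$ in a category $\mathcal{C}$ is generating if the functors $\mathcal{C}(X,-):\mathcal{C}\to\mathbf{Set}$, $X\in\mathcal{G}$, are jointly faithful. A family of objects $\widehat{\mathcal{G}}$ in a $2$-category $\mathcal{K}$ is generating if the $2$-functors $\mathcal{K}(X,-):\mathcal{K}\to\mathbf{Cat}$, $X\in\widehat{\mathcal{G}}$,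 are jointly faithful on $1$-cells and on $2$-cells. *)

theory Defs
  imports Main "HOL-Library.FuncSet"
begin

section \<open>Categories\<close>

record ('o, 'm) cat =
  Ob  :: "'o set"
  Ar  :: "'m set"
  Src :: "'m \<Rightarrow> 'o"
  Tgt :: "'m \<Rightarrow> 'o"
  Idn :: "'o \<Rightarrow> 'm"
  Cmp :: "'m \<Rightarrow> 'm \<Rightarrow> 'm"  (infixr "\<cdot>\<index>" 70)

definition hom :: "('o, 'm) cat \<Rightarrow> 'o \<Rightarrow> 'o \<Rightarrow> 'm set" where
  "hom C A B = {f \<in> Ar C. Src C f = A \<and> Tgt C f = B}"

locale category =
  fixes C :: "('o, 'm) cat" (structure)
  assumes Src_in [simp, intro]: "f \<in> Ar C \<Longrightarrow> Src C f \<in> Ob C"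
    and Tgt_in [simp, intro]: "f \<in> Ar C \<Longrightarrow> Tgt C f \<in> Ob C"
    and Idn_in: "A \<in> Ob C \<Longrightarrow> Idn C A \<in> hom C A A"
    and Cmp_in: "f \<in> hom C X Y \<Longrightarrow> g \<in> hom C Y Z \<Longrightarrow> g \<cdot> f \<in> hom C X Z"
    and Idn_left: "f \<in> hom C X Y \<Longrightarrow> Idn C Y \<cdot> f = f"
    and Idn_right: "f \<in> hom C X Y \<Longrightarrow> f \<cdot> Idn C X = f"
    and Cmp_assoc: "f \<in> hom C W X \<Longrightarrow> g \<in> hom C X Y \<Longrightarrow> h \<in> hom C Y Z \<Longrightarrow>
                      (h \<cdot> g) \<cdot> f = h \<cdot> (g \<cdot> f)"

definition is_iso :: "('o, 'm) cat \<Rightarrow> 'm \<Rightarrow> bool" where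
  "is_iso C f \<longleftrightarrow> f \<in> Ar C \<and> (\<exists>g \<in> hom C (Tgt C f) (Src C f).
     g \<cdot>\<^bsub>C\<^esub> f = Idn C (Src C f) \<and> f \<cdot>\<^bsub>C\<^esub> g = Idn C (Tgt C f))"

subsection \<open>Functors, natural transformations, equivalences\<close>

record ('o, 'm, 'p, 'n) func =
  FOb :: "'o \<Rightarrow> 'p"
  FAr :: "'m \<Rightarrow> 'n"

definition is_functor ::
    "('o, 'm) cat \<Rightarrow> ('p, 'n) cat \<Rightarrow> ('o, 'm, 'p, 'n) func \<Rightarrow> bool" where
  "is_functor C D F \<longleftrightarrow>
     (\<forall>A \<in> Ob C. FOb F A \<in> Ob D) \<and>
     (\<forall>f \<in> Ar C. FAr F f \<in> hom D (FOb F (Src C f)) (FOb F (Tgt C f))) \<and>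
     (\<forall>A \<in> Ob C. FAr F (Idn C A) = Idn D (FOb F A)) \<and>
     (\<forall>f \<in> Ar C. \<forall>g \<in> Ar C. Tgt C f = Src C g \<longrightarrow>
        FAr F (g \<cdot>\<^bsub>C\<^esub> f) = FAr F g \<cdot>\<^bsub>D\<^esub> FAr F f)"

definition id_func :: "('o, 'm, 'o, 'm) func" where
  "id_func = \<lparr>FOb = (\<lambda>A. A), FAr = (\<lambda>f. f)\<rparr>"

definition comp_func ::
    "('p, 'n, 'q, 'k) func \<Rightarrow> ('o, 'm, 'p, 'n) func \<Rightarrow> ('o, 'm, 'q, 'k) func" where
  "comp_func G F = \<lparr>FOb = FOb G \<circ> FOb F, FAr = FAr G \<circ> FAr F\<rparr>"

definition is_nat_trans ::
    "('o, 'm) cat \<Rightarrow> ('p, 'n) cat \<Rightarrow> ('o, 'm, 'p, 'n) func \<Rightarrow> ('o, 'm, 'p, 'n) func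
       \<Rightarrow> ('o \<Rightarrow> 'n) \<Rightarrow> bool" where
  "is_nat_trans C D F G \<eta> \<longleftrightarrow>
     (\<forall>A \<in> Ob C. \<eta> A \<in> hom D (FOb F A) (FOb G A)) \<and>
     (\<forall>f \<in> Ar C. \<eta> (Tgt C f) \<cdot>\<^bsub>D\<^esub> FAr F f = FAr G f \<cdot>\<^bsub>D\<^esub> \<eta> (Src C f))"

definition naturally_isomorphic ::
    "('o, 'm) cat \<Rightarrow> ('p, 'n) cat \<Rightarrow> ('o, 'm, 'p, 'n) func \<Rightarrow> ('o, 'm, 'p, 'n) func
       \<Rightarrow> bool" where
  "naturally_isomorphic C D F G \<longleftrightarrow>
     (\<exists>\<eta>. is_nat_trans C D F G \<eta> \<and> (\<forall>A \<in> Ob C. is_iso D (\<eta> A)))"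

definition is_equivalence ::
    "('o, 'm) cat \<Rightarrow> ('p, 'n) cat \<Rightarrow> ('o, 'm, 'p, 'n) func \<Rightarrow> bool" where
  "is_equivalence C D F \<longleftrightarrow> is_functor C D F \<and>
     (\<exists>G. is_functor D C G \<and>
          naturally_isomorphic C C (comp_func G F) id_func \<and>
          naturally_isomorphic D D (comp_func F G) id_func)"

subsection \<open>Limits\<close>

definition is_cone ::
    "('i, 'j) cat \<Rightarrow> ('o, 'm) cat \<Rightarrow> ('i, 'j, 'o, 'm) func \<Rightarrow> 'o \<Rightarrow> ('i \<Rightarrow> 'm) \<Rightarrow> bool" where
  "is_cone J C D L \<pi> \<longleftrightarrow> L \<in> Ob C \<and>
     (\<forall>j \<in> Ob J. \<pi> j \<in> hom C L (FOb D j)) \<and>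
     (\<forall>u \<in> Ar J. FAr D u \<cdot>\<^bsub>C\<^esub> \<pi> (Src J u) = \<pi> (Tgt J u))"

definition is_limit ::
    "('i, 'j) cat \<Rightarrow> ('o, 'm) cat \<Rightarrow> ('i, 'j, 'o, 'm) func \<Rightarrow> 'o \<Rightarrow> ('i \<Rightarrow> 'm) \<Rightarrow> bool" where
  "is_limit J C D L \<pi> \<longleftrightarrow> is_cone J C D L \<pi> \<and>
     (\<forall>M \<mu>. is_cone J C D M \<mu> \<longrightarrow>
        (\<exists>!h. h \<in> hom C M L \<and> (\<forall>j \<in> Ob J. \<pi> j \<cdot>\<^bsub>C\<^esub> h = \<mu> j)))"

text \<open>Every finite category is isomorphic to one whose objects and arrows are natural
  numbers, so these suffice as shapes of finite diagrams.\<close>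

definition has_finite_limits :: "('o, 'm) cat \<Rightarrow> bool" where
  "has_finite_limits C \<longleftrightarrow>
     (\<forall>(J :: (nat, nat) cat) D. category J \<and> finite (Ob J) \<and> finite (Ar J) \<and> is_functor J C D
        \<longrightarrow> (\<exists>L \<pi>. is_limit J C D L \<pi>))"

definition is_terminal :: "('o, 'm) cat \<Rightarrow> 'o \<Rightarrow> bool" where
  "is_terminal C T \<longleftrightarrow> T \<in> Ob C \<and> (\<forall>A \<in> Ob C. \<exists>!h. h \<in> hom C A T)"

definition is_pullback ::
    "('o, 'm) cat \<Rightarrow> 'm \<Rightarrow> 'm \<Rightarrow> 'o \<Rightarrow> 'm \<Rightarrow> 'm \<Rightarrow> bool" where
  "is_pullback C f g P p q \<longleftrightarrow>
     f \<in> Ar C \<and> g \<in> Ar C \<and> Tgt C f = Tgt C g \<and> P \<in> Ob C \<and>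
     p \<in> hom C P (Src C f) \<and> q \<in> hom C P (Src C g) \<and> f \<cdot>\<^bsub>C\<^esub> p = g \<cdot>\<^bsub>C\<^esub> q \<and>
     (\<forall>T x y. x \<in> hom C T (Src C f) \<and> y \<in> hom C T (Src C g) \<and> f \<cdot>\<^bsub>C\<^esub> x = g \<cdot>\<^bsub>C\<^esub> y \<longrightarrow>
        (\<exists>!h. h \<in> hom C T P \<and> p \<cdot>\<^bsub>C\<^esub> h = x \<and> q \<cdot>\<^bsub>C\<^esub> h = y))"

definition is_product ::
    "('o, 'm) cat \<Rightarrow> 'o \<Rightarrow> 'o \<Rightarrow> 'o \<Rightarrow> 'm \<Rightarrow> 'm \<Rightarrow> bool" where
  "is_product C A B P p q \<longleftrightarrow> P \<in> Ob C \<and> p \<in> hom C P A \<and> q \<in> hom C P B \<and>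
     (\<forall>T x y. x \<in> hom C T A \<and> y \<in> hom C T B \<longrightarrow>
        (\<exists>!h. h \<in> hom C T P \<and> p \<cdot>\<^bsub>C\<^esub> h = x \<and> q \<cdot>\<^bsub>C\<^esub> h = y))"

text \<open>The arrow \<open>(x, y)\<close> into a pullback \<open>P\<close> with projections \<open>p, q\<close>.\<close>

definition tuple :: "('o, 'm) cat \<Rightarrow> 'o \<Rightarrow> 'm \<Rightarrow> 'm \<Rightarrow> 'm \<Rightarrow> 'm \<Rightarrow> 'm" where
  "tuple C P p q x y =
     (THE h. h \<in> hom C (Src C x) P \<and> p \<cdot>\<^bsub>C\<^esub> h = x \<and> q \<cdot>\<^bsub>C\<^esub> h = y)"

definition prod_ob :: "('o, 'm) cat \<Rightarrow> 'o \<Rightarrow> 'o \<Rightarrow> 'o" where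
  "prod_ob C A B = (SOME P. \<exists>p q. is_product C A B P p q)"

subsection \<open>Coproducts and extensivity\<close>

definition is_coproduct ::
    "('o, 'm) cat \<Rightarrow> 'i set \<Rightarrow> ('i \<Rightarrow> 'o) \<Rightarrow> 'o \<Rightarrow> ('i \<Rightarrow> 'm) \<Rightarrow> bool" where
  "is_coproduct C I X S \<iota> \<longleftrightarrow> S \<in> Ob C \<and> (\<forall>i \<in> I. \<iota> i \<in> hom C (X i) S) \<and>
     (\<forall>T f. T \<in> Ob C \<and> (\<forall>i \<in> I. f i \<in> hom C (X i) T) \<longrightarrow>
        (\<exists>!h. h \<in> hom C S T \<and> (\<forall>i \<in> I. h \<cdot>\<^bsub>C\<^esub> \<iota> i = f i)))"

definition has_finite_coproducts :: "('o, 'm) cat \<Rightarrow> bool" where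
  "has_finite_coproducts C \<longleftrightarrow>
     (\<forall>(n :: nat) X. (\<forall>i<n. X i \<in> Ob C) \<longrightarrow> (\<exists>S \<iota>. is_coproduct C {..<n} X S \<iota>))"

definition coproduct_of :: "('o, 'm) cat \<Rightarrow> 'o \<Rightarrow> 'o \<Rightarrow> 'o \<times> 'm \<times> 'm" where
  "coproduct_of C A B =
     (SOME (S, i, j). is_coproduct C (UNIV :: bool set) (\<lambda>b. if b then A else B) S
                                   (\<lambda>b. if b then i else j))"

definition coprod_ob :: "('o, 'm) cat \<Rightarrow> 'o \<Rightarrow> 'o \<Rightarrow> 'o" where
  "coprod_ob C A B = fst (coproduct_of C A B)"

definition coprod_inl :: "('o, 'm) cat \<Rightarrow> 'o \<Rightarrow> 'o \<Rightarrow> 'm" where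
  "coprod_inl C A B = fst (snd (coproduct_of C A B))"

definition coprod_inr :: "('o, 'm) cat \<Rightarrow> 'o \<Rightarrow> 'o \<Rightarrow> 'm" where
  "coprod_inr C A B = snd (snd (coproduct_of C A B))"

definition coprod_map :: "('o, 'm) cat \<Rightarrow> 'm \<Rightarrow> 'm \<Rightarrow> 'm" where
  "coprod_map C f g =
     (let X = Src C f; Y = Src C g; A = Tgt C f; B = Tgt C g
      in THE h. h \<in> hom C (coprod_ob C X Y) (coprod_ob C A B) \<and>
           h \<cdot>\<^bsub>C\<^esub> coprod_inl C X Y = coprod_inl C A B \<cdot>\<^bsub>C\<^esub> f \<and>
           h \<cdot>\<^bsub>C\<^esub> coprod_inr C X Y = coprod_inr C A B \<cdot>\<^bsub>C\<^esub> g)"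

text \<open>An arrow of the slice over \<open>A\<close> is a triple \<open>(f, h, g)\<close>: the arrow \<open>h\<close> from the object
  \<open>f\<close> to the object \<open>g\<close>.\<close>

definition slice :: "('o, 'm) cat \<Rightarrow> 'o \<Rightarrow> ('m, 'm \<times> 'm \<times> 'm) cat" where
  "slice C A =
     \<lparr>Ob = {f \<in> Ar C. Tgt C f = A},
      Ar = {(f, h, g). f \<in> Ar C \<and> g \<in> Ar C \<and> Tgt C f = A \<and> Tgt C g = A \<and>
                       h \<in> hom C (Src C f) (Src C g) \<and> g \<cdot>\<^bsub>C\<^esub> h = f},
      Src = (\<lambda>(f, h, g). f),
      Tgt = (\<lambda>(f, h, g). g),
      Idn = (\<lambda>f. (f, Idn C (Src C f), f)),
      Cmp = (\<lambda>(g', k, l) (f, h, g). (f, k \<cdot>\<^bsub>C\<^esub> h, l))\<rparr>"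

definition prod_cat ::
    "('o, 'm) cat \<Rightarrow> ('p, 'n) cat \<Rightarrow> ('o \<times> 'p, 'm \<times> 'n) cat" where
  "prod_cat C D =
     \<lparr>Ob = Ob C \<times> Ob D,
      Ar = Ar C \<times> Ar D,
      Src = map_prod (Src C) (Src D),
      Tgt = map_prod (Tgt C) (Tgt D),
      Idn = map_prod (Idn C) (Idn D),
      Cmp = (\<lambda>(g, g') (f, f'). (g \<cdot>\<^bsub>C\<^esub> f, g' \<cdot>\<^bsub>D\<^esub> f'))\<rparr>"

text \<open>The functor \<open>C/A \<times> C/B \<rightarrow> C/(A + B)\<close> taking coproducts; its action does not mention
  \<open>A\<close> and \<open>B\<close>, which are determined by its arguments.\<close>

definition coprod_functor ::
    "('o, 'm) cat \<Rightarrow> ('m \<times> 'm, ('m \<times> 'm \<times> 'm) \<times> ('m \<times> 'm \<times> 'm), 'm, 'm \<times> 'm \<times> 'm) func" where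
  "coprod_functor C =
     \<lparr>FOb = (\<lambda>(f, g). coprod_map C f g),
      FAr = (\<lambda>((f, h, f'), (g, k, g')).
               (coprod_map C f g, coprod_map C h k, coprod_map C f' g'))\<rparr>"

definition has_extensive_coproducts :: "('o, 'm) cat \<Rightarrow> bool" where
  "has_extensive_coproducts C \<longleftrightarrow> has_finite_coproducts C \<and>
     (\<forall>A \<in> Ob C. \<forall>B \<in> Ob C.
        is_equivalence (prod_cat (slice C A) (slice C B)) (slice C (coprod_ob C A B))
                       (coprod_functor C))"

definition preserves_finite_coproducts ::
    "('o, 'm) cat \<Rightarrow> ('p, 'n) cat \<Rightarrow> ('o, 'm, 'p, 'n) func \<Rightarrow> bool" where
  "preserves_finite_coproducts C D F \<longleftrightarrow>
     (\<forall>(n :: nat) X S \<iota>. is_coproduct C {..<n} X S \<iota> \<longrightarrow>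
        is_coproduct D {..<n} (\<lambda>i. FOb F (X i)) (FOb F S) (\<lambda>i. FAr F (\<iota> i)))"

definition preserves_terminal ::
    "('o, 'm) cat \<Rightarrow> ('p, 'n) cat \<Rightarrow> ('o, 'm, 'p, 'n) func \<Rightarrow> bool" where
  "preserves_terminal C D F \<longleftrightarrow> (\<forall>T. is_terminal C T \<longrightarrow> is_terminal D (FOb F T))"

subsection \<open>Generating families\<close>

text \<open>The function \<open>C(X, f) : C(X, A) \<rightarrow> C(X, B)\<close> for \<open>f : A \<rightarrow> B\<close>, made extensional so that
  equality is equality of functions on \<open>C(X, A)\<close>.\<close>

definition rep :: "('o, 'm) cat \<Rightarrow> 'o \<Rightarrow> 'm \<Rightarrow> 'm \<Rightarrow> 'm" where
  "rep C X f = (\<lambda>h \<in> hom C X (Src C f). f \<cdot>\<^bsub>C\<^esub> h)"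

definition generating :: "('o, 'm) cat \<Rightarrow> 'o set \<Rightarrow> bool" where
  "generating C \<G> \<longleftrightarrow> \<G> \<subseteq> Ob C \<and>
     (\<forall>A \<in> Ob C. \<forall>B \<in> Ob C. \<forall>f \<in> hom C A B. \<forall>g \<in> hom C A B.
        (\<forall>X \<in> \<G>. rep C X f = rep C X g) \<longrightarrow> f = g)"

section \<open>2-categories\<close>

text \<open>A 2-category is presented by its underlying category of objects and 1-cells, its
  hom-categories, whose objects are the 1-cells and whose arrows are the 2-cells, and horizontal
  composition of 2-cells.\<close>

record ('o, 'm, 'c) two_cat =
  Base :: "('o, 'm) cat"
  Hom2 :: "'o \<Rightarrow> 'o \<Rightarrow> ('m, 'c) cat"
  HCmp :: "'c \<Rightarrow> 'c \<Rightarrow> 'c"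

text \<open>For \<open>f : A \<rightarrow> B\<close>, the functor \<open>K(X, f) : K(X, A) \<rightarrow> K(X, B)\<close>; for a 2-cell \<open>\<alpha>\<close> between
  1-cells \<open>A \<rightarrow> B\<close>, the (components of the) natural transformation \<open>K(X, \<alpha>)\<close>. Both are made
  extensional.\<close>

definition rep1 ::
    "('o, 'm, 'c) two_cat \<Rightarrow> 'o \<Rightarrow> 'o \<Rightarrow> 'o \<Rightarrow> 'm \<Rightarrow> ('m, 'c, 'm, 'c) func" where
  "rep1 K X A B f =
     \<lparr>FOb = (\<lambda>h \<in> Ob (Hom2 K X A). f \<cdot>\<^bsub>Base K\<^esub> h),
      FAr = (\<lambda>\<gamma> \<in> Ar (Hom2 K X A). HCmp K (Idn (Hom2 K A B) f) \<gamma>)\<rparr>"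

definition rep2 :: "('o, 'm, 'c) two_cat \<Rightarrow> 'o \<Rightarrow> 'o \<Rightarrow> 'c \<Rightarrow> 'm \<Rightarrow> 'c" where
  "rep2 K X A \<alpha> = (\<lambda>h \<in> Ob (Hom2 K X A). HCmp K \<alpha> (Idn (Hom2 K X A) h))"

definition generating2 :: "('o, 'm, 'c) two_cat \<Rightarrow> 'o set \<Rightarrow> bool" where
  "generating2 K \<G> \<longleftrightarrow> \<G> \<subseteq> Ob (Base K) \<and>
     (\<forall>A \<in> Ob (Base K). \<forall>B \<in> Ob (Base K). \<forall>f \<in> Ob (Hom2 K A B). \<forall>g \<in> Ob (Hom2 K A B).
        (\<forall>X \<in> \<G>. rep1 K X A B f = rep1 K X A B g) \<longrightarrow> f = g) \<and>
     (\<forall>A \<in> Ob (Base K). \<forall>B \<in> Ob (Base K). \<forall>f \<in> Ob (Hom2 K A B). \<forall>g \<in> Ob (Hom2 K A B).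
        \<forall>\<alpha> \<in> hom (Hom2 K A B) f g. \<forall>\<beta> \<in> hom (Hom2 K A B) f g.
        (\<forall>X \<in> \<G>. rep2 K X A \<alpha> = rep2 K X A \<beta>) \<longrightarrow> \<alpha> = \<beta>)"

section \<open>Internal categories\<close>

text \<open>The object \<open>C2\<close> of composable pairs, with its projections, is part of the data: this
  avoids a choice of pullbacks and lets a functor act componentwise. A generalised element of
  \<open>C2\<close> is a pair \<open>(g, f)\<close> with the source of \<open>g\<close> equal to the target of \<open>f\<close>, and \<open>cmp\<close>
  sends it to \<open>g\<close> after \<open>f\<close>.\<close>

record ('o, 'm) icat =
  C0  :: 'o
  C1  :: 'o
  C2  :: 'o
  src :: 'm
  tgt :: 'm
  idn :: 'm
  pr1 :: 'm
  pr2 :: 'm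
  cmp :: 'm

definition comp_pair :: "('o, 'm) cat \<Rightarrow> ('o, 'm) icat \<Rightarrow> 'm \<Rightarrow> 'm \<Rightarrow> 'm" where
  "comp_pair E C g f = tuple E (C2 C) (pr1 C) (pr2 C) g f"

text \<open>The last clause is associativity on the object \<open>T\<close> of composable triples \<open>(h, g, f)\<close>,
  where \<open>u = (h, g)\<close> and \<open>v = (g, f)\<close>.\<close>

definition int_category :: "('o, 'm) cat \<Rightarrow> ('o, 'm) icat \<Rightarrow> bool" where
  "int_category E C \<longleftrightarrow>
     C0 C \<in> Ob E \<and> C1 C \<in> Ob E \<and>
     src C \<in> hom E (C1 C) (C0 C) \<and> tgt C \<in> hom E (C1 C) (C0 C) \<and>
     idn C \<in> hom E (C0 C) (C1 C) \<and>
     is_pullback E (src C) (tgt C) (C2 C) (pr1 C) (pr2 C) \<and>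
     cmp C \<in> hom E (C2 C) (C1 C) \<and>
     src C \<cdot>\<^bsub>E\<^esub> idn C = Idn E (C0 C) \<and> tgt C \<cdot>\<^bsub>E\<^esub> idn C = Idn E (C0 C) \<and>
     src C \<cdot>\<^bsub>E\<^esub> cmp C = src C \<cdot>\<^bsub>E\<^esub> pr2 C \<and> tgt C \<cdot>\<^bsub>E\<^esub> cmp C = tgt C \<cdot>\<^bsub>E\<^esub> pr1 C \<and>
     cmp C \<cdot>\<^bsub>E\<^esub> comp_pair E C (idn C \<cdot>\<^bsub>E\<^esub> tgt C) (Idn E (C1 C)) = Idn E (C1 C) \<and>
     cmp C \<cdot>\<^bsub>E\<^esub> comp_pair E C (Idn E (C1 C)) (idn C \<cdot>\<^bsub>E\<^esub> src C) = Idn E (C1 C) \<and>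
     (\<forall>T u v. is_pullback E (pr2 C) (pr1 C) T u v \<longrightarrow>
        cmp C \<cdot>\<^bsub>E\<^esub> comp_pair E C (cmp C \<cdot>\<^bsub>E\<^esub> u) (pr2 C \<cdot>\<^bsub>E\<^esub> v) =
        cmp C \<cdot>\<^bsub>E\<^esub> comp_pair E C (pr1 C \<cdot>\<^bsub>E\<^esub> u) (cmp C \<cdot>\<^bsub>E\<^esub> v))"

record ('o, 'm) ifunc =
  Fdom :: "('o, 'm) icat"
  Fcod :: "('o, 'm) icat"
  F0   :: 'm
  F1   :: 'm

definition int_functor :: "('o, 'm) cat \<Rightarrow> ('o, 'm) ifunc \<Rightarrow> bool" where
  "int_functor E F \<longleftrightarrow> (let A = Fdom F; B = Fcod F in
     F0 F \<in> hom E (C0 A) (C0 B) \<and> F1 F \<in> hom E (C1 A) (C1 B) \<and>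
     src B \<cdot>\<^bsub>E\<^esub> F1 F = F0 F \<cdot>\<^bsub>E\<^esub> src A \<and> tgt B \<cdot>\<^bsub>E\<^esub> F1 F = F0 F \<cdot>\<^bsub>E\<^esub> tgt A \<and>
     F1 F \<cdot>\<^bsub>E\<^esub> idn A = idn B \<cdot>\<^bsub>E\<^esub> F0 F \<and>
     F1 F \<cdot>\<^bsub>E\<^esub> cmp A =
       cmp B \<cdot>\<^bsub>E\<^esub> comp_pair E B (F1 F \<cdot>\<^bsub>E\<^esub> pr1 A) (F1 F \<cdot>\<^bsub>E\<^esub> pr2 A))"

record ('o, 'm) itrans =
  Ndom  :: "('o, 'm) ifunc"
  Ncod  :: "('o, 'm) ifunc"
  Ncomp :: 'm

definition int_nat_trans :: "('o, 'm) cat \<Rightarrow> ('o, 'm) itrans \<Rightarrow> bool" where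
  "int_nat_trans E \<alpha> \<longleftrightarrow> (let F = Ndom \<alpha>; G = Ncod \<alpha>; A = Fdom F; B = Fcod F in
     Fdom G = A \<and> Fcod G = B \<and>
     Ncomp \<alpha> \<in> hom E (C0 A) (C1 B) \<and>
     src B \<cdot>\<^bsub>E\<^esub> Ncomp \<alpha> = F0 F \<and> tgt B \<cdot>\<^bsub>E\<^esub> Ncomp \<alpha> = F0 G \<and>
     cmp B \<cdot>\<^bsub>E\<^esub> comp_pair E B (F1 G) (Ncomp \<alpha> \<cdot>\<^bsub>E\<^esub> src A) =
     cmp B \<cdot>\<^bsub>E\<^esub> comp_pair E B (Ncomp \<alpha> \<cdot>\<^bsub>E\<^esub> tgt A) (F1 F))"

definition int_hom ::
    "('o, 'm) cat \<Rightarrow> ('o, 'm) icat \<Rightarrow> ('o, 'm) icat \<Rightarrow> (('o, 'm) ifunc, ('o, 'm) itrans) cat" where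
  "int_hom E A B =
     \<lparr>Ob = {F. int_functor E F \<and> Fdom F = A \<and> Fcod F = B},
      Ar = {\<alpha>. int_nat_trans E \<alpha> \<and>
               int_functor E (Ndom \<alpha>) \<and> Fdom (Ndom \<alpha>) = A \<and> Fcod (Ndom \<alpha>) = B \<and>
               int_functor E (Ncod \<alpha>) \<and> Fdom (Ncod \<alpha>) = A \<and> Fcod (Ncod \<alpha>) = B},
      Src = Ndom,
      Tgt = Ncod,
      Idn = (\<lambda>F. \<lparr>Ndom = F, Ncod = F, Ncomp = idn B \<cdot>\<^bsub>E\<^esub> F0 F\<rparr>),
      Cmp = (\<lambda>\<beta> \<alpha>. \<lparr>Ndom = Ndom \<alpha>, Ncod = Ncod \<beta>,
                     Ncomp = cmp B \<cdot>\<^bsub>E\<^esub> comp_pair E B (Ncomp \<beta>) (Ncomp \<alpha>)\<rparr>)\<rparr>"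

definition int_id :: "('o, 'm) cat \<Rightarrow> ('o, 'm) icat \<Rightarrow> ('o, 'm) ifunc" where
  "int_id E A = \<lparr>Fdom = A, Fcod = A, F0 = Idn E (C0 A), F1 = Idn E (C1 A)\<rparr>"

definition int_comp ::
    "('o, 'm) cat \<Rightarrow> ('o, 'm) ifunc \<Rightarrow> ('o, 'm) ifunc \<Rightarrow> ('o, 'm) ifunc" where
  "int_comp E G F =
     \<lparr>Fdom = Fdom F, Fcod = Fcod G, F0 = F0 G \<cdot>\<^bsub>E\<^esub> F0 F, F1 = F1 G \<cdot>\<^bsub>E\<^esub> F1 F\<rparr>"

text \<open>For \<open>\<alpha> : F \<Rightarrow> F'\<close> and \<open>\<beta> : G \<Rightarrow> G'\<close>, the component at \<open>x\<close> of the horizontal composite is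
  \<open>\<beta>\<close> at \<open>F' x\<close> after \<open>G\<close> of (\<open>\<alpha>\<close> at \<open>x\<close>).\<close>

definition int_hcomp ::
    "('o, 'm) cat \<Rightarrow> ('o, 'm) itrans \<Rightarrow> ('o, 'm) itrans \<Rightarrow> ('o, 'm) itrans" where
  "int_hcomp E \<beta> \<alpha> =
     (let D = Fcod (Ndom \<beta>) in
      \<lparr>Ndom = int_comp E (Ndom \<beta>) (Ndom \<alpha>),
       Ncod = int_comp E (Ncod \<beta>) (Ncod \<alpha>),
       Ncomp = cmp D \<cdot>\<^bsub>E\<^esub> comp_pair E D (Ncomp \<beta> \<cdot>\<^bsub>E\<^esub> F0 (Ncod \<alpha>))
                                       (F1 (Ndom \<beta>) \<cdot>\<^bsub>E\<^esub> Ncomp \<alpha>)\<rparr>)"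

definition Cat ::
    "('o, 'm) cat \<Rightarrow> (('o, 'm) icat, ('o, 'm) ifunc, ('o, 'm) itrans) two_cat" where
  "Cat E =
     \<lparr>Base = \<lparr>Ob = {C. int_category E C},
               Ar = {F. int_functor E F \<and> int_category E (Fdom F) \<and> int_category E (Fcod F)},
               Src = Fdom,
               Tgt = Fcod,
               Idn = int_id E,
               Cmp = int_comp E\<rparr>,
      Hom2 = int_hom E,
      HCmp = int_hcomp E\<rparr>"

definition disc :: "('o, 'm) cat \<Rightarrow> 'o \<Rightarrow> ('o, 'm) icat" where
  "disc E X =
     \<lparr>C0 = X, C1 = X, C2 = X, src = Idn E X, tgt = Idn E X, idn = Idn E X,
      pr1 = Idn E X, pr2 = Idn E X, cmp = Idn E X\<rparr>"

text \<open>The action of \<open>Cat F : Cat C \<rightarrow> Cat D\<close> on objects.\<close>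

definition Cat_map :: "('o, 'm, 'p, 'n) func \<Rightarrow> ('o, 'm) icat \<Rightarrow> ('p, 'n) icat" where
  "Cat_map F C =
     \<lparr>C0 = FOb F (C0 C), C1 = FOb F (C1 C), C2 = FOb F (C2 C),
      src = FAr F (src C), tgt = FAr F (tgt C), idn = FAr F (idn C),
      pr1 = FAr F (pr1 C), pr2 = FAr F (pr2 C), cmp = FAr F (cmp C)\<rparr>"

section \<open>Finite sets and the free-living arrow\<close>

text \<open>Up to equivalence, the category of finite sets: its objects are the finite sets of natural
  numbers and its arrows the triples \<open>(A, f, B)\<close> with \<open>f\<close> an (extensional) function from \<open>A\<close>
  to \<open>B\<close>.\<close>

definition FinSet :: "(nat set, nat set \<times> (nat \<Rightarrow> nat) \<times> nat set) cat" where
  "FinSet =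
     \<lparr>Ob = {A. finite A},
      Ar = {(A, f, B). finite A \<and> finite B \<and> f \<in> A \<rightarrow>\<^sub>E B},
      Src = (\<lambda>(A, f, B). A),
      Tgt = (\<lambda>(A, f, B). B),
      Idn = (\<lambda>A. (A, (\<lambda>x \<in> A. x), A)),
      Cmp = (\<lambda>(B', g, C) (A, f, B). (A, compose A g f, C))\<rparr>"

text \<open>The function on \<open>{0, \<dots>, length xs - 1}\<close> with values \<open>xs\<close>, as an arrow to \<open>{0, \<dots>, n - 1}\<close>.\<close>

definition tabulate :: "nat list \<Rightarrow> nat \<Rightarrow> nat set \<times> (nat \<Rightarrow> nat) \<times> nat set" where
  "tabulate xs n = ({..<length xs}, (\<lambda>i \<in> {..<length xs}. xs ! i), {..<n})"

text \<open>The category with objects \<open>0, 1\<close> and a single non-identity arrow \<open>0 \<rightarrow> 1\<close>. Its arrows are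
  coded as \<open>0 = id\<^sub>0\<close>, \<open>1 = id\<^sub>1\<close>, \<open>2 : 0 \<rightarrow> 1\<close>, and its composable pairs \<open>(g, f)\<close> as
  \<open>0 = (0, 0)\<close>, \<open>1 = (1, 1)\<close>, \<open>2 = (2, 0)\<close>, \<open>3 = (1, 2)\<close>.\<close>

definition free_arrow :: "(nat set, nat set \<times> (nat \<Rightarrow> nat) \<times> nat set) icat" where
  "free_arrow =
     \<lparr>C0 = {..<2}, C1 = {..<3}, C2 = {..<4},
      src = tabulate [0, 1, 0] 2,
      tgt = tabulate [0, 1, 1] 2,
      idn = tabulate [0, 1] 3,
      pr1 = tabulate [0, 1, 2, 1] 3,
      pr2 = tabulate [0, 1, 0, 2] 3,
      cmp = tabulate [0, 1, 2, 2] 3\<rparr>"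

end

theory Submission
  imports Defs
begin

text \<open>Write \<open>n \<bullet> X\<close> for the coproduct of \<open>n\<close> copies of \<open>X\<close>. The components of \<open>2\<^sub>E\<close> are the
  objects \<open>n \<bullet> 1\<close> for \<open>n = 2, 3, 4\<close>, and by extensivity \<open>(n \<bullet> 1) \<times> X\<close> is \<open>n \<bullet> X\<close>, so
  \<open>2\<^sub>E \<times> disc X\<close> has the components \<open>n \<bullet> X\<close> with the structure maps of the free-living arrow
  acting on the indices. Mapping out of these coproducts, an arrow \<open>a : X \<rightarrow> A\<^sub>1\<close> extends to an internal
  functor \<open>2\<^sub>E \<times> disc X \<rightarrow> A\<close> that sends the copy of \<open>X\<close> at \<open>0 \<rightarrow> 1\<close> to \<open>a\<close>. Internal functors out
  of \<open>A\<close> that agree on all of these therefore agree on \<open>A\<^sub>1\<close>, since \<open>\<G>\<close> is generating, and then also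
  on \<open>A\<^sub>0\<close>. For natural transformations take \<open>a\<close> to be the identity at \<open>x : X \<rightarrow> A\<^sub>0\<close>.\<close>

section \<open>Calculus of arrows\<close>

text \<open>Extensivity is a statement about slices, while the proof computes with arrows. Two
  consequences bridge the gap. Essential surjectivity of \<open>coprod_functor\<close> says that an
  arrow into a coproduct splits its domain into pieces, each landing in one summand; fullness says
  that distinct summands are disjoint. So an equation between arrows into copowers of
  \<open>X\<close> can be tested piece by piece: on a piece both sides sit at fixed indices, and
  either the indices agree, which leaves a finite table lookup, or all arrows out of the piece
  coincide. The pullback condition on composable pairs, associativity and the identification of
  \<open>(n \<bullet> 1) \<times> X\<close> with \<open>n \<bullet> X\<close> all go this way.

  The second obstacle is that \<open>prod_ob\<close> is a choice, so that nothing but its universal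
  property is known about the member of the family at \<open>X\<close>. The computation is therefore
  done in an explicit product \<open>Q\<close>, built from products of the components, and carried
  over along the comparison functors between the two.\<close>

context category
begin

lemma mem_hom_iff: "f \<in> hom C A B \<longleftrightarrow> f \<in> Ar C \<and> Src C f = A \<and> Tgt C f = B"
  by (simp add: hom_def)

lemma Cmp_simps [simp]:
  assumes "f \<in> Ar C" "g \<in> Ar C" "Tgt C f = Src C g"
  shows "g \<cdot> f \<in> Ar C" "Src C (g \<cdot> f) = Src C f" "Tgt C (g \<cdot> f) = Tgt C g"
  using Cmp_in[of f "Src C f" "Tgt C f" g "Tgt C g"] assms by (auto simp: mem_hom_iff)

lemma Idn_simps [simp]:
  assumes "A \<in> Ob C"
  shows "Idn C A \<in> Ar C" "Src C (Idn C A) = A" "Tgt C (Idn C A) = A"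
  using Idn_in[OF assms] by (auto simp: mem_hom_iff)

lemma Idn_cancel [simp]:
  assumes "f \<in> Ar C"
  shows "Tgt C f = A \<Longrightarrow> Idn C A \<cdot> f = f" "Src C f = A \<Longrightarrow> f \<cdot> Idn C A = f"
  using Idn_left[of f "Src C f" "Tgt C f"] Idn_right[of f "Src C f" "Tgt C f"] assms
  by (auto simp: mem_hom_iff)

lemma assoc [simp]:
  assumes "f \<in> Ar C" "g \<in> Ar C" "h \<in> Ar C" "Tgt C f = Src C g" "Tgt C g = Src C h"
  shows "(h \<cdot> g) \<cdot> f = h \<cdot> (g \<cdot> f)"
  by (rule Cmp_assoc[of f "Src C f" "Tgt C f" g "Tgt C g" h "Tgt C h"])
     (use assms in \<open>auto simp: mem_hom_iff\<close>)

text \<open>The simp rule \<open>assoc\<close> brackets every composite to the right, where an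
  equation for \<open>g \<cdot> f\<close> no longer matches a subterm. This form applies it at the
  head of a longer composite; \<open>square_reassoc\<close> does the same for a commuting
  square.\<close>

lemma reassoc:
  assumes "g \<cdot> f = k" "f \<in> Ar C" "g \<in> Ar C" "Tgt C f = Src C g" "x \<in> Ar C" "Tgt C x = Src C f"
  shows "g \<cdot> (f \<cdot> x) = k \<cdot> x"
  using assms assoc[of x f g] by simp

lemma square_reassoc:
  assumes "g \<cdot> f = k \<cdot> h" "f \<in> Ar C" "g \<in> Ar C" "h \<in> Ar C" "k \<in> Ar C"
    "Tgt C f = Src C g" "Tgt C h = Src C k" "Src C f = Src C h" "x \<in> Ar C" "Tgt C x = Src C f"
  shows "g \<cdot> (f \<cdot> x) = k \<cdot> (h \<cdot> x)"
  using assms assoc[of x f g] assoc[of x h k] by simp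

lemma is_isoE:
  assumes "is_iso C f"
  obtains g where "g \<in> Ar C" "Src C g = Tgt C f" "Tgt C g = Src C f"
    "g \<cdot> f = Idn C (Src C f)" "f \<cdot> g = Idn C (Tgt C f)" "f \<in> Ar C"
  using assms by (auto simp: is_iso_def mem_hom_iff)

end

subsection \<open>Equivalences\<close>

lemma equivalence_ess_surj:
  assumes "is_equivalence C D F" "d \<in> Ob D"
  obtains c i where "c \<in> Ob C" "is_iso D i" "i \<in> hom D (FOb F c) d"
proof -
  obtain G \<epsilon> where G: "is_functor D C G" "is_nat_trans D D (comp_func F G) id_func \<epsilon>"
    "\<forall>A\<in>Ob D. is_iso D (\<epsilon> A)"
    using assms(1) by (auto simp: is_equivalence_def naturally_isomorphic_def)
  show thesis
    by (rule that[of "FOb G d" "\<epsilon> d"])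
       (use G assms(2) in \<open>auto simp: is_functor_def is_nat_trans_def comp_func_def id_func_def\<close>)
qed

text \<open>Naturality gives \<open>\<eta> B \<cdot> T f = f \<cdot> \<eta> A\<close>, and
  \<open>\<eta> A\<close> can be cancelled on the right. Applied to \<open>T = F G\<close>, it shows
  that a quasi-inverse \<open>G\<close> is faithful.\<close>

lemma nat_iso_id_faithful:
  assumes "category C" "naturally_isomorphic C C T id_func"
    and "f \<in> hom C A B" "g \<in> hom C A B" "FAr T f = FAr T g" "is_functor C C T"
  shows "f = g"
proof -
  interpret category C by fact
  obtain \<eta> where \<eta>: "is_nat_trans C C T id_func \<eta>" "\<forall>A\<in>Ob C. is_iso C (\<eta> A)"
    using assms(2) by (auto simp: naturally_isomorphic_def)
  have AB: "A \<in> Ob C" "B \<in> Ob C" using assms(3) by (auto simp: mem_hom_iff)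
  obtain i where i: "i \<in> Ar C" "Src C i = Tgt C (\<eta> A)" "Tgt C i = Src C (\<eta> A)"
    "\<eta> A \<cdot>\<^bsub>C\<^esub> i = Idn C (Tgt C (\<eta> A))" "\<eta> A \<in> Ar C"
    using \<eta>(2) AB by (metis is_isoE)
  have nat: "\<eta> B \<cdot>\<^bsub>C\<^esub> FAr T h = h \<cdot>\<^bsub>C\<^esub> \<eta> A" if "h \<in> hom C A B" for h
    using \<eta>(1) that by (auto simp: is_nat_trans_def mem_hom_iff id_func_def)
  have tA: "Tgt C (\<eta> A) = A"
    using \<eta>(1) AB by (auto simp: is_nat_trans_def mem_hom_iff id_func_def)
  have "f \<cdot>\<^bsub>C\<^esub> \<eta> A = g \<cdot>\<^bsub>C\<^esub> \<eta> A"
    using nat[OF assms(3)] nat[OF assms(4)] assms(5) by simp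
  then have "(f \<cdot>\<^bsub>C\<^esub> \<eta> A) \<cdot>\<^bsub>C\<^esub> i = (g \<cdot>\<^bsub>C\<^esub> \<eta> A) \<cdot>\<^bsub>C\<^esub> i" by simp
  then show ?thesis using i assms(3,4) tA by (simp add: mem_hom_iff)
qed

lemma is_functor_comp:
  assumes "is_functor C D F" "is_functor D K G" "category C"
  shows "is_functor C K (comp_func G F)"
proof -
  interpret category C by fact
  show ?thesis
    using assms(1,2) unfolding is_functor_def comp_func_def hom_def
    by (simp add: Src_in Tgt_in)
qed

text \<open>With \<open>G\<close> a quasi-inverse and \<open>\<eta>\<close> the isomorphism from
  \<open>G F\<close> to the identity, the preimage of \<open>k\<close> is the conjugate of
  \<open>G k\<close> by \<open>\<eta>\<close>. Naturality of \<open>\<eta>\<close> at this arrow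
  yields \<open>G (F h) = G k\<close>, and \<open>G\<close> is faithful since \<open>F G\<close> is
  also isomorphic to the identity.\<close>

lemma equivalence_full:
  assumes eq: "is_equivalence C D F" and cats: "category C" "category D"
    and xy: "x \<in> Ob C" "y \<in> Ob C" and k: "k \<in> hom D (FOb F x) (FOb F y)"
  obtains h where "h \<in> hom C x y" "FAr F h = k"
proof -
  interpret C: category C by fact
  interpret D: category D by fact
  obtain G \<eta> where F: "is_functor C D F" and G: "is_functor D C G"
    and \<eta>: "is_nat_trans C C (comp_func G F) id_func \<eta>" "\<forall>A\<in>Ob C. is_iso C (\<eta> A)"
    and \<epsilon>: "naturally_isomorphic D D (comp_func F G) id_func"
    using eq by (auto simp: is_equivalence_def naturally_isomorphic_def)
  have \<eta>_hom: "\<eta> A \<in> Ar C" "Src C (\<eta> A) = FOb G (FOb F A)" "Tgt C (\<eta> A) = A" if "A \<in> Ob C" for A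
    using \<eta>(1) that by (auto simp: is_nat_trans_def comp_func_def id_func_def hom_def)
  obtain i where i: "i \<in> Ar C" "Src C i = x" "Tgt C i = FOb G (FOb F x)"
    "i \<cdot>\<^bsub>C\<^esub> \<eta> x = Idn C (FOb G (FOb F x))"
    using \<eta>(2) xy(1) \<eta>_hom[OF xy(1)] by (metis C.is_isoE)
  obtain j where j: "j \<in> Ar C" "Src C j = y" "Tgt C j = FOb G (FOb F y)"
    "j \<cdot>\<^bsub>C\<^esub> \<eta> y = Idn C (FOb G (FOb F y))"
    using \<eta>(2) xy(2) \<eta>_hom[OF xy(2)] by (metis C.is_isoE)
  have Gk: "FAr G k \<in> Ar C" "Src C (FAr G k) = FOb G (FOb F x)" "Tgt C (FAr G k) = FOb G (FOb F y)"
    using G k by (auto simp: is_functor_def hom_def)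
  define h where "h = \<eta> y \<cdot>\<^bsub>C\<^esub> (FAr G k \<cdot>\<^bsub>C\<^esub> i)"
  have h: "h \<in> Ar C" "Src C h = x" "Tgt C h = y"
    unfolding h_def using i Gk \<eta>_hom xy by simp_all
  have Fh: "FAr F h \<in> hom D (FOb F x) (FOb F y)"
    using F h by (auto simp: is_functor_def)
  have GFh: "FAr G (FAr F h) \<in> Ar C" "Src C (FAr G (FAr F h)) = FOb G (FOb F x)"
    "Tgt C (FAr G (FAr F h)) = FOb G (FOb F y)"
    using G Fh by (auto simp: is_functor_def hom_def)
  have "\<eta> y \<cdot>\<^bsub>C\<^esub> FAr G (FAr F h) = h \<cdot>\<^bsub>C\<^esub> \<eta> x"
    using \<eta>(1) h by (auto simp: is_nat_trans_def comp_func_def id_func_def)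
  also have "\<dots> = \<eta> y \<cdot>\<^bsub>C\<^esub> FAr G k"
    unfolding h_def using i Gk \<eta>_hom xy by simp
  finally have "j \<cdot>\<^bsub>C\<^esub> (\<eta> y \<cdot>\<^bsub>C\<^esub> FAr G (FAr F h)) = j \<cdot>\<^bsub>C\<^esub> (\<eta> y \<cdot>\<^bsub>C\<^esub> FAr G k)"
    by simp
  then have eqG: "FAr G (FAr F h) = FAr G k"
    using C.reassoc[OF j(4)] j \<eta>_hom xy GFh Gk by simp
  have "FAr F h = k"
    by (rule nat_iso_id_faithful[OF cats(2) \<epsilon> Fh k])
       (use eqG is_functor_comp[OF G F cats(2)] in \<open>simp_all add: comp_func_def\<close>)
  then show thesis using that h by (simp add: hom_def)
qed

subsection \<open>Coproducts\<close>

lemma coproduct_cotuple: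
  assumes "is_coproduct C I X S \<iota>" "T \<in> Ob C" "\<And>i. i \<in> I \<Longrightarrow> f i \<in> hom C (X i) T"
  obtains h where "h \<in> hom C S T" "\<And>i. i \<in> I \<Longrightarrow> h \<cdot>\<^bsub>C\<^esub> \<iota> i = f i"
  using assms unfolding is_coproduct_def by metis

lemma coproduct_inj:
  assumes "is_coproduct C I X S \<iota>" "i \<in> I"
  shows "\<iota> i \<in> Ar C" "Src C (\<iota> i) = X i" "Tgt C (\<iota> i) = S"
  using assms by (auto simp: is_coproduct_def hom_def)

context category
begin

lemma coproduct_eqI:
  assumes "is_coproduct C I X S \<iota>" "h \<in> hom C S T" "h' \<in> hom C S T"
    and "\<And>i. i \<in> I \<Longrightarrow> h \<cdot> \<iota> i = h' \<cdot> \<iota> i"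
  shows "h = h'"
proof -
  have "T \<in> Ob C" using assms(2) by (auto simp: mem_hom_iff)
  moreover have "\<forall>i\<in>I. h \<cdot> \<iota> i \<in> hom C (X i) T"
    using coproduct_inj[OF assms(1)] assms(2) by (auto simp: mem_hom_iff)
  ultimately have "\<exists>!k. k \<in> hom C S T \<and> (\<forall>i\<in>I. k \<cdot> \<iota> i = h \<cdot> \<iota> i)"
    using assms(1)[unfolded is_coproduct_def, THEN conjunct2, THEN conjunct2,
        THEN spec[of _ T], THEN spec[of _ "\<lambda>i. h \<cdot> \<iota> i"]] by blast
  then show ?thesis using assms(2-4) by metis
qed

lemma coproductI:
  assumes "S \<in> Ob C" "\<And>i. i \<in> I \<Longrightarrow> \<iota> i \<in> hom C (X i) S"
    and "\<And>T f. T \<in> Ob C \<Longrightarrow> (\<And>i. i \<in> I \<Longrightarrow> f i \<in> hom C (X i) T) \<Longrightarrow>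
           \<exists>h \<in> hom C S T. \<forall>i\<in>I. h \<cdot> \<iota> i = f i"
    and "\<And>T h h'. h \<in> hom C S T \<Longrightarrow> h' \<in> hom C S T \<Longrightarrow> (\<And>i. i \<in> I \<Longrightarrow> h \<cdot> \<iota> i = h' \<cdot> \<iota> i)
           \<Longrightarrow> h = h'"
  shows "is_coproduct C I X S \<iota>"
  unfolding is_coproduct_def
proof (intro conjI allI impI ballI assms(1,2))
  fix T f assume *: "T \<in> Ob C \<and> (\<forall>i\<in>I. f i \<in> hom C (X i) T)"
  obtain h where h: "h \<in> hom C S T" "\<forall>i\<in>I. h \<cdot> \<iota> i = f i" using assms(3)[of T f] * by auto
  then show "\<exists>!h. h \<in> hom C S T \<and> (\<forall>i\<in>I. h \<cdot> \<iota> i = f i)"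
    by (intro ex1I[of _ h]) (auto intro: assms(4))
qed

text \<open>Finite coproducts are given over \<open>{..<n}\<close>, the chosen binary ones over
  \<open>bool\<close>; a bijection of index sets passes from the one form to the other.\<close>

lemma coproduct_reindex:
  assumes c: "is_coproduct C I X S \<iota>" and \<sigma>: "bij_betw \<sigma> J I"
  shows "is_coproduct C J (\<lambda>j. X (\<sigma> j)) S (\<lambda>j. \<iota> (\<sigma> j))"
proof (rule coproductI)
  show "S \<in> Ob C" using c by (simp add: is_coproduct_def)
  show "\<iota> (\<sigma> j) \<in> hom C (X (\<sigma> j)) S" if "j \<in> J" for j
    using c \<sigma> that by (auto simp: is_coproduct_def bij_betw_def)
next
  fix T f assume T: "T \<in> Ob C" and f: "\<And>j. j \<in> J \<Longrightarrow> f j \<in> hom C (X (\<sigma> j)) T"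
  define \<tau> where "\<tau> = inv_into J \<sigma>"
  have \<tau>: "\<And>i. i \<in> I \<Longrightarrow> \<tau> i \<in> J \<and> \<sigma> (\<tau> i) = i" "\<And>j. j \<in> J \<Longrightarrow> \<tau> (\<sigma> j) = j \<and> \<sigma> j \<in> I"
    using \<sigma> unfolding \<tau>_def bij_betw_def by (auto simp: inv_into_into f_inv_into_f)
  have f\<tau>: "f (\<tau> i) \<in> hom C (X i) T" if "i \<in> I" for i
    using f[of "\<tau> i"] \<tau>(1)[OF that] by simp
  obtain h where "h \<in> hom C S T" "\<And>i. i \<in> I \<Longrightarrow> h \<cdot> \<iota> i = f (\<tau> i)"
    using coproduct_cotuple[OF c T f\<tau>] by blast
  then show "\<exists>h\<in>hom C S T. \<forall>j\<in>J. h \<cdot> \<iota> (\<sigma> j) = f j"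
    using \<tau>(2) by (intro bexI[of _ h]) auto
next
  fix T h h' assume *: "h \<in> hom C S T" "h' \<in> hom C S T"
    "\<And>j. j \<in> J \<Longrightarrow> h \<cdot> \<iota> (\<sigma> j) = h' \<cdot> \<iota> (\<sigma> j)"
  show "h = h'"
  proof (rule coproduct_eqI[OF c *(1,2)])
    fix i assume "i \<in> I"
    then obtain j where "j \<in> J" "i = \<sigma> j" using \<sigma> unfolding bij_betw_def by blast
    then show "h \<cdot> \<iota> i = h' \<cdot> \<iota> i" using *(3) by simp
  qed
qed

lemma coproduct_iso:
  assumes c: "is_coproduct C I X S \<iota>"
    and \<theta>: "\<theta> \<in> hom C S T" "\<theta>' \<in> hom C T S" "\<theta>' \<cdot> \<theta> = Idn C S" "\<theta> \<cdot> \<theta>' = Idn C T"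
  shows "is_coproduct C I X T (\<lambda>i. \<theta> \<cdot> \<iota> i)"
proof (rule coproductI)
  note inj = coproduct_inj[OF c]
  note t = \<theta>[unfolded mem_hom_iff]
  show "T \<in> Ob C" using t by auto
  show "\<theta> \<cdot> \<iota> i \<in> hom C (X i) T" if "i \<in> I" for i
    using inj[OF that] t by (simp add: mem_hom_iff)
  show "\<exists>h\<in>hom C T Z. \<forall>i\<in>I. h \<cdot> (\<theta> \<cdot> \<iota> i) = f i"
    if Z: "Z \<in> Ob C" and f: "\<And>i. i \<in> I \<Longrightarrow> f i \<in> hom C (X i) Z" for Z f
  proof -
    obtain h where h: "h \<in> hom C S Z" "\<And>i. i \<in> I \<Longrightarrow> h \<cdot> \<iota> i = f i"
      using coproduct_cotuple[OF c Z f] by blast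
    show ?thesis
      by (rule bexI[of _ "h \<cdot> \<theta>'"])
         (use h inj t reassoc[OF t(3)] in \<open>auto simp: mem_hom_iff\<close>)
  qed
  show "h = h'" if h: "h \<in> hom C T Z" "h' \<in> hom C T Z"
    and eq: "\<And>i. i \<in> I \<Longrightarrow> h \<cdot> (\<theta> \<cdot> \<iota> i) = h' \<cdot> (\<theta> \<cdot> \<iota> i)" for Z h h'
  proof -
    have "h \<cdot> \<theta> = h' \<cdot> \<theta>"
      by (rule coproduct_eqI[OF c]) (use h t inj eq in \<open>auto simp: mem_hom_iff\<close>)
    then have "(h \<cdot> \<theta>) \<cdot> \<theta>' = (h' \<cdot> \<theta>) \<cdot> \<theta>'" by simp
    then show ?thesis using h t by (simp add: mem_hom_iff)
  qed
qed

text \<open>An iterated coproduct is a coproduct over pairs of indices. It serves to split one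
  object along two arrows at once.\<close>

lemma coproduct_Sigma:
  assumes c: "is_coproduct C I X S \<iota>"
    and d: "\<And>i. i \<in> I \<Longrightarrow> is_coproduct C (J i) (Y i) (X i) (\<kappa> i)"
  shows "is_coproduct C (Sigma I J) (\<lambda>(i, j). Y i j) S (\<lambda>(i, j). \<iota> i \<cdot> \<kappa> i j)"
proof (rule coproductI)
  note inj = coproduct_inj[OF c]
  note dinj = coproduct_inj[OF d]
  show "S \<in> Ob C" using c by (simp add: is_coproduct_def)
  show "(case p of (i, j) \<Rightarrow> \<iota> i \<cdot> \<kappa> i j) \<in> hom C (case p of (i, j) \<Rightarrow> Y i j) S"
    if "p \<in> Sigma I J" for p
    using that inj dinj by (auto simp: mem_hom_iff)
  show "\<exists>h\<in>hom C S Z. \<forall>p\<in>Sigma I J. h \<cdot> (case p of (i, j) \<Rightarrow> \<iota> i \<cdot> \<kappa> i j) = f p"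
    if Z: "Z \<in> Ob C" and f: "\<And>p. p \<in> Sigma I J \<Longrightarrow> f p \<in> hom C (case p of (i, j) \<Rightarrow> Y i j) Z"
    for Z f
  proof -
    have "\<exists>g. g \<in> hom C (X i) Z \<and> (\<forall>j\<in>J i. g \<cdot> \<kappa> i j = f (i, j))" if "i \<in> I" for i
      by (rule coproduct_cotuple[OF d[OF that] Z, of "\<lambda>j. f (i, j)"]) (use f that in force)+
    then obtain g where g: "\<And>i. i \<in> I \<Longrightarrow> g i \<in> hom C (X i) Z"
      "\<And>i j. i \<in> I \<Longrightarrow> j \<in> J i \<Longrightarrow> g i \<cdot> \<kappa> i j = f (i, j)" by metis
    obtain h where h: "h \<in> hom C S Z" "\<And>i. i \<in> I \<Longrightarrow> h \<cdot> \<iota> i = g i"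
      using coproduct_cotuple[OF c Z g(1)] by blast
    show ?thesis
      by (rule bexI[of _ h])
         (use h g inj dinj reassoc[OF h(2)] in \<open>auto simp: mem_hom_iff\<close>)
  qed
  show "h = h'" if h: "h \<in> hom C S Z" "h' \<in> hom C S Z"
    and eq: "\<And>p. p \<in> Sigma I J \<Longrightarrow>
      h \<cdot> (case p of (i, j) \<Rightarrow> \<iota> i \<cdot> \<kappa> i j) = h' \<cdot> (case p of (i, j) \<Rightarrow> \<iota> i \<cdot> \<kappa> i j)" for Z h h'
  proof (rule coproduct_eqI[OF c h])
    fix i assume i: "i \<in> I"
    show "h \<cdot> \<iota> i = h' \<cdot> \<iota> i"
    proof (rule coproduct_eqI[OF d[OF i]])
      show "(h \<cdot> \<iota> i) \<cdot> \<kappa> i j = (h' \<cdot> \<iota> i) \<cdot> \<kappa> i j" if "j \<in> J i" for j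
        using eq[of "(i, j)"] i that h inj dinj by (simp add: mem_hom_iff)
    qed (use h i inj in \<open>auto simp: mem_hom_iff\<close>)
  qed
qed

end


subsection \<open>Slices and extensivity\<close>

context category
begin

lemma slice_hom_iff:
  "u \<in> hom (slice C A) f g \<longleftrightarrow> (\<exists>h. u = (f, h, g) \<and> f \<in> Ar C \<and> g \<in> Ar C \<and>
     Tgt C f = A \<and> Tgt C g = A \<and> h \<in> hom C (Src C f) (Src C g) \<and> g \<cdot> h = f)"
  by (cases u) (force simp only: slice_def hom_def mem_Collect_eq cat.simps split_conv prod.inject)

lemma category_slice:
  assumes "A \<in> Ob C"
  shows "category (slice C A)"
proof unfold_locales
  show "Cmp (slice C A) v u \<in> hom (slice C A) f k"
    if uv: "u \<in> hom (slice C A) f g" "v \<in> hom (slice C A) g k" for u v f g k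
  proof -
    from uv obtain h l where h: "u = (f, h, g)" "h \<in> hom C (Src C f) (Src C g)" "g \<cdot> h = f" "f \<in> Ar C"
      "Tgt C f = A" and l: "v = (g, l, k)" "l \<in> hom C (Src C g) (Src C k)" "k \<cdot> l = g" "k \<in> Ar C"
      "Tgt C k = A" unfolding slice_hom_iff by blast
    have "k \<cdot> (l \<cdot> h) = f"
      using reassoc[OF l(3), of h] l(2,4) h(2,3) by (simp only: mem_hom_iff)
    then show ?thesis
      unfolding slice_hom_iff using h l Cmp_in[OF h(2) l(2)]
      by (simp only: slice_def cat.simps split_conv) blast
  qed
  show "Cmp (slice C A) (Cmp (slice C A) w v) u = Cmp (slice C A) w (Cmp (slice C A) v u)"
    if uvw: "u \<in> hom (slice C A) f g" "v \<in> hom (slice C A) g k" "w \<in> hom (slice C A) k l"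
    for u v w f g k l
    using uvw unfolding slice_hom_iff
    by (elim exE conjE) (simp only: slice_def cat.simps split_conv prod.inject Cmp_assoc)
  show "Src (slice C A) u \<in> Ob (slice C A)" "Tgt (slice C A) u \<in> Ob (slice C A)"
    if "u \<in> Ar (slice C A)" for u
    using that by (cases u; clarsimp simp: slice_def simp del: assoc)+
  show "Idn (slice C A) f \<in> hom (slice C A) f f" if "f \<in> Ob (slice C A)" for f
    using that by (simp add: slice_def hom_def)
  show "Cmp (slice C A) (Idn (slice C A) g) u = u" "Cmp (slice C A) u (Idn (slice C A) f) = u"
    if "u \<in> hom (slice C A) f g" for u f g
    using that unfolding slice_hom_iff
    by (elim exE conjE; simp only: slice_def cat.simps split_conv Idn_left Idn_right)+
qed

lemma category_prod_cat:
  assumes "category D"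
  shows "category (prod_cat C D)"
proof -
  interpret D: category D by fact
  show ?thesis
    by unfold_locales (auto simp: prod_cat_def hom_def)
qed

end

section \<open>Binary coproducts\<close>

abbreviation is_binary_coproduct ::
    "('o, 'm) cat \<Rightarrow> 'o \<Rightarrow> 'o \<Rightarrow> 'o \<Rightarrow> 'm \<Rightarrow> 'm \<Rightarrow> bool" where
  "is_binary_coproduct C A B S i j \<equiv>
     is_coproduct C (UNIV :: bool set) (\<lambda>b. if b then A else B) S (\<lambda>b. if b then i else j)"

lemma binary_coproduct_cotuple:
  assumes "is_binary_coproduct C A B S i j" "T \<in> Ob C" "f \<in> hom C A T" "g \<in> hom C B T"
  obtains h where "h \<in> hom C S T" "h \<cdot>\<^bsub>C\<^esub> i = f" "h \<cdot>\<^bsub>C\<^esub> j = g"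
proof -
  obtain h where "h \<in> hom C S T"
    "\<And>b. b \<in> UNIV \<Longrightarrow> h \<cdot>\<^bsub>C\<^esub> (if b then i else j) = (if b then f else g)"
    by (rule coproduct_cotuple[OF assms(1,2), of "\<lambda>b. if b then f else g"])
       (use assms(3,4) in \<open>auto split: if_splits\<close>)
  from this(1) this(2)[of True] this(2)[of False] show thesis using that by simp
qed

lemma binary_coproduct_inj:
  assumes "is_binary_coproduct C A B S i j"
  shows "i \<in> Ar C" "Src C i = A" "Tgt C i = S" "j \<in> Ar C" "Src C j = B" "Tgt C j = S"
  using coproduct_inj[OF assms, of True] coproduct_inj[OF assms, of False] by simp_all

lemma (in category) binary_coproduct_eqI:
  assumes "is_binary_coproduct C A B S i j" "h \<in> hom C S T" "h' \<in> hom C S T"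
    and "h \<cdot> i = h' \<cdot> i" "h \<cdot> j = h' \<cdot> j"
  shows "h = h'"
  by (rule coproduct_eqI[OF assms(1-3)]) (use assms(4,5) in auto)

section \<open>Splitting and disjointness in an extensive category\<close>

locale extensive_category = category E for E :: "('o, 'm) cat" (structure) +
  assumes extensive: "has_extensive_coproducts E"
begin

lemma finite_coproducts: "has_finite_coproducts E"
  using extensive by (simp add: has_extensive_coproducts_def)

lemma coproduct_exists:
  assumes "\<And>i. i < (n :: nat) \<Longrightarrow> X i \<in> Ob E"
  obtains S \<iota> where "is_coproduct E {..<n} X S \<iota>"
  using finite_coproducts assms unfolding has_finite_coproducts_def by blast

text \<open>\<open>coproduct_of\<close> chooses by \<open>SOME\<close>, so a coproduct has to be
  exhibited first: the one over \<open>{..<2}\<close>, reindexed by \<open>bool\<close>.\<close>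

lemma chosen_coproduct:
  assumes "A \<in> Ob E" "B \<in> Ob E"
  shows "is_binary_coproduct E A B (coprod_ob E A B) (coprod_inl E A B) (coprod_inr E A B)"
proof -
  have X: "\<And>i. i < (2::nat) \<Longrightarrow> (if i = 0 then A else B) \<in> Ob E" using assms by simp
  obtain S \<iota> where "is_coproduct E {..<2::nat} (\<lambda>i. if i = 0 then A else B) S \<iota>"
    by (rule coproduct_exists[OF X])
  moreover have "bij_betw (\<lambda>b. if b then 0 else 1) UNIV {..<2::nat}"
    by (auto simp: bij_betw_def inj_on_def image_iff less_2_cases_iff)
  ultimately have "is_coproduct E UNIV (\<lambda>b. if (if b then 0 else 1) = (0::nat) then A else B) S
     (\<lambda>b. \<iota> (if b then 0 else 1))"
    by (rule coproduct_reindex)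
  moreover have "(\<lambda>b. if (if b then 0 else 1) = (0::nat) then A else B) = (\<lambda>b. if b then A else B)"
    "(\<lambda>b. \<iota> (if b then 0 else 1)) = (\<lambda>b. if b then \<iota> 0 else \<iota> 1)" by auto
  ultimately have "is_binary_coproduct E A B S (\<iota> 0) (\<iota> 1)" by (simp only:)
  then have "case (S, \<iota> 0, \<iota> 1) of (S, i, j) \<Rightarrow> is_binary_coproduct E A B S i j"
    by (simp only: split_conv)
  then have "case coproduct_of E A B of (S, i, j) \<Rightarrow> is_binary_coproduct E A B S i j"
    unfolding coproduct_of_def by (rule someI)
  then show ?thesis
    unfolding coprod_ob_def coprod_inl_def coprod_inr_def case_prod_beta .
qed

lemma coprod_map:
  assumes f: "f \<in> hom E X A" and g: "g \<in> hom E Y B"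
  shows "coprod_map E f g \<in> hom E (coprod_ob E X Y) (coprod_ob E A B)"
    "coprod_map E f g \<cdot> coprod_inl E X Y = coprod_inl E A B \<cdot> f"
    "coprod_map E f g \<cdot> coprod_inr E X Y = coprod_inr E A B \<cdot> g"
proof -
  have obs: "X \<in> Ob E" "Y \<in> Ob E" "A \<in> Ob E" "B \<in> Ob E"
    using f g by (auto simp: mem_hom_iff)
  note XY = chosen_coproduct[OF obs(1,2)] and AB = chosen_coproduct[OF obs(3,4)]
  note inj = binary_coproduct_inj[OF XY] binary_coproduct_inj[OF AB]
  have T: "coprod_ob E A B \<in> Ob E" using inj by (metis Tgt_in)
  obtain h where h: "h \<in> hom E (coprod_ob E X Y) (coprod_ob E A B)"
    "h \<cdot> coprod_inl E X Y = coprod_inl E A B \<cdot> f"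
    "h \<cdot> coprod_inr E X Y = coprod_inr E A B \<cdot> g"
    by (rule binary_coproduct_cotuple[OF XY T, of "coprod_inl E A B \<cdot> f" "coprod_inr E A B \<cdot> g"])
       (use f g inj in \<open>auto simp: mem_hom_iff\<close>)
  have "coprod_map E f g = h"
    unfolding coprod_map_def Let_def
  proof (rule the_equality)
    have ends: "Src E f = X" "Tgt E f = A" "Src E g = Y" "Tgt E g = B"
      using f g by (simp_all add: mem_hom_iff)
    show "h \<in> hom E (coprod_ob E (Src E f) (Src E g)) (coprod_ob E (Tgt E f) (Tgt E g)) \<and>
      h \<cdot> coprod_inl E (Src E f) (Src E g) = coprod_inl E (Tgt E f) (Tgt E g) \<cdot> f \<and>
      h \<cdot> coprod_inr E (Src E f) (Src E g) = coprod_inr E (Tgt E f) (Tgt E g) \<cdot> g"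
      unfolding ends using h by blast
    show "h' = h" if "h' \<in> hom E (coprod_ob E (Src E f) (Src E g)) (coprod_ob E (Tgt E f) (Tgt E g)) \<and>
      h' \<cdot> coprod_inl E (Src E f) (Src E g) = coprod_inl E (Tgt E f) (Tgt E g) \<cdot> f \<and>
      h' \<cdot> coprod_inr E (Src E f) (Src E g) = coprod_inr E (Tgt E f) (Tgt E g) \<cdot> g" for h'
      by (rule binary_coproduct_eqI[OF XY _ h(1)]) (use that h(2,3) in \<open>simp_all only: ends\<close>)
  qed
  then show "coprod_map E f g \<in> hom E (coprod_ob E X Y) (coprod_ob E A B)"
    "coprod_map E f g \<cdot> coprod_inl E X Y = coprod_inl E A B \<cdot> f"
    "coprod_map E f g \<cdot> coprod_inr E X Y = coprod_inr E A B \<cdot> g"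
    using h by auto
qed

lemma slice_equivalence:
  "A \<in> Ob E \<Longrightarrow> B \<in> Ob E \<Longrightarrow>
   is_equivalence (prod_cat (slice E A) (slice E B)) (slice E (coprod_ob E A B)) (coprod_functor E)"
  using extensive by (simp add: has_extensive_coproducts_def)

lemma coprod_ob_in: "A \<in> Ob E \<Longrightarrow> B \<in> Ob E \<Longrightarrow> coprod_ob E A B \<in> Ob E"
  using chosen_coproduct by (simp add: is_coproduct_def)

text \<open>Essential surjectivity of \<open>coprod_functor\<close> at the object \<open>t\<close>
  of the slice: \<open>t\<close> is isomorphic over \<open>A + B\<close> to some
  \<open>f + g\<close>, and the injections into the domain of \<open>f + g\<close> are carried to
  \<open>T\<close> along the isomorphism.\<close>

lemma split_chosen:
  assumes obs: "A \<in> Ob E" "B \<in> Ob E" and t: "t \<in> hom E T (coprod_ob E A B)"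
  obtains X Y i j f g where "is_binary_coproduct E X Y T i j" "f \<in> hom E X A" "g \<in> hom E Y B"
    "t \<cdot> i = coprod_inl E A B \<cdot> f" "t \<cdot> j = coprod_inr E A B \<cdot> g"
proof -
  have "t \<in> Ob (slice E (coprod_ob E A B))" using t by (simp add: slice_def mem_hom_iff)
  from equivalence_ess_surj[OF slice_equivalence[OF obs] this]
  obtain c \<theta> where c: "c \<in> Ob (prod_cat (slice E A) (slice E B))"
    and \<theta>: "is_iso (slice E (coprod_ob E A B)) \<theta>"
      "\<theta> \<in> hom (slice E (coprod_ob E A B)) (FOb (coprod_functor E) c) t" .
  obtain f g where fg: "c = (f, g)" "f \<in> Ar E" "Tgt E f = A" "g \<in> Ar E" "Tgt E g = B"
    using c by (auto simp: prod_cat_def slice_def)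
  define X Y where "X = Src E f" and "Y = Src E g"
  have homs: "f \<in> hom E X A" "g \<in> hom E Y B" using fg by (auto simp: X_def Y_def mem_hom_iff)
  have XY: "X \<in> Ob E" "Y \<in> Ob E" using homs by (auto simp: mem_hom_iff)
  note m = coprod_map[OF homs]
  note cXY = chosen_coproduct[OF XY]
  note inj = binary_coproduct_inj[OF cXY]
  obtain k where k: "\<theta> = (coprod_map E f g, k, t)" "k \<in> hom E (coprod_ob E X Y) T"
    "t \<cdot> k = coprod_map E f g"
    using \<theta>(2) fg(1) t m(1) by (auto simp: coprod_functor_def slice_def hom_def)
  obtain l where l: "l \<in> hom E T (coprod_ob E X Y)"
    "l \<cdot> k = Idn E (coprod_ob E X Y)" "k \<cdot> l = Idn E T"
    using \<theta>(1) t m(1) unfolding k(1) is_iso_def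
    by (auto simp: slice_def hom_def)
  show thesis
  proof (rule that)
    have "(\<lambda>b. k \<cdot> (if b then coprod_inl E X Y else coprod_inr E X Y)) =
      (\<lambda>b. if b then k \<cdot> coprod_inl E X Y else k \<cdot> coprod_inr E X Y)" by auto
    then show "is_binary_coproduct E X Y T (k \<cdot> coprod_inl E X Y) (k \<cdot> coprod_inr E X Y)"
      using coproduct_iso[OF cXY k(2) l] by simp
    show "t \<cdot> (k \<cdot> coprod_inl E X Y) = coprod_inl E A B \<cdot> f"
      "t \<cdot> (k \<cdot> coprod_inr E X Y) = coprod_inr E A B \<cdot> g"
      using reassoc[OF k(3)] t k(2) inj m(2,3) by (auto simp: mem_hom_iff)
  qed (rule homs)+
qed

text \<open>Reduction to the chosen coproduct: \<open>s\<close> and \<open>r\<close> compare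
  \<open>S\<close> with it, the arrow \<open>s \<cdot> t\<close> is split, and
  \<open>r \<cdot> s = Idn E S\<close> brings the resulting squares back to
  \<open>S\<close>.\<close>

lemma split_binary:
  assumes c: "is_binary_coproduct E A B S \<alpha> \<beta>" and t: "t \<in> hom E T S"
  obtains X Y i j f g where "is_binary_coproduct E X Y T i j" "f \<in> hom E X A" "g \<in> hom E Y B"
    "t \<cdot> i = \<alpha> \<cdot> f" "t \<cdot> j = \<beta> \<cdot> g"
proof -
  note inj = binary_coproduct_inj[OF c]
  have obs: "A \<in> Ob E" "B \<in> Ob E" "S \<in> Ob E" using inj by auto
  note d = chosen_coproduct[OF obs(1,2)]
  note dinj = binary_coproduct_inj[OF d]
  obtain s where s: "s \<in> hom E S (coprod_ob E A B)" "s \<cdot> \<alpha> = coprod_inl E A B"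
    "s \<cdot> \<beta> = coprod_inr E A B"
    by (rule binary_coproduct_cotuple[OF c coprod_ob_in[OF obs(1,2)]])
       (use dinj in \<open>auto simp: mem_hom_iff\<close>)
  obtain r where r: "r \<in> hom E (coprod_ob E A B) S" "r \<cdot> coprod_inl E A B = \<alpha>"
    "r \<cdot> coprod_inr E A B = \<beta>"
    by (rule binary_coproduct_cotuple[OF d obs(3)])
       (use inj in \<open>auto simp: mem_hom_iff\<close>)
  have rs: "r \<cdot> s = Idn E S"
    by (rule binary_coproduct_eqI[OF c]) (use r s inj obs in \<open>auto simp: mem_hom_iff\<close>)
  have st: "s \<cdot> t \<in> hom E T (coprod_ob E A B)" using s t by (auto simp: mem_hom_iff)
  obtain X Y i j f g where X: "is_binary_coproduct E X Y T i j" "f \<in> hom E X A" "g \<in> hom E Y B"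
    "(s \<cdot> t) \<cdot> i = coprod_inl E A B \<cdot> f" "(s \<cdot> t) \<cdot> j = coprod_inr E A B \<cdot> g"
    by (rule split_chosen[OF obs(1,2) st])
  note iinj = binary_coproduct_inj[OF X(1)]
  have "r \<cdot> ((s \<cdot> t) \<cdot> i) = t \<cdot> i" "r \<cdot> ((s \<cdot> t) \<cdot> j) = t \<cdot> j"
    using r(1) s(1) t iinj reassoc[OF rs] by (auto simp: mem_hom_iff)
  moreover have "r \<cdot> (coprod_inl E A B \<cdot> f) = \<alpha> \<cdot> f" "r \<cdot> (coprod_inr E A B \<cdot> g) = \<beta> \<cdot> g"
    using r(1) X(2,3) dinj reassoc[OF r(2)] reassoc[OF r(3)] by (auto simp: mem_hom_iff)
  ultimately show thesis using that[OF X(1-3)] X(4,5) by simp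
qed

text \<open>The coproduct of the empty family, so the value \<open>undefined\<close> is never looked
  at.\<close>

lemma initial_exists:
  obtains Z where "Z \<in> Ob E" "\<And>A. A \<in> Ob E \<Longrightarrow> \<exists>z. z \<in> hom E Z A"
    "\<And>A u v. u \<in> hom E Z A \<Longrightarrow> v \<in> hom E Z A \<Longrightarrow> u = v"
proof -
  obtain Z \<iota> where Z: "is_coproduct E {..<0::nat} (\<lambda>_. undefined) Z \<iota>"
    using coproduct_exists[of 0 "\<lambda>_. undefined"] by (metis less_nat_zero_code)
  show thesis
  proof (rule that)
    show "Z \<in> Ob E" using Z by (simp add: is_coproduct_def)
    show "\<exists>z. z \<in> hom E Z A" if "A \<in> Ob E" for A
      by (rule coproduct_cotuple[OF Z that, of undefined]) auto
    show "u = v" if "u \<in> hom E Z A" "v \<in> hom E Z A" for A u v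
      by (rule coproduct_eqI[OF Z that]) simp
  qed
qed

text \<open>If \<open>inl \<circ> f = inr \<circ> g\<close> on \<open>S\<close>, then \<open>S + 0\<close> and \<open>0 + S\<close> are isomorphic over \<open>A + B\<close>.
  By fullness the comparison between them is a coproduct \<open>h + k\<close>, so the right injection
  \<open>S \<rightarrow> 0 + S\<close> factors through \<open>0\<close>.\<close>

lemma coprod_disjoint:
  assumes f: "f \<in> hom E S A" and g: "g \<in> hom E S B"
    and eq: "coprod_inl E A B \<cdot> f = coprod_inr E A B \<cdot> g"
    and uv: "u \<in> hom E S Q" "v \<in> hom E S Q"
  shows "u = v"
proof -
  obtain Z where Z: "Z \<in> Ob E" "\<And>A. A \<in> Ob E \<Longrightarrow> \<exists>z. z \<in> hom E Z A"
    "\<And>A u v. u \<in> hom E Z A \<Longrightarrow> v \<in> hom E Z A \<Longrightarrow> u = v" using initial_exists by blast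
  have obs: "A \<in> Ob E" "B \<in> Ob E" "S \<in> Ob E" "Q \<in> Ob E" using f g uv by (auto simp: mem_hom_iff)
  obtain zA zB zQ where z: "zA \<in> hom E Z A" "zB \<in> hom E Z B" "zQ \<in> hom E Z Q"
    using Z(2)[OF obs(1)] Z(2)[OF obs(2)] Z(2)[OF obs(4)] by auto
  note SZ = chosen_coproduct[OF obs(3) Z(1)] and ZS = chosen_coproduct[OF Z(1) obs(3)]
  note inj = binary_coproduct_inj[OF SZ] binary_coproduct_inj[OF ZS]
    binary_coproduct_inj[OF chosen_coproduct[OF obs(1,2)]]
  have ZSob: "coprod_ob E Z S \<in> Ob E" using coprod_ob_in Z(1) obs(3) by blast
  obtain z' where z': "z' \<in> hom E Z (coprod_ob E Z S)" using Z(2) ZSob by blast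
  have inr_ZS: "coprod_inr E Z S \<in> hom E S (coprod_ob E Z S)" using inj by (simp add: mem_hom_iff)
  obtain \<theta> where \<theta>: "\<theta> \<in> hom E (coprod_ob E S Z) (coprod_ob E Z S)"
    "\<theta> \<cdot> coprod_inl E S Z = coprod_inr E Z S" "\<theta> \<cdot> coprod_inr E S Z = z'"
    by (rule binary_coproduct_cotuple[OF SZ ZSob inr_ZS z'])
  note m1 = coprod_map[OF f z(2)] and m2 = coprod_map[OF z(1) g]
  \<comment> \<open>This is where the assumption \<open>eq\<close> enters: on the summand
    \<open>S\<close> the two sides are \<open>inr \<cdot> g\<close> and
    \<open>inl \<cdot> f\<close>, and on the initial object any two arrows agree.\<close>
  have over: "coprod_map E zA g \<cdot> \<theta> = coprod_map E f zB"
  proof (rule binary_coproduct_eqI[OF SZ])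
    show "coprod_map E zA g \<cdot> \<theta> \<in> hom E (coprod_ob E S Z) (coprod_ob E A B)"
      using m2 \<theta> by (auto simp: mem_hom_iff)
    show "coprod_map E f zB \<in> hom E (coprod_ob E S Z) (coprod_ob E A B)" by (rule m1)
    show "(coprod_map E zA g \<cdot> \<theta>) \<cdot> coprod_inl E S Z = coprod_map E f zB \<cdot> coprod_inl E S Z"
      using \<theta>(1,2) m1(1,2) m2(1,3) inj eq f g by (simp add: mem_hom_iff)
    show "(coprod_map E zA g \<cdot> \<theta>) \<cdot> coprod_inr E S Z = coprod_map E f zB \<cdot> coprod_inr E S Z"
      by (rule Z(3)) (use \<theta>(1) m1(1) m2(1) inj in \<open>simp_all add: mem_hom_iff\<close>)
  qed
  have slice_hom: "(coprod_map E f zB, \<theta>, coprod_map E zA g) \<in> hom (slice E (coprod_ob E A B))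
      (FOb (coprod_functor E) (f, zB)) (FOb (coprod_functor E) (zA, g))"
    using m1(1) m2(1) \<theta>(1) over by (auto simp: coprod_functor_def slice_def hom_def)
  have cats: "category (prod_cat (slice E A) (slice E B))" "category (slice E (coprod_ob E A B))"
    using category_slice obs coprod_ob_in category.category_prod_cat by blast+
  have "(f, zB) \<in> Ob (prod_cat (slice E A) (slice E B))"
    "(zA, g) \<in> Ob (prod_cat (slice E A) (slice E B))"
    using f g z by (auto simp: prod_cat_def slice_def mem_hom_iff)
  from equivalence_full[OF slice_equivalence[OF obs(1,2)] cats this slice_hom]
  obtain h where h: "h \<in> hom (prod_cat (slice E A) (slice E B)) (f, zB) (zA, g)"
    "FAr (coprod_functor E) h = (coprod_map E f zB, \<theta>, coprod_map E zA g)" by blast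
  obtain p q where pq: "h = (p, q)" "p \<in> hom (slice E A) f zA" "q \<in> hom (slice E B) zB g"
    using h(1) by (cases h) (simp add: prod_cat_def hom_def)
  obtain a b where ab: "p = (f, a, zA)" "q = (zB, b, g)"
    "a \<in> hom E (Src E f) (Src E zA)" "b \<in> hom E (Src E zB) (Src E g)"
    using pq(2,3) unfolding slice_hom_iff by blast
  have a: "a \<in> hom E S Z" "b \<in> hom E Z S" "coprod_map E a b = \<theta>"
    using ab(3,4) f g z h(2) unfolding pq(1) ab(1,2)
    by (simp_all add: coprod_functor_def mem_hom_iff)
  have inr: "coprod_inr E Z S = coprod_inl E Z S \<cdot> a"
    using coprod_map(2)[OF a(1,2)] a(3) \<theta>(2) by simp
  \<comment> \<open>Extend \<open>w\<close> to \<open>0 + S\<close> by the arrow \<open>zQ\<close>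
    on \<open>0\<close>. As the right injection is the left one after \<open>a\<close>, this gives
    \<open>w = zQ \<cdot> a\<close>, the same arrow for every \<open>w\<close>.\<close>
  have "w = zQ \<cdot> a" if w: "w \<in> hom E S Q" for w
  proof -
    obtain k where k: "k \<in> hom E (coprod_ob E Z S) Q" "k \<cdot> coprod_inl E Z S = zQ"
      "k \<cdot> coprod_inr E Z S = w"
      by (rule binary_coproduct_cotuple[OF ZS obs(4) z(3) w])
    then show ?thesis
      using inr a(1) inj reassoc[OF k(2)] by (auto simp: mem_hom_iff)
  qed
  then show ?thesis using uv by metis
qed

text \<open>Induction from \<open>split_binary\<close>, with the coproduct of \<open>Suc n\<close>
  objects seen as the coproduct of the first \<open>n\<close> and the last. It starts at
  \<open>n = 1\<close>: for \<open>n = 0\<close> the statement would be strictness of the initial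
  object, a separate fact.\<close>

lemma split_coproduct:
  assumes "is_coproduct E {..<n::nat} X S \<iota>" "n > 0" "t \<in> hom E T S"
  obtains K k a where "is_coproduct E {..<n} K T k"
    "\<And>i. i < n \<Longrightarrow> a i \<in> hom E (K i) (X i)" "\<And>i. i < n \<Longrightarrow> t \<cdot> k i = \<iota> i \<cdot> a i"
proof -
  have "\<exists>K k a. is_coproduct E {..<n} K T k \<and>
    (\<forall>i<n. a i \<in> hom E (K i) (X i) \<and> t \<cdot> k i = \<iota> i \<cdot> a i)"
    using assms(2,1,3)
  proof (induction n arbitrary: S \<iota> t T rule: nat_induct_non_zero)
    case 1
    note inj = coproduct_inj[OF 1(1), of 0, simplified]
    have obs: "S \<in> Ob E" "X 0 \<in> Ob E" "T \<in> Ob E" 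
      using Src_in[OF inj(1)] Tgt_in[OF inj(1)] inj 1(2) by (auto simp: mem_hom_iff)
    \<comment> \<open>The injection of a coproduct of one object is an isomorphism with inverse
      \<open>r\<close>, so \<open>T\<close> is its own single piece, with component
      \<open>r \<cdot> t\<close>.\<close>
    obtain r where r: "r \<in> hom E S (X 0)" "\<And>i. i \<in> {..<1} \<Longrightarrow> r \<cdot> \<iota> i = Idn E (X 0)"
      by (rule coproduct_cotuple[OF 1(1) obs(2), of "\<lambda>_. Idn E (X 0)"])
         (use obs in \<open>auto simp: mem_hom_iff\<close>)
    have \<iota>r: "\<iota> 0 \<cdot> r = Idn E S"
      by (rule coproduct_eqI[OF 1(1)]) (use r inj obs in \<open>auto simp: mem_hom_iff\<close>)
    have "is_coproduct E {..<1::nat} (\<lambda>_. T) T (\<lambda>_. Idn E T)"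
      by (rule coproductI) (use obs in \<open>auto simp: mem_hom_iff\<close>)
    moreover have "t \<cdot> Idn E T = \<iota> 0 \<cdot> (r \<cdot> t)"
      using reassoc[OF \<iota>r] r(1) inj 1(2) by (auto simp: mem_hom_iff)
    moreover have "r \<cdot> t \<in> hom E T (X 0)" using r(1) 1(2) by (auto simp: mem_hom_iff)
    ultimately show ?case
      by (intro exI[of _ "\<lambda>_. T"] exI[of _ "\<lambda>_. Idn E T"] exI[of _ "\<lambda>_. r \<cdot> t"]) auto
  next
    case (Suc n)
    note inj = coproduct_inj[OF Suc.prems(1)]
    have Xob: "\<And>i. i < Suc n \<Longrightarrow> X i \<in> Ob E" using inj by (metis Src_in lessThan_iff)
    obtain S' \<iota>' where S': "is_coproduct E {..<n} X S' \<iota>'"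
      using coproduct_exists[of n X] Xob by (metis less_SucI)
    note inj' = coproduct_inj[OF S']
    have Sob: "S \<in> Ob E" "S' \<in> Ob E" using Suc.prems(1) S' by (auto simp: is_coproduct_def)
    obtain s where s: "s \<in> hom E S' S" "\<And>i. i \<in> {..<n} \<Longrightarrow> s \<cdot> \<iota>' i = \<iota> i"
      by (rule coproduct_cotuple[OF S' Sob(1), of \<iota>]) (use inj in \<open>auto simp: mem_hom_iff\<close>)
    \<comment> \<open>Regroup \<open>S\<close> as \<open>S' + X n\<close>: the binary splitting then
      applies, and the induction hypothesis splits the part over \<open>S'\<close>.\<close>
    have bin: "is_binary_coproduct E S' (X n) S s (\<iota> n)"
    proof (rule coproductI)
      show "(if b then s else \<iota> n) \<in> hom E (if b then S' else X n) S" for b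
        using s inj by (auto simp: mem_hom_iff)
      show "\<exists>h\<in>hom E S T. \<forall>b\<in>UNIV. h \<cdot> (if b then s else \<iota> n) = f b"
        if T: "T \<in> Ob E" and f: "\<And>b. b \<in> UNIV \<Longrightarrow> f b \<in> hom E (if b then S' else X n) T" for T f
      proof -
        have fb: "f True \<in> hom E S' T" "f False \<in> hom E (X n) T"
          using f[of True] f[of False] by auto
        obtain h where h: "h \<in> hom E S T"
          "\<And>i. i \<in> {..<Suc n} \<Longrightarrow> h \<cdot> \<iota> i = (if i = n then f False else f True \<cdot> \<iota>' i)"
          by (rule coproduct_cotuple[OF Suc.prems(1) T,
                of "\<lambda>i. if i = n then f False else f True \<cdot> \<iota>' i"])
             (use fb inj' in \<open>auto simp: mem_hom_iff\<close>)
        have "h \<cdot> s = f True"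
          by (rule coproduct_eqI[OF S'])
             (use h s fb inj inj' in \<open>auto simp: mem_hom_iff\<close>)
        moreover have "h \<cdot> \<iota> n = f False" using h(2)[of n] by simp
        ultimately show ?thesis using h(1) by (intro bexI[of _ h]) auto
      qed
      show "h = h'" if h: "h \<in> hom E S T" "h' \<in> hom E S T"
        and eq: "\<And>b. b \<in> UNIV \<Longrightarrow> h \<cdot> (if b then s else \<iota> n) = h' \<cdot> (if b then s else \<iota> n)"
      for T h h'
      proof (rule coproduct_eqI[OF Suc.prems(1) h])
        fix i assume "i \<in> {..<Suc n}"
        then consider "i = n" | "i < n" by fastforce
        then show "h \<cdot> \<iota> i = h' \<cdot> \<iota> i"
        proof cases
          case 2
          have "(h \<cdot> s) \<cdot> \<iota>' i = (h' \<cdot> s) \<cdot> \<iota>' i" using eq[of True] by simp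
          then show ?thesis using 2 s h inj' by (simp add: mem_hom_iff)
        qed (use eq[of False] in simp)
      qed
    qed (rule Sob)
    obtain T' Tn i j f g where sp: "is_binary_coproduct E T' Tn T i j" "f \<in> hom E T' S'"
      "g \<in> hom E Tn (X n)" "t \<cdot> i = s \<cdot> f" "t \<cdot> j = \<iota> n \<cdot> g"
      by (rule split_binary[OF bin Suc.prems(2)])
    note binj = binary_coproduct_inj[OF sp(1)]
    obtain K k a where K: "is_coproduct E {..<n} K T' k"
      "\<And>l. l < n \<Longrightarrow> a l \<in> hom E (K l) (X l)" "\<And>l. l < n \<Longrightarrow> f \<cdot> k l = \<iota>' l \<cdot> a l"
      using Suc.IH[OF S' sp(2)] by blast
    note kinj = coproduct_inj[OF K(1)]
    define K' k' a' where "K' = (\<lambda>l. if l = n then Tn else K l)"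
      and "k' = (\<lambda>l. if l = n then j else i \<cdot> k l)" and "a' = (\<lambda>l. if l = n then g else a l)"
    have "is_coproduct E {..<Suc n} K' T k'"
    proof (rule coproductI)
      show "T \<in> Ob E" using binj by auto
      show "k' l \<in> hom E (K' l) T" if "l \<in> {..<Suc n}" for l
        using that binj kinj by (auto simp: K'_def k'_def mem_hom_iff less_Suc_eq)
      show "\<exists>h\<in>hom E T Z. \<forall>l\<in>{..<Suc n}. h \<cdot> k' l = w l"
        if Z: "Z \<in> Ob E" and w: "\<And>l. l \<in> {..<Suc n} \<Longrightarrow> w l \<in> hom E (K' l) Z" for Z w
      proof -
        have w'_lt: "w l \<in> hom E (K l) Z" if "l \<in> {..<n}" for l
          using w[of l] that by (simp add: K'_def)
        have w'_n: "w n \<in> hom E Tn Z" using w[of n] by (simp add: K'_def)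
        note w' = w'_lt w'_n
        obtain h' where h': "h' \<in> hom E T' Z" "\<And>l. l \<in> {..<n} \<Longrightarrow> h' \<cdot> k l = w l"
          using coproduct_cotuple[OF K(1) Z w'(1)] by blast
        obtain h where h: "h \<in> hom E T Z" "h \<cdot> i = h'" "h \<cdot> j = w n"
          by (rule binary_coproduct_cotuple[OF sp(1) Z h'(1) w'(2)])
        have "h \<cdot> k' l = w l" if l: "l < Suc n" for l
        proof (cases "l = n")
          case False
          then have l: "l \<in> {..<n}" using l by simp
          have "h \<cdot> (i \<cdot> k l) = h' \<cdot> k l"
            by (rule reassoc[OF h(2)]) (use h(1) binj kinj[OF l] in \<open>simp_all add: mem_hom_iff\<close>)
          then show ?thesis using False h'(2)[OF l] by (simp add: k'_def)
        qed (simp add: k'_def h(3))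
        then show ?thesis using h(1) by blast
      qed
      show "h = h'" if h: "h \<in> hom E T Z" "h' \<in> hom E T Z"
        and eq: "\<And>l. l \<in> {..<Suc n} \<Longrightarrow> h \<cdot> k' l = h' \<cdot> k' l" for Z h h'
      proof (rule binary_coproduct_eqI[OF sp(1) h])
        show "h \<cdot> j = h' \<cdot> j" using eq[of n] by (simp add: k'_def)
        show "h \<cdot> i = h' \<cdot> i"
        proof (rule coproduct_eqI[OF K(1)])
          show "(h \<cdot> i) \<cdot> k l = (h' \<cdot> i) \<cdot> k l" if "l \<in> {..<n}" for l
            using eq[of l] that h binj kinj by (simp add: k'_def mem_hom_iff)
        qed (use h binj in \<open>auto simp: mem_hom_iff\<close>)
      qed
    qed
    moreover have "a' l \<in> hom E (K' l) (X l)" if "l < Suc n" for l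
      using that K(2) sp(3) by (auto simp: a'_def K'_def less_Suc_eq)
    moreover have "t \<cdot> k' l = \<iota> l \<cdot> a' l" if "l < Suc n" for l
    proof (cases "l = n")
      case False
      then have l: "l < n" using that by simp
      have "t \<cdot> (i \<cdot> k l) = s \<cdot> (f \<cdot> k l)"
        using square_reassoc[OF sp(4)] l Suc.prems(2) s(1) sp(2) binj kinj
        by (simp add: mem_hom_iff)
      also have "\<dots> = \<iota> l \<cdot> a l"
        using K(2,3)[OF l] reassoc[OF s(2)] l s(1) inj' by (simp add: mem_hom_iff)
      finally show ?thesis using False by (simp add: k'_def a'_def)
    qed (simp add: k'_def a'_def sp(5))
    ultimately show ?case by blast
  qed
  then show thesis using that by blast
qed

end

section \<open>Terminal objects, binary products and copowers\<close>

context category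
begin

lemma hom_Ob: "f \<in> hom C A B \<Longrightarrow> A \<in> Ob C" "f \<in> hom C A B \<Longrightarrow> B \<in> Ob C"
  by (auto simp: mem_hom_iff)

lemma terminal_unique:
  assumes "is_terminal C U" "f \<in> hom C A U" "g \<in> hom C A U"
  shows "f = g"
proof -
  have "A \<in> Ob C" using assms(2) by (auto simp: mem_hom_iff)
  then show ?thesis using assms unfolding is_terminal_def by blast
qed

lemma product_tuple:
  assumes "is_product C A B P p q" "x \<in> hom C T A" "y \<in> hom C T B"
  obtains h where "h \<in> hom C T P" "p \<cdot> h = x" "q \<cdot> h = y"
  using assms unfolding is_product_def by metis

lemma product_proj:
  assumes "is_product C A B P p q"
  shows "P \<in> Ob C" "p \<in> Ar C" "Src C p = P" "Tgt C p = A" "q \<in> Ar C" "Src C q = P" "Tgt C q = B"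
  using assms by (auto simp: is_product_def mem_hom_iff)

lemma product_eqI:
  assumes P: "is_product C A B P p q" and h: "h \<in> hom C T P" "h' \<in> hom C T P"
    and eq: "p \<cdot> h = p \<cdot> h'" "q \<cdot> h = q \<cdot> h'"
  shows "h = h'"
proof -
  have "p \<cdot> h \<in> hom C T A" "q \<cdot> h \<in> hom C T B"
    using product_proj[OF P] h by (auto simp: mem_hom_iff)
  then have "\<exists>!k. k \<in> hom C T P \<and> p \<cdot> k = p \<cdot> h \<and> q \<cdot> k = q \<cdot> h"
    using P unfolding is_product_def by blast
  then show ?thesis using h eq by metis
qed

lemma product_exists:
  assumes lim: "has_finite_limits C" and A: "A \<in> Ob C" and B: "B \<in> Ob C"
  obtains P p q where "is_product C A B P p q"
proof -
  \<comment> \<open>The discrete category on \<open>0\<close> and \<open>1\<close>, with each object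
    coded as its own identity. Composable arrows are equal, so \<open>Cmp\<close> may return
    either.\<close>
  define J :: "(nat, nat) cat" where
    "J = \<lparr>Ob = {0, 1}, Ar = {0, 1}, Src = id, Tgt = id, Idn = id, Cmp = (\<lambda>g f. f)\<rparr>"
  define D :: "(nat, nat, 'o, 'm) func" where
    "D = \<lparr>FOb = (\<lambda>i. if i = 0 then A else B), FAr = (\<lambda>i. if i = 0 then Idn C A else Idn C B)\<rparr>"
  have "category J" by unfold_locales (auto simp: J_def hom_def)
  moreover have "finite (Ob J)" "finite (Ar J)" by (simp_all add: J_def)
  moreover have "is_functor J C D"
    using A B by (auto simp: is_functor_def J_def D_def mem_hom_iff)
  ultimately obtain L \<pi> where L: "is_limit J C D L \<pi>"
    using lim unfolding has_finite_limits_def by blast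
  have cone: "is_cone J C D M \<mu> \<longleftrightarrow> M \<in> Ob C \<and> \<mu> 0 \<in> hom C M A \<and> \<mu> 1 \<in> hom C M B" for M \<mu>
    using A B by (auto simp: is_cone_def J_def D_def mem_hom_iff)
  have "is_product C A B L (\<pi> 0) (\<pi> 1)"
    unfolding is_product_def
  proof (intro conjI allI impI)
    show "L \<in> Ob C" "\<pi> 0 \<in> hom C L A" "\<pi> 1 \<in> hom C L B"
      using L by (auto simp: is_limit_def cone)
    fix T x y assume xy: "x \<in> hom C T A \<and> y \<in> hom C T B"
    then have "is_cone J C D T (\<lambda>i. if i = 0 then x else y)"
      by (auto simp: cone mem_hom_iff)
    then have "\<exists>!h. h \<in> hom C T L \<and> (\<forall>j\<in>Ob J. \<pi> j \<cdot> h = (if j = 0 then x else y))"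
      using L unfolding is_limit_def by blast
    then show "\<exists>!h. h \<in> hom C T L \<and> \<pi> 0 \<cdot> h = x \<and> \<pi> 1 \<cdot> h = y"
      by (simp add: J_def)
  qed
  then show thesis by (rule that)
qed

text \<open>The codiagonal \<open>r\<close> from the copower to \<open>X\<close> is a left inverse
  of every injection.\<close>

lemma copower_inj_mono:
  assumes c: "is_coproduct C I (\<lambda>_. X) S p" and i: "i \<in> I"
    and f: "f \<in> hom C T X" and g: "g \<in> hom C T X" and eq: "p i \<cdot> f = p i \<cdot> g"
  shows "f = g"
proof -
  have X: "X \<in> Ob C" using f by (auto simp: mem_hom_iff)
  obtain r where r: "r \<in> hom C S X" "\<And>i. i \<in> I \<Longrightarrow> r \<cdot> p i = Idn C X"
    by (rule coproduct_cotuple[OF c X, of "\<lambda>_. Idn C X"]) (use X in \<open>auto simp: mem_hom_iff\<close>)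
  have "r \<cdot> (p i \<cdot> f) = r \<cdot> (p i \<cdot> g)" using eq by simp
  then show ?thesis
    using reassoc[OF r(2)[OF i]] r(1) coproduct_inj[OF c i] f g by (simp add: mem_hom_iff)
qed

end

section \<open>Disjointness, simultaneous splitting and distributivity\<close>

context extensive_category
begin

text \<open>The arrow \<open>r\<close> into \<open>X i + S\<close> sends the summand
  \<open>i\<close> to the left and every other summand \<open>l\<close> to the right through
  \<open>\<iota> l\<close>, which reduces the claim to \<open>coprod_disjoint\<close>. The whole of
  \<open>S\<close> stands in for the coproduct of the other summands, so that this one need not be
  formed.\<close>

lemma coproduct_disjoint:
  assumes c: "is_coproduct E I X S \<iota>" and ij: "i \<in> I" "j \<in> I" "i \<noteq> j"
    and f: "f \<in> hom E T (X i)" and g: "g \<in> hom E T (X j)" and eq: "\<iota> i \<cdot> f = \<iota> j \<cdot> g"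
    and uv: "u \<in> hom E T Q" "v \<in> hom E T Q"
  shows "u = v"
proof -
  note inj = coproduct_inj[OF c]
  have obs: "X i \<in> Ob E" "S \<in> Ob E" using hom_Ob(2)[OF f] c by (simp_all add: is_coproduct_def)
  note dinj = binary_coproduct_inj[OF chosen_coproduct[OF obs]]
  obtain r where r: "r \<in> hom E S (coprod_ob E (X i) S)"
    "\<And>l. l \<in> I \<Longrightarrow> r \<cdot> \<iota> l = (if l = i then coprod_inl E (X i) S else coprod_inr E (X i) S \<cdot> \<iota> l)"
    by (rule coproduct_cotuple[OF c coprod_ob_in[OF obs],
          of "\<lambda>l. if l = i then coprod_inl E (X i) S else coprod_inr E (X i) S \<cdot> \<iota> l"])
       (use inj dinj in \<open>auto simp: mem_hom_iff\<close>)
  have "r \<cdot> (\<iota> i \<cdot> f) = coprod_inl E (X i) S \<cdot> f"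
    by (rule reassoc) (use r ij f inj in \<open>auto simp: mem_hom_iff\<close>)
  moreover have "r \<cdot> (\<iota> j \<cdot> g) = (coprod_inr E (X i) S \<cdot> \<iota> j) \<cdot> g"
    by (rule reassoc) (use r ij g inj in \<open>auto simp: mem_hom_iff\<close>)
  ultimately have "coprod_inl E (X i) S \<cdot> f = coprod_inr E (X i) S \<cdot> (\<iota> j \<cdot> g)"
    using eq inj dinj ij g by (simp add: mem_hom_iff)
  moreover have "\<iota> j \<cdot> g \<in> hom E T S" using inj ij g by (simp add: mem_hom_iff)
  ultimately show ?thesis using coprod_disjoint[OF f] uv by blast
qed

text \<open>Split \<open>T\<close> along \<open>x\<close>, then every piece along the restriction of
  \<open>y\<close>. On the piece \<open>(i, j)\<close> both arrows factor through a single
  injection, so that comparing them starts with comparing indices.\<close>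

lemma split_coproduct_pair:
  assumes c: "is_coproduct E {..<n::nat} X S \<iota>" "n > 0" "x \<in> hom E T S"
    and d: "is_coproduct E {..<m::nat} Y S' \<kappa>" "m > 0" "y \<in> hom E T S'"
  obtains K k a b where "is_coproduct E ({..<n} \<times> {..<m}) K T k"
    "\<And>i j. i < n \<Longrightarrow> j < m \<Longrightarrow> a (i, j) \<in> hom E (K (i, j)) (X i) \<and> b (i, j) \<in> hom E (K (i, j)) (Y j) \<and>
       x \<cdot> k (i, j) = \<iota> i \<cdot> a (i, j) \<and> y \<cdot> k (i, j) = \<kappa> j \<cdot> b (i, j)"
proof -
  obtain K k a where K: "is_coproduct E {..<n} K T k"
    "\<And>i. i < n \<Longrightarrow> a i \<in> hom E (K i) (X i)" "\<And>i. i < n \<Longrightarrow> x \<cdot> k i = \<iota> i \<cdot> a i"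
    using split_coproduct[OF c] by blast
  note kinj = coproduct_inj[OF K(1)]
  have "\<exists>L l b. is_coproduct E {..<m} L (K i) l \<and>
      (\<forall>j<m. b j \<in> hom E (L j) (Y j) \<and> (y \<cdot> k i) \<cdot> l j = \<kappa> j \<cdot> b j)" if i: "i < n" for i
  proof -
    have "y \<cdot> k i \<in> hom E (K i) S'" using kinj i d(3) by (simp add: mem_hom_iff)
    from split_coproduct[OF d(1,2) this] show ?thesis by metis
  qed
  then obtain L l b where L: "\<And>i. i < n \<Longrightarrow> is_coproduct E {..<m} (L i) (K i) (l i)"
    "\<And>i j. i < n \<Longrightarrow> j < m \<Longrightarrow> b i j \<in> hom E (L i j) (Y j)"
    "\<And>i j. i < n \<Longrightarrow> j < m \<Longrightarrow> (y \<cdot> k i) \<cdot> l i j = \<kappa> j \<cdot> b i j" by metis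
  show thesis
  proof (rule that)
    show "is_coproduct E ({..<n} \<times> {..<m}) (\<lambda>(i, j). L i j) T (\<lambda>(i, j). k i \<cdot> l i j)"
      by (rule coproduct_Sigma[OF K(1)]) (use L(1) in simp)
    fix i j assume ij: "i < n" "j < m"
    have lij: "l i j \<in> Ar E" "Src E (l i j) = L i j" "Tgt E (l i j) = K i"
      using coproduct_inj[OF L(1)[OF ij(1)]] ij by auto
    have "x \<cdot> (k i \<cdot> l i j) = \<iota> i \<cdot> (a i \<cdot> l i j)"
      by (rule square_reassoc[OF K(3)])
         (use ij lij kinj K(2) c(3) coproduct_inj[OF c(1)] in \<open>auto simp: mem_hom_iff\<close>)
    then show "(\<lambda>(i, j). a i \<cdot> l i j) (i, j) \<in> hom E ((\<lambda>(i, j). L i j) (i, j)) (X i) \<and>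
       (\<lambda>(i, j). b i j) (i, j) \<in> hom E ((\<lambda>(i, j). L i j) (i, j)) (Y j) \<and>
       x \<cdot> (\<lambda>(i, j). k i \<cdot> l i j) (i, j) = \<iota> i \<cdot> (\<lambda>(i, j). a i \<cdot> l i j) (i, j) \<and>
       y \<cdot> (\<lambda>(i, j). k i \<cdot> l i j) (i, j) = \<kappa> j \<cdot> (\<lambda>(i, j). b i j) (i, j)"
      using ij lij kinj K(2) L(2,3)[OF ij] d(3) by (auto simp: mem_hom_iff)
  qed
qed

text \<open>This is \<open>(n \<bullet> 1) \<times> X = n \<bullet> X\<close>. Splitting
  \<open>P\<close> along \<open>\<pi>\<close> writes it as a coproduct of pieces \<open>K i\<close>;
  the task is to replace these by copies of \<open>X\<close>, where \<open>j i\<close> is the arrow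
  with components \<open>p i \<cdot> b\<close> and the identity.\<close>

lemma copower_terminal_product:
  assumes S: "is_coproduct E {..<n::nat} (\<lambda>_. U) S p" "n > 0" and U: "is_terminal E U"
    and P: "is_product E S X P \<pi> \<rho>" and b: "b \<in> hom E X U"
    and j: "\<And>i. i < n \<Longrightarrow> j i \<in> hom E X P" "\<And>i. i < n \<Longrightarrow> \<pi> \<cdot> j i = p i \<cdot> b"
      "\<And>i. i < n \<Longrightarrow> \<rho> \<cdot> j i = Idn E X"
  shows "is_coproduct E {..<n} (\<lambda>_. X) P j"
proof -
  note pinj = coproduct_inj[OF S(1)] and proj = product_proj[OF P]
  have \<pi>: "\<pi> \<in> hom E P S" using proj by (simp add: mem_hom_iff)
  obtain K k a where K: "is_coproduct E {..<n} K P k"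
    "\<And>i. i < n \<Longrightarrow> a i \<in> hom E (K i) U" "\<And>i. i < n \<Longrightarrow> \<pi> \<cdot> k i = p i \<cdot> a i"
    using split_coproduct[OF S \<pi>] by blast
  note kinj = coproduct_inj[OF K(1)]
  \<comment> \<open>On \<open>K i\<close> the first component is forced by terminality, so
    \<open>k i\<close> factors through \<open>j i\<close>. Hence an arrow out of \<open>P\<close> is
    determined by its composites with the \<open>j i\<close>.\<close>
  have kj: "k i = j i \<cdot> (\<rho> \<cdot> k i)" if i: "i < n" for i
  proof (rule product_eqI[OF P])
    have "b \<cdot> (\<rho> \<cdot> k i) = a i"
      by (rule terminal_unique[OF U, of _ "K i"])
         (use b i K(2) kinj proj in \<open>auto simp: mem_hom_iff\<close>)
    moreover have "\<pi> \<cdot> (j i \<cdot> (\<rho> \<cdot> k i)) = p i \<cdot> (b \<cdot> (\<rho> \<cdot> k i))"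
      by (rule square_reassoc[OF j(2)[OF i]])
         (use b i j(1) kinj pinj proj in \<open>auto simp: mem_hom_iff\<close>)
    ultimately show "\<pi> \<cdot> k i = \<pi> \<cdot> (j i \<cdot> (\<rho> \<cdot> k i))" using K(3) i by simp
    show "\<rho> \<cdot> k i = \<rho> \<cdot> (j i \<cdot> (\<rho> \<cdot> k i))"
      using reassoc[OF j(3)[OF i], of "\<rho> \<cdot> k i"] i j(1) kinj proj by (simp add: mem_hom_iff)
  qed (use i j(1) kinj proj in \<open>auto simp: mem_hom_iff\<close>)
  show ?thesis
  proof (rule coproductI)
    show "P \<in> Ob E" by (rule proj)
    show "j i \<in> hom E X P" if "i \<in> {..<n}" for i using that j(1) by simp
    show "h = h'" if h: "h \<in> hom E P T" "h' \<in> hom E P T"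
      and eq: "\<And>i. i \<in> {..<n} \<Longrightarrow> h \<cdot> j i = h' \<cdot> j i" for T h h'
    proof (rule coproduct_eqI[OF K(1) h])
      fix i assume i: "i \<in> {..<n}"
      have "h \<cdot> (j i \<cdot> (\<rho> \<cdot> k i)) = h' \<cdot> (j i \<cdot> (\<rho> \<cdot> k i))"
        by (rule square_reassoc[OF eq[OF i]])
           (use h i j(1) kinj proj in \<open>auto simp: mem_hom_iff\<close>)
      then show "h \<cdot> k i = h' \<cdot> k i" using kj i by simp
    qed
    show "\<exists>h\<in>hom E P T. \<forall>i\<in>{..<n}. h \<cdot> j i = f i"
      if T: "T \<in> Ob E" and f: "\<And>i. i \<in> {..<n} \<Longrightarrow> f i \<in> hom E X T" for T f
    proof -
      \<comment> \<open>On the piece \<open>K i\<close> the arrow has to be \<open>f i\<close> after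
        the second projection. Its composite with \<open>j i\<close> is then computed by splitting
        \<open>X\<close> along \<open>j i\<close> into pieces over the \<open>K m\<close>.\<close>
      obtain h where h: "h \<in> hom E P T" "\<And>i. i \<in> {..<n} \<Longrightarrow> h \<cdot> k i = f i \<cdot> (\<rho> \<cdot> k i)"
        by (rule coproduct_cotuple[OF K(1) T, of "\<lambda>i. f i \<cdot> (\<rho> \<cdot> k i)"])
           (use f kinj proj in \<open>auto simp: mem_hom_iff\<close>)
      have "h \<cdot> j i = f i" if i: "i < n" for i
      proof -
        note fi = f[of i] and ji = j[OF i]
        obtain L l c where L: "is_coproduct E {..<n} L X l"
          "\<And>m. m < n \<Longrightarrow> c m \<in> hom E (L m) (K m)" "\<And>m. m < n \<Longrightarrow> j i \<cdot> l m = k m \<cdot> c m"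
          using split_coproduct[OF K(1) S(2) ji(1)] by blast
        note linj = coproduct_inj[OF L(1)]
        show ?thesis
        proof (rule coproduct_eqI[OF L(1)])
          show "h \<cdot> j i \<in> hom E X T" "f i \<in> hom E X T"
            using h(1) ji(1) fi i by (auto simp: mem_hom_iff)
          fix m assume "m \<in> {..<n}"
          then have m: "m < n" by simp
          have ty: "l m \<in> Ar E" "Src E (l m) = L m" "Tgt E (l m) = X" "c m \<in> Ar E"
            "Src E (c m) = L m" "Tgt E (c m) = K m" "j i \<in> Ar E" "Src E (j i) = X" "Tgt E (j i) = P"
            "f i \<in> Ar E" "Src E (f i) = X" "Tgt E (f i) = T" "h \<in> Ar E" "Src E h = P" "Tgt E h = T"
            "k m \<in> Ar E" "Src E (k m) = K m" "Tgt E (k m) = P"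
            "b \<in> Ar E" "Src E b = X" "Tgt E b = U" "a m \<in> Ar E" "Src E (a m) = K m" "Tgt E (a m) = U"
            "p m \<in> Ar E" "Src E (p m) = U" "Tgt E (p m) = S" "p i \<in> Ar E" "Src E (p i) = U" "Tgt E (p i) = S"
            using linj L(2) m ji(1) fi i h(1) kinj b K(2) pinj by (auto simp: mem_hom_iff)
          show "(h \<cdot> j i) \<cdot> l m = f i \<cdot> l m"
          proof (cases "m = i")
            case True
            have "h \<cdot> (k i \<cdot> c i) = f i \<cdot> ((\<rho> \<cdot> k i) \<cdot> c i)"
              by (rule square_reassoc[OF h(2)]) (use ty proj True i in auto)
            also have "(\<rho> \<cdot> k i) \<cdot> c i = \<rho> \<cdot> (j i \<cdot> l i)"
              using L(3) ty proj True i by simp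
            also have "\<dots> = l i"
              using reassoc[OF ji(3)] ty proj True by simp
            finally show ?thesis using L(3) ty True i by simp
          next
            \<comment> \<open>For \<open>m \<noteq> i\<close> the piece \<open>L m\<close> lies over
              two distinct summands of \<open>S\<close>, so all arrows out of it agree.\<close>
            case False
            have "\<pi> \<cdot> (j i \<cdot> l m) = p i \<cdot> (b \<cdot> l m)"
              by (rule square_reassoc[OF ji(2)]) (use ty proj in auto)
            moreover have "\<pi> \<cdot> (k m \<cdot> c m) = p m \<cdot> (a m \<cdot> c m)"
              by (rule square_reassoc[OF K(3)]) (use ty proj m in auto)
            ultimately have "p i \<cdot> (b \<cdot> l m) = p m \<cdot> (a m \<cdot> c m)"
              using L(3) m by simp
            then show ?thesis
              by (rule coproduct_disjoint[OF S(1), of i m _ "L m" _ _ T, rotated 5])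
                 (use ty False i m in \<open>auto simp: mem_hom_iff\<close>)
          qed
        qed
      qed
      then show ?thesis using h(1) by auto
    qed
  qed
qed

end

section \<open>Internal categories\<close>

context category
begin

lemma pullback_tuple:
  assumes P: "is_pullback C f g P p q"
    and xy: "x \<in> hom C T (Src C f)" "y \<in> hom C T (Src C g)" "f \<cdot> x = g \<cdot> y"
  shows "tuple C P p q x y \<in> hom C T P" "p \<cdot> tuple C P p q x y = x" "q \<cdot> tuple C P p q x y = y"
proof -
  have T: "Src C x = T" using xy(1) by (simp add: mem_hom_iff)
  have "\<exists>!h. h \<in> hom C T P \<and> p \<cdot> h = x \<and> q \<cdot> h = y"
    using P xy unfolding is_pullback_def by blast
  from theI'[OF this] show "tuple C P p q x y \<in> hom C T P" "p \<cdot> tuple C P p q x y = x"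
    "q \<cdot> tuple C P p q x y = y"
    unfolding tuple_def T by blast+
qed

lemma pullback_proj:
  assumes "is_pullback C f g P p q"
  shows "f \<in> Ar C" "g \<in> Ar C" "Tgt C f = Tgt C g" "P \<in> Ob C" "p \<in> Ar C" "Src C p = P"
    "Tgt C p = Src C f" "q \<in> Ar C" "Src C q = P" "Tgt C q = Src C g" "f \<cdot> p = g \<cdot> q"
  using assms by (simp_all add: is_pullback_def mem_hom_iff)

lemma pullback_eqI:
  assumes P: "is_pullback C f g P p q" and h: "h \<in> hom C T P" "h' \<in> hom C T P"
    and eq: "p \<cdot> h = p \<cdot> h'" "q \<cdot> h = q \<cdot> h'"
  shows "h = h'"
proof -
  note proj = pullback_proj[OF P]
  have "f \<cdot> (p \<cdot> h) = g \<cdot> (q \<cdot> h)"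
    by (rule square_reassoc[OF proj(11)]) (use proj(1-10) h in \<open>simp_all add: mem_hom_iff\<close>)
  moreover have "p \<cdot> h \<in> hom C T (Src C f)" "q \<cdot> h \<in> hom C T (Src C g)"
    using proj(1-10) h by (simp_all add: mem_hom_iff)
  ultimately have "\<exists>!k. k \<in> hom C T P \<and> p \<cdot> k = p \<cdot> h \<and> q \<cdot> k = q \<cdot> h"
    using P unfolding is_pullback_def by blast
  then show ?thesis using h eq by metis
qed

lemma comp_pair:
  assumes "is_pullback C (src A) (tgt A) (C2 A) (pr1 A) (pr2 A)"
    and "src A \<in> hom C (C1 A) (C0 A)" "tgt A \<in> hom C (C1 A) (C0 A)"
    and "x \<in> hom C T (C1 A)" "y \<in> hom C T (C1 A)" "src A \<cdot> x = tgt A \<cdot> y"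
  shows "comp_pair C A x y \<in> hom C T (C2 A)" "pr1 A \<cdot> comp_pair C A x y = x"
    "pr2 A \<cdot> comp_pair C A x y = y"
  unfolding comp_pair_def
  by (rule pullback_tuple[OF assms(1)]; use assms(2-) in \<open>simp add: mem_hom_iff\<close>)+

text \<open>The matching condition on \<open>x\<close> and \<open>y\<close> is inherited from
  \<open>h\<close>, so a pair is computed by exhibiting an arrow with the right projections.\<close>

lemma comp_pair_eqI:
  assumes pb: "is_pullback C (src A) (tgt A) (C2 A) (pr1 A) (pr2 A)"
    and st: "src A \<in> hom C (C1 A) (C0 A)" "tgt A \<in> hom C (C1 A) (C0 A)"
    and h: "h \<in> hom C T (C2 A)" and eq: "pr1 A \<cdot> h = x" "pr2 A \<cdot> h = y"
  shows "comp_pair C A x y = h"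
proof -
  note proj = pullback_proj[OF pb]
  have "src A \<cdot> (pr1 A \<cdot> h) = tgt A \<cdot> (pr2 A \<cdot> h)"
    by (rule square_reassoc[OF proj(11)]) (use proj(1-10) h in \<open>simp_all add: mem_hom_iff\<close>)
  moreover have "pr1 A \<cdot> h \<in> hom C T (C1 A)" "pr2 A \<cdot> h \<in> hom C T (C1 A)"
    using proj(1-10) h st by (simp_all add: mem_hom_iff)
  ultimately have xy: "x \<in> hom C T (C1 A)" "y \<in> hom C T (C1 A)" "src A \<cdot> x = tgt A \<cdot> y"
    using eq by simp_all
  show ?thesis
    by (rule pullback_eqI[OF pb comp_pair(1)[OF pb st xy] h])
       (simp_all add: comp_pair(2,3)[OF pb st xy] eq)
qed

lemma comp_pair_comp:
  assumes pb: "is_pullback C (src A) (tgt A) (C2 A) (pr1 A) (pr2 A)"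
    and st: "src A \<in> hom C (C1 A) (C0 A)" "tgt A \<in> hom C (C1 A) (C0 A)"
    and xy: "x \<in> hom C T (C1 A)" "y \<in> hom C T (C1 A)" "src A \<cdot> x = tgt A \<cdot> y"
    and t: "t \<in> hom C S T"
  shows "comp_pair C A x y \<cdot> t = comp_pair C A (x \<cdot> t) (y \<cdot> t)"
proof (rule comp_pair_eqI[OF pb st, symmetric])
  note c = comp_pair[OF pb st xy] and proj = pullback_proj[OF pb]
  show "comp_pair C A x y \<cdot> t \<in> hom C S (C2 A)" using c(1) t by (simp add: mem_hom_iff)
  show "pr1 A \<cdot> (comp_pair C A x y \<cdot> t) = x \<cdot> t"
    by (rule reassoc[OF c(2)]) (use proj c(1) t in \<open>simp_all add: mem_hom_iff\<close>)
  show "pr2 A \<cdot> (comp_pair C A x y \<cdot> t) = y \<cdot> t"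
    by (rule reassoc[OF c(3)]) (use proj c(1) t in \<open>simp_all add: mem_hom_iff\<close>)
qed

end

section \<open>Unit laws on generalised elements\<close>

locale internal_category = category E for E :: "('o, 'm) cat" (structure) +
  fixes A :: "('o, 'm) icat"
  assumes int_category: "int_category E A"
begin

lemma src_tgt: "src A \<in> hom E (C1 A) (C0 A)" "tgt A \<in> hom E (C1 A) (C0 A)"
  and pullback: "is_pullback E (src A) (tgt A) (C2 A) (pr1 A) (pr2 A)"
  and source_identity: "src A \<cdot> idn A = Idn E (C0 A)"
  and target_identity: "tgt A \<cdot> idn A = Idn E (C0 A)"
  and source_cmp: "src A \<cdot> cmp A = src A \<cdot> pr2 A"
  and target_cmp: "tgt A \<cdot> cmp A = tgt A \<cdot> pr1 A"
  and unit_left: "cmp A \<cdot> comp_pair E A (idn A \<cdot> tgt A) (Idn E (C1 A)) = Idn E (C1 A)"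
  and unit_right: "cmp A \<cdot> comp_pair E A (Idn E (C1 A)) (idn A \<cdot> src A) = Idn E (C1 A)"
  using int_category by (simp_all only: int_category_def)

lemma structure_arrows [simp]:
  "C0 A \<in> Ob E" "C1 A \<in> Ob E" "C2 A \<in> Ob E"
  "src A \<in> Ar E" "Src E (src A) = C1 A" "Tgt E (src A) = C0 A"
  "tgt A \<in> Ar E" "Src E (tgt A) = C1 A" "Tgt E (tgt A) = C0 A"
  "idn A \<in> Ar E" "Src E (idn A) = C0 A" "Tgt E (idn A) = C1 A"
  "pr1 A \<in> Ar E" "Src E (pr1 A) = C2 A" "Tgt E (pr1 A) = C1 A"
  "pr2 A \<in> Ar E" "Src E (pr2 A) = C2 A" "Tgt E (pr2 A) = C1 A"
  "cmp A \<in> Ar E" "Src E (cmp A) = C2 A" "Tgt E (cmp A) = C1 A"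
proof -
  have "idn A \<in> hom E (C0 A) (C1 A)" "cmp A \<in> hom E (C2 A) (C1 A)" "C0 A \<in> Ob E" "C1 A \<in> Ob E"
    using int_category by (simp_all only: int_category_def)
  then show "C0 A \<in> Ob E" "C1 A \<in> Ob E" "C2 A \<in> Ob E"
    "src A \<in> Ar E" "Src E (src A) = C1 A" "Tgt E (src A) = C0 A"
    "tgt A \<in> Ar E" "Src E (tgt A) = C1 A" "Tgt E (tgt A) = C0 A"
    "idn A \<in> Ar E" "Src E (idn A) = C0 A" "Tgt E (idn A) = C1 A"
    "pr1 A \<in> Ar E" "Src E (pr1 A) = C2 A" "Tgt E (pr1 A) = C1 A"
    "pr2 A \<in> Ar E" "Src E (pr2 A) = C2 A" "Tgt E (pr2 A) = C1 A"
    "cmp A \<in> Ar E" "Src E (cmp A) = C2 A" "Tgt E (cmp A) = C1 A"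
    using src_tgt pullback_proj(4-10)[OF pullback] by (simp_all add: mem_hom_iff)
qed

lemmas pair = comp_pair[OF pullback src_tgt]
lemmas pair_eqI = comp_pair_eqI[OF pullback src_tgt]
lemmas pair_comp = comp_pair_comp[OF pullback src_tgt]

text \<open>The axiom is the case of the generic arrow \<open>Idn E (C1 A)\<close>; precomposition
  with \<open>x\<close> carries it to every generalised element. \<open>identity_right\<close> is
  the mirror image.\<close>

lemma identity_left:
  assumes x: "x \<in> hom E T (C1 A)"
  shows "cmp A \<cdot> comp_pair E A (idn A \<cdot> (tgt A \<cdot> x)) x = x"
proof -
  have tx: "idn A \<cdot> tgt A \<in> hom E (C1 A) (C1 A)" "Idn E (C1 A) \<in> hom E (C1 A) (C1 A)"
    by (simp_all add: mem_hom_iff)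
  have eq: "src A \<cdot> (idn A \<cdot> tgt A) = tgt A \<cdot> Idn E (C1 A)"
    using reassoc[OF source_identity, of "tgt A"] by simp
  have "cmp A \<cdot> (comp_pair E A (idn A \<cdot> tgt A) (Idn E (C1 A)) \<cdot> x) = Idn E (C1 A) \<cdot> x"
    by (rule reassoc[OF unit_left]) (use pair(1)[OF tx eq] x in \<open>simp_all add: mem_hom_iff\<close>)
  then show ?thesis
    using pair_comp[OF tx eq x] x by (simp add: mem_hom_iff)
qed

lemma identity_right:
  assumes x: "x \<in> hom E T (C1 A)"
  shows "cmp A \<cdot> comp_pair E A x (idn A \<cdot> (src A \<cdot> x)) = x"
proof -
  have tx: "Idn E (C1 A) \<in> hom E (C1 A) (C1 A)" "idn A \<cdot> src A \<in> hom E (C1 A) (C1 A)"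
    by (simp_all add: mem_hom_iff)
  have eq: "src A \<cdot> Idn E (C1 A) = tgt A \<cdot> (idn A \<cdot> src A)"
    using reassoc[OF target_identity, of "src A"] by simp
  have "cmp A \<cdot> (comp_pair E A (Idn E (C1 A)) (idn A \<cdot> src A) \<cdot> x) = Idn E (C1 A) \<cdot> x"
    by (rule reassoc[OF unit_right]) (use pair(1)[OF tx eq] x in \<open>simp_all add: mem_hom_iff\<close>)
  then show ?thesis
    using pair_comp[OF tx eq x] x by (simp add: mem_hom_iff)
qed

end

section \<open>Copowers of the free-living arrow\<close>

text \<open>The lists below are the tables of the structure maps of \<^const>\<open>free_arrow\<close>.\<close>

lemma less_3_cases: "(i::nat) < 3 \<Longrightarrow> i = 0 \<or> i = 1 \<or> i = 2" by arith
lemma less_4_cases: "(i::nat) < 4 \<Longrightarrow> i = 0 \<or> i = 1 \<or> i = 2 \<or> i = 3" by arith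
lemma tables_less:
  "i < 3 \<Longrightarrow> [0, 1, 0] ! i < (2::nat)" "i < 3 \<Longrightarrow> [0, 1, 1] ! i < (2::nat)"
  "i < 2 \<Longrightarrow> [0, 1] ! i < (3::nat)" "i < 4 \<Longrightarrow> [0, 1, 2, 1] ! i < (3::nat)"
  "i < 4 \<Longrightarrow> [0, 1, 0, 2] ! i < (3::nat)" "i < 4 \<Longrightarrow> [0, 1, 2, 2] ! i < (3::nat)"
  by (auto dest!: less_2_cases less_3_cases less_4_cases)

text \<open>The simplifier turns the entry \<open>1\<close> of a table into \<open>Suc 0\<close>, so
  both spellings are kept.\<close>

lemmas tables_lt = tables_less tables_less[unfolded One_nat_def]

text \<open>Commutativity, existence and uniqueness for the pullback of source and target at the
  level of indices. Each part becomes the corresponding fact for copowers of any object.\<close>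

lemma table_pullback:
  "l < 4 \<Longrightarrow> [0, 1, 0] ! ([0, 1, 2, 1] ! l) = ([0, 1, 1] ! ([0, 1, 0, 2] ! l) :: nat)"
  "i < 3 \<Longrightarrow> j < 3 \<Longrightarrow> [0, 1, 0] ! i = ([0, 1, 1] ! j :: nat) \<Longrightarrow>
     \<exists>l<4. [0, 1, 2, 1] ! l = i \<and> [0, 1, 0, 2] ! l = j"
  "i < 4 \<Longrightarrow> j < 4 \<Longrightarrow> [0, 1, 2, 1] ! i = ([0, 1, 2, 1] ! j :: nat) \<Longrightarrow>
     [0, 1, 0, 2] ! i = ([0, 1, 0, 2] ! j :: nat) \<Longrightarrow> i = j"
proof -
  show "l < 4 \<Longrightarrow> [0, 1, 0] ! ([0, 1, 2, 1] ! l) = ([0, 1, 1] ! ([0, 1, 0, 2] ! l) :: nat)"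
    by (auto dest!: less_4_cases)
  show "\<exists>l<4. [0, 1, 2, 1] ! l = i \<and> [0, 1, 0, 2] ! l = j"
    if "i < 3" "j < 3" "[0, 1, 0] ! i = ([0, 1, 1] ! j :: nat)"
  proof -
    have "(i, j) = (0, 0) \<or> (i, j) = (1, 1) \<or> (i, j) = (2, 0) \<or> (i, j) = (1, 2)"
      using less_3_cases[OF that(1)] less_3_cases[OF that(2)] that(3) by (elim disjE) simp_all
    then show ?thesis
      by (elim disjE)
        (auto intro: exI[of _ 0] exI[of _ 1] exI[of _ 2] exI[of _ 3])
  qed
  show "i < 4 \<Longrightarrow> j < 4 \<Longrightarrow> [0, 1, 2, 1] ! i = ([0, 1, 2, 1] ! j :: nat) \<Longrightarrow>
     [0, 1, 0, 2] ! i = ([0, 1, 0, 2] ! j :: nat) \<Longrightarrow> i = j"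
    by (drule less_4_cases[of i], drule less_4_cases[of j]) (elim disjE; simp)
qed

text \<open>For a composable triple \<open>(h, g, f)\<close>, the index \<open>i\<close> codes
  \<open>(h, g)\<close> and \<open>j\<close> codes \<open>(g, f)\<close>, while \<open>l\<close> and
  \<open>m\<close> code the pairs \<open>(h g, f)\<close> and \<open>(h, g f)\<close>.\<close>

lemma table_assoc:
  assumes "i < 4" "j < 4" "[0, 1, 0, 2] ! i = ([0, 1, 2, 1] ! j :: nat)"
  shows "\<exists>l<4. \<exists>m<4. [0, 1, 2, 1] ! l = ([0, 1, 2, 2] ! i :: nat) \<and> [0, 1, 0, 2] ! l = ([0, 1, 0, 2] ! j :: nat) \<and>
     [0, 1, 2, 1] ! m = ([0, 1, 2, 1] ! i :: nat) \<and> [0, 1, 0, 2] ! m = ([0, 1, 2, 2] ! j :: nat) \<and>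
     [0, 1, 2, 2] ! l = ([0, 1, 2, 2] ! m :: nat)"
proof -
  \<comment> \<open>The five composable triples of the free-living arrow: two made of identities
    only, and three with \<open>0 \<rightarrow> 1\<close> in one of the three places.\<close>
  have "(i, j) = (0, 0) \<or> (i, j) = (1, 1) \<or> (i, j) = (2, 0) \<or> (i, j) = (1, 3) \<or> (i, j) = (3, 2)"
    using less_4_cases[OF assms(1)] less_4_cases[OF assms(2)] assms(3) by (elim disjE) simp_all
  then show ?thesis
    apply (elim disjE)
        apply (rule exI[of _ 0], simp, rule exI[of _ 0], simp)
       apply (rule exI[of _ 1], simp, rule exI[of _ 1], simp)
      apply (rule exI[of _ 2], simp, rule exI[of _ 2], simp)
     apply (rule exI[of _ 3], simp, rule exI[of _ 3], simp)
    apply (rule exI[of _ 2], simp, rule exI[of _ 3], simp)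
    done
qed

lemma table_unit:
  assumes "i < 3"
  shows "\<exists>l<4. [0, 1, 2, 1] ! l = ([0, 1] ! ([0, 1, 1] ! i) :: nat) \<and> [0, 1, 0, 2] ! l = i \<and> [0, 1, 2, 2] ! l = i"
    "\<exists>l<4. [0, 1, 2, 1] ! l = i \<and> [0, 1, 0, 2] ! l = ([0, 1] ! ([0, 1, 0] ! i) :: nat) \<and> [0, 1, 2, 2] ! l = i"
  using less_3_cases[OF assms]
  by (elim disjE; auto intro: exI[of _ 0] exI[of _ 1] exI[of _ 2] exI[of _ 3])+

text \<open>In an extensive category such an object is initial, but only the uniqueness of arrows out of it
  matters.\<close>

definition (in category) subinitial :: "'o \<Rightarrow> bool" where
  "subinitial T \<longleftrightarrow> (\<forall>Z. \<forall>u \<in> hom C T Z. \<forall>v \<in> hom C T Z. u = v)"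

lemma (in category) subinitial_eq:
  "subinitial T \<Longrightarrow> u \<in> hom C T Z \<Longrightarrow> v \<in> hom C T Z \<Longrightarrow> u = v"
  by (auto simp: subinitial_def)

text \<open>The injections of a copower are monic and disjoint. In the second case every equation
  between arrows out of \<open>T\<close> holds, so only the pieces with matching indices call for a
  computation.\<close>

lemma (in extensive_category) copower_eq_cases:
  assumes c: "is_coproduct E I (\<lambda>_. X) S p" and ij: "i \<in> I" "j \<in> I"
    and fg: "f \<in> hom E T X" "g \<in> hom E T X" and eq: "p i \<cdot> f = p j \<cdot> g"
  obtains "i = j" "f = g" | "subinitial T"
proof (cases "i = j")
  case True
  then show thesis using that(1) copower_inj_mono[OF c ij(1) fg] eq by blast
next
  case False
  have "subinitial T"
    unfolding subinitial_def using coproduct_disjoint[OF c ij False fg eq] by blast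
  then show thesis by (rule that(2))
qed

text \<open>The raw data of an internal category made of copies of \<open>X\<close>, with structure
  maps acting on the copies by the tables of \<open>free_arrow\<close>; the category laws are
  derived from this. It is used twice: with \<open>X\<close> terminal it describes
  \<open>2\<^sub>E\<close>, and for general \<open>X\<close> the product with
  \<open>disc E X\<close>.\<close>

locale arrow_copower = extensive_category E for E :: "('o, 'm) cat" (structure) +
  fixes X :: 'o and Q :: "('o, 'm) icat" and p0 p1 p2 :: "nat \<Rightarrow> 'm"
  assumes cop0: "is_coproduct E {..<2} (\<lambda>_. X) (C0 Q) p0"
    and cop1: "is_coproduct E {..<3} (\<lambda>_. X) (C1 Q) p1"
    and cop2: "is_coproduct E {..<4} (\<lambda>_. X) (C2 Q) p2"
    and arrows: "src Q \<in> hom E (C1 Q) (C0 Q)" "tgt Q \<in> hom E (C1 Q) (C0 Q)"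
      "idn Q \<in> hom E (C0 Q) (C1 Q)" "pr1 Q \<in> hom E (C2 Q) (C1 Q)"
      "pr2 Q \<in> hom E (C2 Q) (C1 Q)" "cmp Q \<in> hom E (C2 Q) (C1 Q)"
    and src_inj: "i < 3 \<Longrightarrow> src Q \<cdot> p1 i = p0 ([0, 1, 0] ! i)"
    and tgt_inj: "i < 3 \<Longrightarrow> tgt Q \<cdot> p1 i = p0 ([0, 1, 1] ! i)"
    and idn_inj: "i < 2 \<Longrightarrow> idn Q \<cdot> p0 i = p1 ([0, 1] ! i)"
    and pr1_inj: "i < 4 \<Longrightarrow> pr1 Q \<cdot> p2 i = p1 ([0, 1, 2, 1] ! i)"
    and pr2_inj: "i < 4 \<Longrightarrow> pr2 Q \<cdot> p2 i = p1 ([0, 1, 0, 2] ! i)"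
    and cmp_inj: "i < 4 \<Longrightarrow> cmp Q \<cdot> p2 i = p1 ([0, 1, 2, 2] ! i)"
begin

lemma arrows_simps [simp]:
  "src Q \<in> Ar E" "Src E (src Q) = C1 Q" "Tgt E (src Q) = C0 Q"
  "tgt Q \<in> Ar E" "Src E (tgt Q) = C1 Q" "Tgt E (tgt Q) = C0 Q"
  "idn Q \<in> Ar E" "Src E (idn Q) = C0 Q" "Tgt E (idn Q) = C1 Q"
  "pr1 Q \<in> Ar E" "Src E (pr1 Q) = C2 Q" "Tgt E (pr1 Q) = C1 Q"
  "pr2 Q \<in> Ar E" "Src E (pr2 Q) = C2 Q" "Tgt E (pr2 Q) = C1 Q"
  "cmp Q \<in> Ar E" "Src E (cmp Q) = C2 Q" "Tgt E (cmp Q) = C1 Q"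
  "C0 Q \<in> Ob E" "C1 Q \<in> Ob E" "C2 Q \<in> Ob E" "X \<in> Ob E"
  using arrows cop0 cop1 cop2 coproduct_inj(1,2)[OF cop0, of 0] Src_in[of "p0 0"]
  by (simp_all add: mem_hom_iff is_coproduct_def)

lemma inj_simps [simp]:
  "i < 2 \<Longrightarrow> p0 i \<in> Ar E" "i < 2 \<Longrightarrow> Src E (p0 i) = X" "i < 2 \<Longrightarrow> Tgt E (p0 i) = C0 Q"
  "i < 3 \<Longrightarrow> p1 i \<in> Ar E" "i < 3 \<Longrightarrow> Src E (p1 i) = X" "i < 3 \<Longrightarrow> Tgt E (p1 i) = C1 Q"
  "i < 4 \<Longrightarrow> p2 i \<in> Ar E" "i < 4 \<Longrightarrow> Src E (p2 i) = X" "i < 4 \<Longrightarrow> Tgt E (p2 i) = C2 Q"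
  using coproduct_inj[OF cop0] coproduct_inj[OF cop1] coproduct_inj[OF cop2] by simp_all

lemma inj_comp:
  assumes "a \<in> hom E T X"
  shows "i < 3 \<Longrightarrow> src Q \<cdot> (p1 i \<cdot> a) = p0 ([0, 1, 0] ! i) \<cdot> a"
    "i < 3 \<Longrightarrow> tgt Q \<cdot> (p1 i \<cdot> a) = p0 ([0, 1, 1] ! i) \<cdot> a"
    "i < 2 \<Longrightarrow> idn Q \<cdot> (p0 i \<cdot> a) = p1 ([0, 1] ! i) \<cdot> a"
    "i < 4 \<Longrightarrow> pr1 Q \<cdot> (p2 i \<cdot> a) = p1 ([0, 1, 2, 1] ! i) \<cdot> a"
    "i < 4 \<Longrightarrow> pr2 Q \<cdot> (p2 i \<cdot> a) = p1 ([0, 1, 0, 2] ! i) \<cdot> a"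
    "i < 4 \<Longrightarrow> cmp Q \<cdot> (p2 i \<cdot> a) = p1 ([0, 1, 2, 2] ! i) \<cdot> a"
  by (rule reassoc[OF src_inj] reassoc[OF tgt_inj] reassoc[OF idn_inj] reassoc[OF pr1_inj]
        reassoc[OF pr2_inj] reassoc[OF cmp_inj]; use assms in \<open>simp add: mem_hom_iff\<close>)+

text \<open>On a piece where \<open>h\<close> sits at \<open>i\<close> and \<open>h'\<close> at
  \<open>j\<close>, agreement of both projections forces \<open>i = j\<close> by
  \<open>table_pullback\<close>, unless the piece is subinitial.\<close>

lemma pullback_eq:
  assumes h: "h \<in> hom E T (C2 Q)" "h' \<in> hom E T (C2 Q)"
    and eq: "pr1 Q \<cdot> h = pr1 Q \<cdot> h'" "pr2 Q \<cdot> h = pr2 Q \<cdot> h'"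
  shows "h = h'"
proof -
  obtain K k a b where K: "is_coproduct E ({..<4} \<times> {..<4}) K T k"
    "\<And>i j. i < 4 \<Longrightarrow> j < 4 \<Longrightarrow> a (i, j) \<in> hom E (K (i, j)) X \<and> b (i, j) \<in> hom E (K (i, j)) X \<and>
       h \<cdot> k (i, j) = p2 i \<cdot> a (i, j) \<and> h' \<cdot> k (i, j) = p2 j \<cdot> b (i, j)"
    by (rule split_coproduct_pair[OF cop2 _ h(1) cop2 _ h(2)]) auto
  show ?thesis
  proof (rule coproduct_eqI[OF K(1) h])
    fix ij :: "nat \<times> nat" assume mem: "ij \<in> {..<4} \<times> {..<4}"
    obtain i j where ij: "ij = (i, j)" "i < 4" "j < 4" using mem by auto
    note k = coproduct_inj[OF K(1) mem, unfolded ij(1)]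
    note K2 = K(2)[OF ij(2,3)]
    have a: "a (i, j) \<in> hom E (K (i, j)) X" and b: "b (i, j) \<in> hom E (K (i, j)) X" using K2 by auto
    have "pr1 Q \<cdot> (h \<cdot> k (i, j)) = pr1 Q \<cdot> (h' \<cdot> k (i, j))"
      by (rule square_reassoc[OF eq(1)]) (use h k in \<open>simp_all add: mem_hom_iff\<close>)
    then have e1: "p1 ([0, 1, 2, 1] ! i) \<cdot> a (i, j) = p1 ([0, 1, 2, 1] ! j) \<cdot> b (i, j)"
      using K2 inj_comp(4)[OF a ij(2)] inj_comp(4)[OF b ij(3)] by simp
    have "pr2 Q \<cdot> (h \<cdot> k (i, j)) = pr2 Q \<cdot> (h' \<cdot> k (i, j))"
      by (rule square_reassoc[OF eq(2)]) (use h k in \<open>simp_all add: mem_hom_iff\<close>)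
    then have e2: "p1 ([0, 1, 0, 2] ! i) \<cdot> a (i, j) = p1 ([0, 1, 0, 2] ! j) \<cdot> b (i, j)"
      using K2 inj_comp(5)[OF a ij(2)] inj_comp(5)[OF b ij(3)] by simp
    have sub: "h \<cdot> k ij = h' \<cdot> k ij" if "subinitial (K (i, j))"
      by (rule subinitial_eq[OF that]) (use h k ij(1) in \<open>simp_all add: mem_hom_iff\<close>)
    show "h \<cdot> k ij = h' \<cdot> k ij"
    proof (rule copower_eq_cases[OF cop1 _ _ a b e1])
      assume 1: "[0, 1, 2, 1] ! i = ([0, 1, 2, 1] ! j :: nat)" "a (i, j) = b (i, j)"
      show ?thesis
      proof (rule copower_eq_cases[OF cop1 _ _ a b e2])
        assume "[0, 1, 0, 2] ! i = ([0, 1, 0, 2] ! j :: nat)"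
        then have "i = j" using table_pullback(3) ij 1(1) by blast
        then show ?thesis using K2 1(2) ij(1) by simp
      qed (use sub tables_lt ij in auto)
    qed (use sub tables_lt ij in auto)
  qed
qed

text \<open>For existence, split along \<open>x\<close> and \<open>y\<close>. A piece at
  \<open>(i, j)\<close> with matching source and target is sent to the copy of \<open>X\<close> that
  codes this composable pair; a mismatched piece is subinitial.\<close>

lemma is_pullback: "is_pullback E (src Q) (tgt Q) (C2 Q) (pr1 Q) (pr2 Q)"
  unfolding is_pullback_def
proof (intro conjI allI impI)
  show "src Q \<cdot> pr1 Q = tgt Q \<cdot> pr2 Q"
  proof (rule coproduct_eqI[OF cop2])
    fix l :: nat assume "l \<in> {..<4}"
    then show "(src Q \<cdot> pr1 Q) \<cdot> p2 l = (tgt Q \<cdot> pr2 Q) \<cdot> p2 l"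
      by (simp add: pr1_inj pr2_inj src_inj tgt_inj tables_lt table_pullback(1)[unfolded One_nat_def])
  qed (simp_all add: mem_hom_iff)
next
  fix T x y
  assume xy: "x \<in> hom E T (Src E (src Q)) \<and> y \<in> hom E T (Src E (tgt Q)) \<and> src Q \<cdot> x = tgt Q \<cdot> y"
  then have x: "x \<in> hom E T (C1 Q)" and y: "y \<in> hom E T (C1 Q)" and eq: "src Q \<cdot> x = tgt Q \<cdot> y"
    by simp_all
  obtain K k a b where K: "is_coproduct E ({..<3} \<times> {..<3}) K T k"
    "\<And>i j. i < 3 \<Longrightarrow> j < 3 \<Longrightarrow> a (i, j) \<in> hom E (K (i, j)) X \<and> b (i, j) \<in> hom E (K (i, j)) X \<and>
       x \<cdot> k (i, j) = p1 i \<cdot> a (i, j) \<and> y \<cdot> k (i, j) = p1 j \<cdot> b (i, j)"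
    by (rule split_coproduct_pair[OF cop1 _ x cop1 _ y]) auto
  have "\<exists>w. w \<in> hom E (K ij) (C2 Q) \<and> pr1 Q \<cdot> w = x \<cdot> k ij \<and> pr2 Q \<cdot> w = y \<cdot> k ij"
    if mem: "ij \<in> {..<3} \<times> {..<3}" for ij
  proof -
    obtain i j where ij: "ij = (i, j)" "i < 3" "j < 3" using mem by auto
    note k = coproduct_inj[OF K(1) mem, unfolded ij(1)]
    note K2 = K(2)[OF ij(2,3)]
    have a: "a (i, j) \<in> hom E (K (i, j)) X" and b: "b (i, j) \<in> hom E (K (i, j)) X" using K2 by auto
    have "src Q \<cdot> (x \<cdot> k (i, j)) = tgt Q \<cdot> (y \<cdot> k (i, j))"
      by (rule square_reassoc[OF eq]) (use x y k in \<open>simp_all add: mem_hom_iff\<close>)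
    then have e: "p0 ([0, 1, 0] ! i) \<cdot> a (i, j) = p0 ([0, 1, 1] ! j) \<cdot> b (i, j)"
      using K2 inj_comp(1)[OF a ij(2)] inj_comp(2)[OF b ij(3)] by simp
    show ?thesis
    proof (rule copower_eq_cases[OF cop0 _ _ a b e])
      assume 1: "[0, 1, 0] ! i = ([0, 1, 1] ! j :: nat)" "a (i, j) = b (i, j)"
      obtain l where l: "l < 4" "[0, 1, 2, 1] ! l = i" "[0, 1, 0, 2] ! l = j"
        using table_pullback(2)[OF ij(2,3) 1(1)] by blast
      have "p2 l \<cdot> a (i, j) \<in> hom E (K (i, j)) (C2 Q)" using a l(1) by (simp add: mem_hom_iff)
      moreover have "pr1 Q \<cdot> (p2 l \<cdot> a (i, j)) = x \<cdot> k (i, j)"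
        using inj_comp(4)[OF a l(1)] l(2) K2 by simp
      moreover have "pr2 Q \<cdot> (p2 l \<cdot> a (i, j)) = y \<cdot> k (i, j)"
        using inj_comp(5)[OF a l(1)] l(3) K2 1(2) by simp
      ultimately show ?thesis using ij(1) by blast
    next
      assume s: "subinitial (K (i, j))"
      \<comment> \<open>On a subinitial piece any arrow into \<open>C2 Q\<close> has the right
        projections; the index \<open>0\<close> is arbitrary.\<close>
      have w: "p2 0 \<cdot> a (i, j) \<in> hom E (K (i, j)) (C2 Q)" using a by (simp add: mem_hom_iff)
      have "pr1 Q \<cdot> (p2 0 \<cdot> a (i, j)) = x \<cdot> k (i, j)" "pr2 Q \<cdot> (p2 0 \<cdot> a (i, j)) = y \<cdot> k (i, j)"
        by (rule subinitial_eq[OF s, of _ "C1 Q"]; use w x y k in \<open>simp add: mem_hom_iff\<close>)+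
      then show ?thesis using w ij(1) by blast
    qed (use tables_lt ij in auto)
  qed
  then obtain w where w: "\<And>ij. ij \<in> {..<3} \<times> {..<3} \<Longrightarrow> w ij \<in> hom E (K ij) (C2 Q)"
    "\<And>ij. ij \<in> {..<3} \<times> {..<3} \<Longrightarrow> pr1 Q \<cdot> w ij = x \<cdot> k ij \<and> pr2 Q \<cdot> w ij = y \<cdot> k ij" by metis
  obtain h where h: "h \<in> hom E T (C2 Q)" "\<And>ij. ij \<in> {..<3} \<times> {..<3} \<Longrightarrow> h \<cdot> k ij = w ij"
    using coproduct_cotuple[OF K(1) arrows_simps(21) w(1)] by blast
  have "pr1 Q \<cdot> h = x"
  proof (rule coproduct_eqI[OF K(1) _ x])
    fix ij :: "nat \<times> nat" assume mem: "ij \<in> {..<3} \<times> {..<3}"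
    then show "(pr1 Q \<cdot> h) \<cdot> k ij = x \<cdot> k ij"
      using h(1) h(2)[OF mem] w(2)[OF mem] coproduct_inj[OF K(1) mem] by (simp add: mem_hom_iff)
  qed (use h(1) in \<open>simp add: mem_hom_iff\<close>)
  moreover have "pr2 Q \<cdot> h = y"
  proof (rule coproduct_eqI[OF K(1) _ y])
    fix ij :: "nat \<times> nat" assume mem: "ij \<in> {..<3} \<times> {..<3}"
    then show "(pr2 Q \<cdot> h) \<cdot> k ij = y \<cdot> k ij"
      using h(1) h(2)[OF mem] w(2)[OF mem] coproduct_inj[OF K(1) mem] by (simp add: mem_hom_iff)
  qed (use h(1) in \<open>simp add: mem_hom_iff\<close>)
  ultimately show "\<exists>!h. h \<in> hom E T (C2 Q) \<and> pr1 Q \<cdot> h = x \<and> pr2 Q \<cdot> h = y"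
    using h(1) pullback_eq by (intro ex1I[of _ h]) auto
qed (simp_all add: mem_hom_iff)

lemmas Q_pair = comp_pair[OF is_pullback arrows(1,2)]
lemmas Q_pair_eqI = comp_pair_eqI[OF is_pullback arrows(1,2)]
lemmas Q_pair_comp = comp_pair_comp[OF is_pullback arrows(1,2)]

section \<open>Category laws of the copowers, read off from the tables\<close>

lemma source_target_laws:
  "src Q \<cdot> idn Q = Idn E (C0 Q)" "tgt Q \<cdot> idn Q = Idn E (C0 Q)"
  "src Q \<cdot> cmp Q = src Q \<cdot> pr2 Q" "tgt Q \<cdot> cmp Q = tgt Q \<cdot> pr1 Q"
proof -
  have id: "(src Q \<cdot> idn Q) \<cdot> p0 i = Idn E (C0 Q) \<cdot> p0 i \<and> (tgt Q \<cdot> idn Q) \<cdot> p0 i = Idn E (C0 Q) \<cdot> p0 i"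
    if i: "i \<in> {..<2}" for i
  proof -
    have "[0, 1, 0] ! ([0, 1] ! i) = i" "[0, 1, 1] ! ([0, 1] ! i) = i"
      using i by (auto dest!: less_2_cases)
    then show ?thesis using i by (simp add: idn_inj src_inj tgt_inj tables_lt)
  qed
  show "src Q \<cdot> idn Q = Idn E (C0 Q)"
    by (rule coproduct_eqI[OF cop0 _ _ id[THEN conjunct1]]) (simp_all add: mem_hom_iff)
  show "tgt Q \<cdot> idn Q = Idn E (C0 Q)"
    by (rule coproduct_eqI[OF cop0 _ _ id[THEN conjunct2]]) (simp_all add: mem_hom_iff)
  have cmp: "(src Q \<cdot> cmp Q) \<cdot> p2 i = (src Q \<cdot> pr2 Q) \<cdot> p2 i \<and> (tgt Q \<cdot> cmp Q) \<cdot> p2 i = (tgt Q \<cdot> pr1 Q) \<cdot> p2 i"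
    if i: "i \<in> {..<4}" for i
  proof -
    have "[0, 1, 0] ! ([0, 1, 2, 2] ! i) = ([0, 1, 0] ! ([0, 1, 0, 2] ! i) :: nat)"
      "[0, 1, 1] ! ([0, 1, 2, 2] ! i) = ([0, 1, 1] ! ([0, 1, 2, 1] ! i) :: nat)"
      using i by (auto dest!: less_4_cases)
    then show ?thesis using i by (simp add: cmp_inj pr1_inj pr2_inj src_inj tgt_inj tables_lt)
  qed
  show "src Q \<cdot> cmp Q = src Q \<cdot> pr2 Q"
    by (rule coproduct_eqI[OF cop2 _ _ cmp[THEN conjunct1]]) (simp_all add: mem_hom_iff)
  show "tgt Q \<cdot> cmp Q = tgt Q \<cdot> pr1 Q"
    by (rule coproduct_eqI[OF cop2 _ _ cmp[THEN conjunct2]]) (simp_all add: mem_hom_iff)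
qed

lemma unit_laws:
  "cmp Q \<cdot> comp_pair E Q (idn Q \<cdot> tgt Q) (Idn E (C1 Q)) = Idn E (C1 Q)"
  "cmp Q \<cdot> comp_pair E Q (Idn E (C1 Q)) (idn Q \<cdot> src Q) = Idn E (C1 Q)"
proof -
  have I: "Idn E (C1 Q) \<in> hom E (C1 Q) (C1 Q)" by (simp add: mem_hom_iff)
  have l: "idn Q \<cdot> tgt Q \<in> hom E (C1 Q) (C1 Q)" "src Q \<cdot> (idn Q \<cdot> tgt Q) = tgt Q \<cdot> Idn E (C1 Q)"
    using reassoc[OF source_target_laws(1), of "tgt Q"] by (simp_all add: mem_hom_iff)
  have r: "idn Q \<cdot> src Q \<in> hom E (C1 Q) (C1 Q)" "src Q \<cdot> Idn E (C1 Q) = tgt Q \<cdot> (idn Q \<cdot> src Q)"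
    using reassoc[OF source_target_laws(2), of "src Q"] by (simp_all add: mem_hom_iff)
  note lp = Q_pair[OF l(1) I l(2)] and rp = Q_pair[OF I r]
  show "cmp Q \<cdot> comp_pair E Q (idn Q \<cdot> tgt Q) (Idn E (C1 Q)) = Idn E (C1 Q)"
  proof (rule coproduct_eqI[OF cop1])
    fix i :: nat assume "i \<in> {..<3}"
    then have i: "i < 3" and p: "p1 i \<in> hom E X (C1 Q)" by (simp_all add: mem_hom_iff)
    \<comment> \<open>\<open>m\<close> codes the pair of \<open>i\<close> with the identity at its
      target.\<close>
    obtain m where m: "m < 4" "[0, 1, 2, 1] ! m = ([0, 1] ! ([0, 1, 1] ! i) :: nat)" "[0, 1, 0, 2] ! m = i"
      "[0, 1, 2, 2] ! m = i" using table_unit(1)[OF i] by blast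
    have "comp_pair E Q (idn Q \<cdot> tgt Q) (Idn E (C1 Q)) \<cdot> p1 i = p2 m"
      unfolding Q_pair_comp[OF l(1) I l(2) p]
      by (rule Q_pair_eqI[where T = X])
         (use m i in \<open>simp_all add: mem_hom_iff pr1_inj pr2_inj tgt_inj idn_inj tables_lt\<close>)
    then show "(cmp Q \<cdot> comp_pair E Q (idn Q \<cdot> tgt Q) (Idn E (C1 Q))) \<cdot> p1 i = Idn E (C1 Q) \<cdot> p1 i"
      using lp(1) m i by (simp add: mem_hom_iff cmp_inj)
  qed (use lp(1) in \<open>simp_all add: mem_hom_iff\<close>)
  show "cmp Q \<cdot> comp_pair E Q (Idn E (C1 Q)) (idn Q \<cdot> src Q) = Idn E (C1 Q)"
  proof (rule coproduct_eqI[OF cop1])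
    fix i :: nat assume "i \<in> {..<3}"
    then have i: "i < 3" and p: "p1 i \<in> hom E X (C1 Q)" by (simp_all add: mem_hom_iff)
    obtain m where m: "m < 4" "[0, 1, 2, 1] ! m = i" "[0, 1, 0, 2] ! m = ([0, 1] ! ([0, 1, 0] ! i) :: nat)"
      "[0, 1, 2, 2] ! m = i" using table_unit(2)[OF i] by blast
    have "comp_pair E Q (Idn E (C1 Q)) (idn Q \<cdot> src Q) \<cdot> p1 i = p2 m"
      unfolding Q_pair_comp[OF I r p]
      by (rule Q_pair_eqI[where T = X])
         (use m i in \<open>simp_all add: mem_hom_iff pr1_inj pr2_inj src_inj idn_inj tables_lt\<close>)
    then show "(cmp Q \<cdot> comp_pair E Q (Idn E (C1 Q)) (idn Q \<cdot> src Q)) \<cdot> p1 i = Idn E (C1 Q) \<cdot> p1 i"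
      using rp(1) m i by (simp add: mem_hom_iff cmp_inj)
  qed (use rp(1) in \<open>simp_all add: mem_hom_iff\<close>)
qed

text \<open>Here \<open>T\<close> is an arbitrary pullback and is not identified with five copies of
  \<open>X\<close>. Splitting it along \<open>u\<close> and \<open>v\<close> leaves pieces indexed
  by two codes: mismatched ones are subinitial, and on the others \<open>table_assoc\<close>
  evaluates both sides at the same copy.\<close>

lemma associativity:
  assumes T: "is_pullback E (pr2 Q) (pr1 Q) T u v"
  shows "cmp Q \<cdot> comp_pair E Q (cmp Q \<cdot> u) (pr2 Q \<cdot> v) =
         cmp Q \<cdot> comp_pair E Q (pr1 Q \<cdot> u) (cmp Q \<cdot> v)"
proof -
  have u: "u \<in> hom E T (C2 Q)" and v: "v \<in> hom E T (C2 Q)" and eq: "pr2 Q \<cdot> u = pr1 Q \<cdot> v"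
    using pullback_proj[OF T] by (simp_all add: mem_hom_iff)
  note uv = u[unfolded mem_hom_iff] v[unfolded mem_hom_iff]
  have s: "src Q \<cdot> (cmp Q \<cdot> u) = src Q \<cdot> (pr2 Q \<cdot> u)"
    "tgt Q \<cdot> (cmp Q \<cdot> v) = tgt Q \<cdot> (pr1 Q \<cdot> v)"
    by (rule square_reassoc[OF source_target_laws(3)] square_reassoc[OF source_target_laws(4)];
        use uv in simp)+
  have c: "src Q \<cdot> (pr1 Q \<cdot> w) = tgt Q \<cdot> (pr2 Q \<cdot> w)" if "w \<in> hom E T (C2 Q)" for w
    by (rule square_reassoc[OF pullback_proj(11)[OF is_pullback]])
       (use that in \<open>simp_all add: mem_hom_iff\<close>)
  have l: "cmp Q \<cdot> u \<in> hom E T (C1 Q)" "pr2 Q \<cdot> v \<in> hom E T (C1 Q)"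
    "src Q \<cdot> (cmp Q \<cdot> u) = tgt Q \<cdot> (pr2 Q \<cdot> v)"
    using uv s(1) c[OF v] eq by (simp_all add: mem_hom_iff)
  have r: "pr1 Q \<cdot> u \<in> hom E T (C1 Q)" "cmp Q \<cdot> v \<in> hom E T (C1 Q)"
    "src Q \<cdot> (pr1 Q \<cdot> u) = tgt Q \<cdot> (cmp Q \<cdot> v)"
    using uv s(2) c[OF u] eq by (simp_all add: mem_hom_iff)
  note lp = Q_pair[OF l] and rp = Q_pair[OF r]
  obtain K k a b where K: "is_coproduct E ({..<4} \<times> {..<4}) K T k"
    "\<And>i j. i < 4 \<Longrightarrow> j < 4 \<Longrightarrow> a (i, j) \<in> hom E (K (i, j)) X \<and> b (i, j) \<in> hom E (K (i, j)) X \<and>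
       u \<cdot> k (i, j) = p2 i \<cdot> a (i, j) \<and> v \<cdot> k (i, j) = p2 j \<cdot> b (i, j)"
    by (rule split_coproduct_pair[OF cop2 _ u cop2 _ v]) auto
  let ?l = "comp_pair E Q (cmp Q \<cdot> u) (pr2 Q \<cdot> v)" and ?r = "comp_pair E Q (pr1 Q \<cdot> u) (cmp Q \<cdot> v)"
  show ?thesis
  proof (rule coproduct_eqI[OF K(1)])
    show "cmp Q \<cdot> ?l \<in> hom E T (C1 Q)" "cmp Q \<cdot> ?r \<in> hom E T (C1 Q)"
      using lp(1) rp(1) by (simp_all add: mem_hom_iff)
    fix ij :: "nat \<times> nat" assume mem: "ij \<in> {..<4} \<times> {..<4}"
    obtain i j where ij: "ij = (i, j)" "i < 4" "j < 4" using mem by auto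
    note k = coproduct_inj[OF K(1) mem, unfolded ij(1)]
    note K2 = K(2)[OF ij(2,3)]
    have k': "k (i, j) \<in> hom E (K (i, j)) T" using k by (simp add: mem_hom_iff)
    have a: "a (i, j) \<in> hom E (K (i, j)) X" and b: "b (i, j) \<in> hom E (K (i, j)) X" using K2 by auto
    have "pr2 Q \<cdot> (u \<cdot> k (i, j)) = pr1 Q \<cdot> (v \<cdot> k (i, j))"
      by (rule square_reassoc[OF eq]) (use uv k in simp_all)
    then have e: "p1 ([0, 1, 0, 2] ! i) \<cdot> a (i, j) = p1 ([0, 1, 2, 1] ! j) \<cdot> b (i, j)"
      using K2 inj_comp(5)[OF a ij(2)] inj_comp(4)[OF b ij(3)] by simp
    show "(cmp Q \<cdot> ?l) \<cdot> k ij = (cmp Q \<cdot> ?r) \<cdot> k ij"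
    proof (rule copower_eq_cases[OF cop1 _ _ a b e])
      assume 1: "[0, 1, 0, 2] ! i = ([0, 1, 2, 1] ! j :: nat)" "a (i, j) = b (i, j)"
      obtain l m where lm: "l < 4" "m < 4" "[0, 1, 2, 1] ! l = ([0, 1, 2, 2] ! i :: nat)"
        "[0, 1, 0, 2] ! l = ([0, 1, 0, 2] ! j :: nat)"
        "[0, 1, 2, 1] ! m = ([0, 1, 2, 1] ! i :: nat)" "[0, 1, 0, 2] ! m = ([0, 1, 2, 2] ! j :: nat)"
        "[0, 1, 2, 2] ! l = ([0, 1, 2, 2] ! m :: nat)"
        using table_assoc[OF ij(2,3) 1(1)] by blast
      have a2: "p2 n \<cdot> a (i, j) \<in> hom E (K (i, j)) (C2 Q)" if "n < 4" for n
        using a that by (simp add: mem_hom_iff)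
      have "?l \<cdot> k (i, j) = p2 l \<cdot> a (i, j)"
        unfolding Q_pair_comp[OF l k']
        by (rule Q_pair_eqI[OF a2[OF lm(1)]])
           (use uv k K2 1(2) inj_comp[OF a] inj_comp[OF b] lm ij in simp_all)
      moreover have "?r \<cdot> k (i, j) = p2 m \<cdot> a (i, j)"
        unfolding Q_pair_comp[OF r k']
        by (rule Q_pair_eqI[OF a2[OF lm(2)]])
           (use uv k K2 1(2) inj_comp[OF a] inj_comp[OF b] lm ij in simp_all)
      ultimately show ?thesis
        using lp(1) rp(1) k inj_comp(6)[OF a] lm ij(1) by (simp add: mem_hom_iff)
    next
      assume s: "subinitial (K (i, j))"
      show ?thesis
        by (rule subinitial_eq[OF s, of _ "C1 Q"])
           (use lp(1) rp(1) k ij(1) in \<open>simp_all add: mem_hom_iff\<close>)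
    qed (use tables_lt ij in auto)
  qed
qed

lemma int_category: "int_category E Q"
  unfolding int_category_def
  by (intro conjI allI impI arrows arrows_simps(19,20) is_pullback source_target_laws unit_laws
      associativity)

lemma functor_of_arrow:
  assumes A: "int_category E A" and a: "a \<in> hom E X (C1 A)"
  obtains W where "int_functor E W" "Fdom W = Q" "Fcod W = A" "F1 W \<cdot> p1 2 = a"
proof -
  interpret A: internal_category E A by unfold_locales (rule A)
  note ty = a[unfolded mem_hom_iff]
  \<comment> \<open>The values at the objects \<open>0\<close>, \<open>1\<close> and at the arrows
    \<open>id\<^sub>0\<close>, \<open>id\<^sub>1\<close>, \<open>0 \<rightarrow> 1\<close>, in the
    order in which \<open>free_arrow\<close> codes them. Once the last is \<open>a\<close>,
    functoriality forces the others.\<close>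
  define o0 where "o0 = [src A \<cdot> a, tgt A \<cdot> a]"
  define o1 where "o1 = [idn A \<cdot> (src A \<cdot> a), idn A \<cdot> (tgt A \<cdot> a), a]"
  have o0: "o0 ! i \<in> hom E X (C0 A)" if "i \<in> {..<2}" for i
    using that ty by (auto simp: o0_def mem_hom_iff dest!: less_2_cases)
  have o1: "o1 ! i \<in> hom E X (C1 A)" if "i \<in> {..<3}" for i
    using that ty by (auto simp: o1_def mem_hom_iff dest!: less_3_cases)
  obtain f0 where f0: "f0 \<in> hom E (C0 Q) (C0 A)" "\<And>i. i \<in> {..<2} \<Longrightarrow> f0 \<cdot> p0 i = o0 ! i"
    by (rule coproduct_cotuple[OF cop0 A.structure_arrows(1), of "(!) o0"]) (use o0 in blast)+
  obtain f1 where f1: "f1 \<in> hom E (C1 Q) (C1 A)" "\<And>i. i \<in> {..<3} \<Longrightarrow> f1 \<cdot> p1 i = o1 ! i"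
    by (rule coproduct_cotuple[OF cop1 A.structure_arrows(2), of "(!) o1"]) (use o1 in blast)+
  note fty = f0(1)[unfolded mem_hom_iff] f1(1)[unfolded mem_hom_iff]
  have id_s: "src A \<cdot> (idn A \<cdot> x) = x" "tgt A \<cdot> (idn A \<cdot> x) = x" if "x \<in> hom E X (C0 A)" for x
    using reassoc[OF A.source_identity, of x] reassoc[OF A.target_identity, of x] that
    by (simp_all add: mem_hom_iff)
  have sa: "src A \<cdot> a \<in> hom E X (C0 A)" "tgt A \<cdot> a \<in> hom E X (C0 A)"
    "idn A \<cdot> (src A \<cdot> a) \<in> hom E X (C1 A)" "idn A \<cdot> (tgt A \<cdot> a) \<in> hom E X (C1 A)"
    using ty by (simp_all add: mem_hom_iff)
  have src: "src A \<cdot> f1 = f0 \<cdot> src Q"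
  proof (rule coproduct_eqI[OF cop1])
    fix i :: nat assume i: "i \<in> {..<3}"
    have "src A \<cdot> o1 ! i = o0 ! ([0, 1, 0] ! i)"
      using i sa by (auto simp: o0_def o1_def id_s dest!: less_3_cases)
    then show "(src A \<cdot> f1) \<cdot> p1 i = (f0 \<cdot> src Q) \<cdot> p1 i"
      using i fty f0(2) f1(2) by (simp add: src_inj tables_lt)
  qed (use fty in \<open>simp_all add: mem_hom_iff\<close>)
  have tgt: "tgt A \<cdot> f1 = f0 \<cdot> tgt Q"
  proof (rule coproduct_eqI[OF cop1])
    fix i :: nat assume i: "i \<in> {..<3}"
    have "tgt A \<cdot> o1 ! i = o0 ! ([0, 1, 1] ! i)"
      using i sa by (auto simp: o0_def o1_def id_s dest!: less_3_cases)
    then show "(tgt A \<cdot> f1) \<cdot> p1 i = (f0 \<cdot> tgt Q) \<cdot> p1 i"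
      using i fty f0(2) f1(2) by (simp add: tgt_inj tables_lt)
  qed (use fty in \<open>simp_all add: mem_hom_iff\<close>)
  have idn: "f1 \<cdot> idn Q = idn A \<cdot> f0"
  proof (rule coproduct_eqI[OF cop0])
    fix i :: nat assume i: "i \<in> {..<2}"
    have "o1 ! ([0, 1] ! i) = idn A \<cdot> o0 ! i"
      using i by (auto simp: o0_def o1_def dest!: less_2_cases)
    then show "(f1 \<cdot> idn Q) \<cdot> p0 i = (idn A \<cdot> f0) \<cdot> p0 i"
      using i fty f0(2) f1(2) by (simp add: idn_inj tables_lt)
  qed (use fty in \<open>simp_all add: mem_hom_iff\<close>)
  have p: "f1 \<cdot> pr1 Q \<in> hom E (C2 Q) (C1 A)" "f1 \<cdot> pr2 Q \<in> hom E (C2 Q) (C1 A)"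
    using fty by (simp_all add: mem_hom_iff)
  have "src A \<cdot> (f1 \<cdot> pr1 Q) = f0 \<cdot> (src Q \<cdot> pr1 Q)" "tgt A \<cdot> (f1 \<cdot> pr2 Q) = f0 \<cdot> (tgt Q \<cdot> pr2 Q)"
    by (rule square_reassoc[OF src] square_reassoc[OF tgt]; use fty in simp)+
  then have pc: "src A \<cdot> (f1 \<cdot> pr1 Q) = tgt A \<cdot> (f1 \<cdot> pr2 Q)"
    using pullback_proj(11)[OF is_pullback] by simp
  note pp = A.pair[OF p pc]
  \<comment> \<open>Each of the four composable pairs contains an identity, so the unit laws of
    \<open>A\<close> suffice.\<close>
  have cmp: "f1 \<cdot> cmp Q = cmp A \<cdot> comp_pair E A (f1 \<cdot> pr1 Q) (f1 \<cdot> pr2 Q)"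
  proof (rule coproduct_eqI[OF cop2])
    fix i :: nat assume i: "i \<in> {..<4}"
    then have p2: "p2 i \<in> hom E X (C2 Q)" by (simp add: mem_hom_iff)
    have "cmp A \<cdot> comp_pair E A (o1 ! ([0, 1, 2, 1] ! i)) (o1 ! ([0, 1, 0, 2] ! i)) = o1 ! ([0, 1, 2, 2] ! i)"
      using i A.identity_left[OF a] A.identity_right[OF a]
        A.identity_left[OF sa(3)] A.identity_left[OF sa(4)] id_s(2)[OF sa(1)] id_s(2)[OF sa(2)]
      by (auto simp: o1_def dest!: less_4_cases)
    moreover have "comp_pair E A (f1 \<cdot> pr1 Q) (f1 \<cdot> pr2 Q) \<cdot> p2 i =
      comp_pair E A (o1 ! ([0, 1, 2, 1] ! i)) (o1 ! ([0, 1, 0, 2] ! i))"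
      unfolding A.pair_comp[OF p pc p2]
      using i fty f1(2) by (simp add: pr1_inj pr2_inj tables_lt)
    ultimately show "(f1 \<cdot> cmp Q) \<cdot> p2 i = (cmp A \<cdot> comp_pair E A (f1 \<cdot> pr1 Q) (f1 \<cdot> pr2 Q)) \<cdot> p2 i"
      using i fty f1(2) pp(1) by (simp add: cmp_inj tables_lt mem_hom_iff)
  qed (use fty pp(1) in \<open>simp_all add: mem_hom_iff\<close>)
  show thesis
  proof (rule that)
    let ?W = "\<lparr>Fdom = Q, Fcod = A, F0 = f0, F1 = f1\<rparr>"
    show "int_functor E ?W"
      using f0(1) f1(1) src tgt idn cmp by (simp add: int_functor_def)
    show "F1 ?W \<cdot> p1 2 = a" using f1(2)[of 2] by (simp add: o1_def)
  qed simp_all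
qed

end

section \<open>Products with discrete internal categories\<close>

lemma disc_simps [simp]:
  "C0 (disc E X) = X" "C1 (disc E X) = X" "C2 (disc E X) = X"
  "src (disc E X) = Idn E X" "tgt (disc E X) = Idn E X" "idn (disc E X) = Idn E X"
  "pr1 (disc E X) = Idn E X" "pr2 (disc E X) = Idn E X" "cmp (disc E X) = Idn E X"
  by (simp_all add: disc_def)

section \<open>Discrete internal categories and internal functors\<close>

context category
begin

lemma disc_pullback:
  assumes "X \<in> Ob C"
  shows "is_pullback C (Idn C X) (Idn C X) X (Idn C X) (Idn C X)"
  unfolding is_pullback_def
proof (intro conjI allI impI)
  fix T x y
  assume xy: "x \<in> hom C T (Src C (Idn C X)) \<and> y \<in> hom C T (Src C (Idn C X)) \<and>
    Idn C X \<cdot> x = Idn C X \<cdot> y"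
  then have x: "x \<in> hom C T X" and y: "y \<in> hom C T X" using assms by simp_all
  then have "x = y" using xy Idn_left[OF x] Idn_left[OF y] by simp
  with x show "\<exists>!h. h \<in> hom C T X \<and> Idn C X \<cdot> h = x \<and> Idn C X \<cdot> h = y"
    using Idn_left by (intro ex1I[of _ x]) auto
qed (use assms in \<open>simp_all add: mem_hom_iff\<close>)

lemma disc_comp_pair:
  assumes "x \<in> hom C T X"
  shows "comp_pair C (disc C X) x x = x"
proof -
  have X: "X \<in> Ob C" using hom_Ob(2)[OF assms] .
  show ?thesis
    by (rule comp_pair_eqI[of "disc C X" x T]) (use X assms disc_pullback in \<open>simp_all add: mem_hom_iff\<close>)
qed

lemma int_category_disc:
  assumes X: "X \<in> Ob C"
  shows "int_category C (disc C X)"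
proof -
  have I: "Idn C X \<in> hom C X X" by (rule Idn_in[OF X])
  have assoc: "Idn C X \<cdot> comp_pair C (disc C X) (Idn C X \<cdot> u) (Idn C X \<cdot> v) =
      Idn C X \<cdot> comp_pair C (disc C X) (Idn C X \<cdot> u) (Idn C X \<cdot> v)" for u v ..
  show ?thesis
    unfolding int_category_def disc_simps
    using X I disc_pullback[OF X] disc_comp_pair[OF I] by simp
qed

lemma int_functorD:
  assumes "int_functor C W" "Fdom W = A" "Fcod W = B"
  shows "F0 W \<in> hom C (C0 A) (C0 B)" "F1 W \<in> hom C (C1 A) (C1 B)"
    "src B \<cdot> F1 W = F0 W \<cdot> src A" "tgt B \<cdot> F1 W = F0 W \<cdot> tgt A"
    "F1 W \<cdot> idn A = idn B \<cdot> F0 W"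
    "F1 W \<cdot> cmp A = cmp B \<cdot> comp_pair C B (F1 W \<cdot> pr1 A) (F1 W \<cdot> pr2 A)"
  using assms by (simp_all only: int_functor_def Let_def)

lemma int_functor_composable:
  assumes W: "int_functor C W" "Fdom W = A" "Fcod W = B" and A: "int_category C A" "int_category C B"
  shows "F1 W \<cdot> pr1 A \<in> hom C (C2 A) (C1 B)" "F1 W \<cdot> pr2 A \<in> hom C (C2 A) (C1 B)"
    "src B \<cdot> (F1 W \<cdot> pr1 A) = tgt B \<cdot> (F1 W \<cdot> pr2 A)"
proof -
  interpret A: internal_category C A by unfold_locales (rule A)
  interpret B: internal_category C B by unfold_locales (rule A)
  note w = int_functorD[OF W]
  note ty = w(1,2)[unfolded mem_hom_iff]
  show "F1 W \<cdot> pr1 A \<in> hom C (C2 A) (C1 B)" "F1 W \<cdot> pr2 A \<in> hom C (C2 A) (C1 B)"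
    using ty by (simp_all add: mem_hom_iff)
  have "src B \<cdot> (F1 W \<cdot> pr1 A) = F0 W \<cdot> (src A \<cdot> pr1 A)"
    by (rule square_reassoc[OF w(3)]) (use ty in simp_all)
  moreover have "tgt B \<cdot> (F1 W \<cdot> pr2 A) = F0 W \<cdot> (tgt A \<cdot> pr2 A)"
    by (rule square_reassoc[OF w(4)]) (use ty in simp_all)
  ultimately show "src B \<cdot> (F1 W \<cdot> pr1 A) = tgt B \<cdot> (F1 W \<cdot> pr2 A)"
    using pullback_proj(11)[OF A.pullback] by simp
qed

end

text \<open>The equations make the \<open>\<pi>\<close> and the \<open>\<rho>\<close> internal
  functors from \<open>Q\<close> to \<open>A\<close> and to \<open>disc E X\<close>. That
  \<open>Q\<close> is an internal category is assumed; for the product at hand it comes from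
  \<open>arrow_copower\<close>.\<close>

locale product_with_disc = category E for E :: "('o, 'm) cat" (structure) +
  fixes A Q :: "('o, 'm) icat" and X :: 'o and \<pi>0 \<pi>1 \<pi>2 \<rho>0 \<rho>1 \<rho>2 :: 'm
  assumes int_cats: "int_category E A" "int_category E Q"
    and prods: "is_product E (C0 A) X (C0 Q) \<pi>0 \<rho>0" "is_product E (C1 A) X (C1 Q) \<pi>1 \<rho>1"
      "is_product E (C2 A) X (C2 Q) \<pi>2 \<rho>2"
    and src: "\<pi>0 \<cdot> src Q = src A \<cdot> \<pi>1" "\<rho>0 \<cdot> src Q = \<rho>1"
    and tgt: "\<pi>0 \<cdot> tgt Q = tgt A \<cdot> \<pi>1" "\<rho>0 \<cdot> tgt Q = \<rho>1"
    and idn: "\<pi>1 \<cdot> idn Q = idn A \<cdot> \<pi>0" "\<rho>1 \<cdot> idn Q = \<rho>0"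
    and pr1: "\<pi>1 \<cdot> pr1 Q = pr1 A \<cdot> \<pi>2" "\<rho>1 \<cdot> pr1 Q = \<rho>2"
    and pr2: "\<pi>1 \<cdot> pr2 Q = pr2 A \<cdot> \<pi>2" "\<rho>1 \<cdot> pr2 Q = \<rho>2"
    and cmp: "\<pi>1 \<cdot> cmp Q = cmp A \<cdot> \<pi>2" "\<rho>1 \<cdot> cmp Q = \<rho>2"
begin

sublocale A: internal_category E A by unfold_locales (rule int_cats)
sublocale Q: internal_category E Q by unfold_locales (rule int_cats)

lemma proj_simps [simp]:
  "\<pi>0 \<in> Ar E" "Src E \<pi>0 = C0 Q" "Tgt E \<pi>0 = C0 A" "\<rho>0 \<in> Ar E" "Src E \<rho>0 = C0 Q" "Tgt E \<rho>0 = X"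
  "\<pi>1 \<in> Ar E" "Src E \<pi>1 = C1 Q" "Tgt E \<pi>1 = C1 A" "\<rho>1 \<in> Ar E" "Src E \<rho>1 = C1 Q" "Tgt E \<rho>1 = X"
  "\<pi>2 \<in> Ar E" "Src E \<pi>2 = C2 Q" "Tgt E \<pi>2 = C2 A" "\<rho>2 \<in> Ar E" "Src E \<rho>2 = C2 Q" "Tgt E \<rho>2 = X"
  using product_proj[OF prods(1)] product_proj[OF prods(2)] product_proj[OF prods(3)] by simp_all

lemma X_in [simp]: "X \<in> Ob E"
  using Tgt_in[OF proj_simps(4)] by simp

lemma proj_fst: "int_functor E \<lparr>Fdom = Q, Fcod = A, F0 = \<pi>0, F1 = \<pi>1\<rparr>"
proof -
  have "comp_pair E A (\<pi>1 \<cdot> pr1 Q) (\<pi>1 \<cdot> pr2 Q) = \<pi>2"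
    by (rule A.pair_eqI[where T = "C2 Q"]) (simp_all add: mem_hom_iff pr1 pr2)
  then show ?thesis by (simp add: int_functor_def mem_hom_iff src tgt idn cmp)
qed

lemma proj_snd: "int_functor E \<lparr>Fdom = Q, Fcod = disc E X, F0 = \<rho>0, F1 = \<rho>1\<rparr>"
proof -
  have "comp_pair E (disc E X) \<rho>2 \<rho>2 = \<rho>2"
    by (rule disc_comp_pair[of _ "C2 Q"]) (simp add: mem_hom_iff)
  then show ?thesis by (simp add: int_functor_def mem_hom_iff src tgt idn cmp pr1 pr2)
qed

text \<open>Each equation between arrows into a component of \<open>Q\<close> is tested after the
  two projections, which are jointly monic. The \<open>\<pi>\<close> half is then a law of
  \<open>U\<close> and the \<open>\<rho>\<close> half one of \<open>V\<close>.\<close>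

lemma pairing:
  assumes Z: "int_category E Z"
    and U: "int_functor E U" "Fdom U = Z" "Fcod U = A"
    and V: "int_functor E V" "Fdom V = Z" "Fcod V = disc E X"
    and w0: "w0 \<in> hom E (C0 Z) (C0 Q)" "\<pi>0 \<cdot> w0 = F0 U" "\<rho>0 \<cdot> w0 = F0 V"
    and w1: "w1 \<in> hom E (C1 Z) (C1 Q)" "\<pi>1 \<cdot> w1 = F1 U" "\<rho>1 \<cdot> w1 = F1 V"
  shows "int_functor E \<lparr>Fdom = Z, Fcod = Q, F0 = w0, F1 = w1\<rparr>"
proof -
  interpret Z: internal_category E Z by unfold_locales (rule Z)
  note u = int_functorD[OF U] and v = int_functorD[OF V, unfolded disc_simps]
  note ty = u(1,2)[unfolded mem_hom_iff] v(1,2)[unfolded mem_hom_iff]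
    w0(1)[unfolded mem_hom_iff] w1(1)[unfolded mem_hom_iff]
  have v': "F0 V \<cdot> src Z = F1 V" "F0 V \<cdot> tgt Z = F1 V" "F1 V \<cdot> idn Z = F0 V"
    using v(3,4,5) ty by simp_all
  have src_eq: "src Q \<cdot> w1 = w0 \<cdot> src Z"
  proof (rule product_eqI[OF prods(1)])
    have "\<pi>0 \<cdot> (src Q \<cdot> w1) = src A \<cdot> (\<pi>1 \<cdot> w1)"
      by (rule square_reassoc[OF src(1)]) (use ty in simp_all)
    moreover have "\<pi>0 \<cdot> (w0 \<cdot> src Z) = F0 U \<cdot> src Z"
      by (rule reassoc[OF w0(2)]) (use ty in simp_all)
    ultimately show "\<pi>0 \<cdot> (src Q \<cdot> w1) = \<pi>0 \<cdot> (w0 \<cdot> src Z)" using w1(2) u(3) by simp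
    have "\<rho>0 \<cdot> (src Q \<cdot> w1) = \<rho>1 \<cdot> w1"
      by (rule reassoc[OF src(2)]) (use ty in simp_all)
    moreover have "\<rho>0 \<cdot> (w0 \<cdot> src Z) = F0 V \<cdot> src Z"
      by (rule reassoc[OF w0(3)]) (use ty in simp_all)
    ultimately show "\<rho>0 \<cdot> (src Q \<cdot> w1) = \<rho>0 \<cdot> (w0 \<cdot> src Z)" using w1(3) v' by simp
  qed (use ty in \<open>simp_all add: mem_hom_iff\<close>)
  have tgt_eq: "tgt Q \<cdot> w1 = w0 \<cdot> tgt Z"
  proof (rule product_eqI[OF prods(1)])
    have "\<pi>0 \<cdot> (tgt Q \<cdot> w1) = tgt A \<cdot> (\<pi>1 \<cdot> w1)"
      by (rule square_reassoc[OF tgt(1)]) (use ty in simp_all)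
    moreover have "\<pi>0 \<cdot> (w0 \<cdot> tgt Z) = F0 U \<cdot> tgt Z"
      by (rule reassoc[OF w0(2)]) (use ty in simp_all)
    ultimately show "\<pi>0 \<cdot> (tgt Q \<cdot> w1) = \<pi>0 \<cdot> (w0 \<cdot> tgt Z)" using w1(2) u(4) by simp
    have "\<rho>0 \<cdot> (tgt Q \<cdot> w1) = \<rho>1 \<cdot> w1"
      by (rule reassoc[OF tgt(2)]) (use ty in simp_all)
    moreover have "\<rho>0 \<cdot> (w0 \<cdot> tgt Z) = F0 V \<cdot> tgt Z"
      by (rule reassoc[OF w0(3)]) (use ty in simp_all)
    ultimately show "\<rho>0 \<cdot> (tgt Q \<cdot> w1) = \<rho>0 \<cdot> (w0 \<cdot> tgt Z)" using w1(3) v' by simp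
  qed (use ty in \<open>simp_all add: mem_hom_iff\<close>)
  have idn_eq: "w1 \<cdot> idn Z = idn Q \<cdot> w0"
  proof (rule product_eqI[OF prods(2)])
    have "\<pi>1 \<cdot> (idn Q \<cdot> w0) = idn A \<cdot> (\<pi>0 \<cdot> w0)"
      by (rule square_reassoc[OF idn(1)]) (use ty in simp_all)
    moreover have "\<pi>1 \<cdot> (w1 \<cdot> idn Z) = F1 U \<cdot> idn Z"
      by (rule reassoc[OF w1(2)]) (use ty in simp_all)
    ultimately show "\<pi>1 \<cdot> (w1 \<cdot> idn Z) = \<pi>1 \<cdot> (idn Q \<cdot> w0)" using w0(2) u(5) by simp
    have "\<rho>1 \<cdot> (idn Q \<cdot> w0) = \<rho>0 \<cdot> w0"
      by (rule reassoc[OF idn(2)]) (use ty in simp_all)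
    moreover have "\<rho>1 \<cdot> (w1 \<cdot> idn Z) = F1 V \<cdot> idn Z"
      by (rule reassoc[OF w1(3)]) (use ty in simp_all)
    ultimately show "\<rho>1 \<cdot> (w1 \<cdot> idn Z) = \<rho>1 \<cdot> (idn Q \<cdot> w0)" using w0(3) v' by simp
  qed (use ty in \<open>simp_all add: mem_hom_iff\<close>)
  have w: "w1 \<cdot> pr1 Z \<in> hom E (C2 Z) (C1 Q)" "w1 \<cdot> pr2 Z \<in> hom E (C2 Z) (C1 Q)"
    using ty by (simp_all add: mem_hom_iff)
  have "src Q \<cdot> (w1 \<cdot> pr1 Z) = w0 \<cdot> (src Z \<cdot> pr1 Z)"
    by (rule square_reassoc[OF src_eq]) (use ty in simp_all)
  moreover have "tgt Q \<cdot> (w1 \<cdot> pr2 Z) = w0 \<cdot> (tgt Z \<cdot> pr2 Z)"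
    by (rule square_reassoc[OF tgt_eq]) (use ty in simp_all)
  ultimately have wc: "src Q \<cdot> (w1 \<cdot> pr1 Z) = tgt Q \<cdot> (w1 \<cdot> pr2 Z)"
    using pullback_proj(11)[OF Z.pullback] by simp
  define c where "c = comp_pair E Q (w1 \<cdot> pr1 Z) (w1 \<cdot> pr2 Z)"
  note c = Q.pair[OF w wc, folded c_def]
  note cty = c(1)[unfolded mem_hom_iff]
  have \<pi>w: "\<pi>1 \<cdot> (w1 \<cdot> t) = F1 U \<cdot> t" "\<rho>1 \<cdot> (w1 \<cdot> t) = F1 V \<cdot> t" if "t \<in> hom E (C2 Z) (C1 Z)" for t
    by (rule reassoc[OF w1(2)] reassoc[OF w1(3)]; use ty that in \<open>simp add: mem_hom_iff\<close>)+
  have pr_hom: "pr1 Z \<in> hom E (C2 Z) (C1 Z)" "pr2 Z \<in> hom E (C2 Z) (C1 Z)" "cmp Z \<in> hom E (C2 Z) (C1 Z)"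
    by (simp_all add: mem_hom_iff)
  have cmp_eq: "w1 \<cdot> cmp Z = cmp Q \<cdot> c"
  proof (rule product_eqI[OF prods(2)])
    \<comment> \<open>The image \<open>\<pi>2 \<cdot> c\<close> of the pair in \<open>Q\<close> is
      the pair of the images in \<open>A\<close>, where the composition law of \<open>U\<close>
      applies.\<close>
    have "pr1 A \<cdot> (\<pi>2 \<cdot> c) = \<pi>1 \<cdot> (pr1 Q \<cdot> c)"
      by (rule square_reassoc[OF pr1(1)[symmetric]]) (use cty in simp_all)
    moreover have "pr2 A \<cdot> (\<pi>2 \<cdot> c) = \<pi>1 \<cdot> (pr2 Q \<cdot> c)"
      by (rule square_reassoc[OF pr2(1)[symmetric]]) (use cty in simp_all)
    ultimately have "comp_pair E A (F1 U \<cdot> pr1 Z) (F1 U \<cdot> pr2 Z) = \<pi>2 \<cdot> c"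
      using cty c(2,3) \<pi>w(1)[OF pr_hom(1)] \<pi>w(1)[OF pr_hom(2)]
      by (intro A.pair_eqI[where T = "C2 Z"]) (simp_all add: mem_hom_iff)
    moreover have "\<pi>1 \<cdot> (cmp Q \<cdot> c) = cmp A \<cdot> (\<pi>2 \<cdot> c)"
      by (rule square_reassoc[OF cmp(1)]) (use cty in simp_all)
    ultimately show "\<pi>1 \<cdot> (w1 \<cdot> cmp Z) = \<pi>1 \<cdot> (cmp Q \<cdot> c)"
      using \<pi>w(1)[OF pr_hom(3)] u(6) by simp
    have e: "\<rho>1 \<cdot> (pr1 Q \<cdot> c) = \<rho>2 \<cdot> c" "\<rho>1 \<cdot> (pr2 Q \<cdot> c) = \<rho>2 \<cdot> c" "\<rho>1 \<cdot> (cmp Q \<cdot> c) = \<rho>2 \<cdot> c"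
      by (rule reassoc[OF pr1(2)] reassoc[OF pr2(2)] reassoc[OF cmp(2)]; use cty in simp)+
    have "\<rho>2 \<cdot> c \<in> hom E (C2 Z) X" using cty by (simp add: mem_hom_iff)
    from disc_comp_pair[OF this] have "F1 V \<cdot> cmp Z = \<rho>2 \<cdot> c"
      using v(6) e(1,2) c(2,3) \<pi>w(2)[OF pr_hom(1)] \<pi>w(2)[OF pr_hom(2)] cty by simp
    then show "\<rho>1 \<cdot> (w1 \<cdot> cmp Z) = \<rho>1 \<cdot> (cmp Q \<cdot> c)"
      using \<pi>w(2)[OF pr_hom(3)] e(3) by simp
  qed (use ty cty in \<open>simp_all add: mem_hom_iff\<close>)
  show ?thesis
    using w0(1) w1(1) src_eq tgt_eq idn_eq cmp_eq
    by (simp add: int_functor_def c_def)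
qed

text \<open>An internal functor is determined by its components on objects and on arrows, so
  existence and uniqueness come from the products of these; \<open>pairing\<close> supplies
  functoriality.\<close>

lemma is_product_Cat:
  "is_product (Base (Cat E)) A (disc E X) Q \<lparr>Fdom = Q, Fcod = A, F0 = \<pi>0, F1 = \<pi>1\<rparr>
     \<lparr>Fdom = Q, Fcod = disc E X, F0 = \<rho>0, F1 = \<rho>1\<rparr>"
  unfolding is_product_def
proof (intro conjI allI impI)
  show "Q \<in> Ob (Base (Cat E))" using int_cats by (simp add: Cat_def)
  show "\<lparr>Fdom = Q, Fcod = A, F0 = \<pi>0, F1 = \<pi>1\<rparr> \<in> hom (Base (Cat E)) Q A"
    using int_cats proj_fst by (simp add: Cat_def hom_def)
  show "\<lparr>Fdom = Q, Fcod = disc E X, F0 = \<rho>0, F1 = \<rho>1\<rparr> \<in> hom (Base (Cat E)) Q (disc E X)"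
    using int_cats proj_snd int_category_disc by (simp add: Cat_def hom_def)
next
  fix Z U V assume "U \<in> hom (Base (Cat E)) Z A \<and> V \<in> hom (Base (Cat E)) Z (disc E X)"
  then have Z: "int_category E Z" and U: "int_functor E U" "Fdom U = Z" "Fcod U = A"
    and V: "int_functor E V" "Fdom V = Z" "Fcod V = disc E X"
    by (auto simp: Cat_def hom_def)
  note u = int_functorD[OF U] and v = int_functorD[OF V, unfolded disc_simps]
  obtain w0 where w0: "w0 \<in> hom E (C0 Z) (C0 Q)" "\<pi>0 \<cdot> w0 = F0 U" "\<rho>0 \<cdot> w0 = F0 V"
    by (rule product_tuple[OF prods(1) u(1) v(1)])
  obtain w1 where w1: "w1 \<in> hom E (C1 Z) (C1 Q)" "\<pi>1 \<cdot> w1 = F1 U" "\<rho>1 \<cdot> w1 = F1 V"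
    by (rule product_tuple[OF prods(2) u(2) v(2)])
  let ?W = "\<lparr>Fdom = Z, Fcod = Q, F0 = w0, F1 = w1\<rparr>"
  show "\<exists>!h. h \<in> hom (Base (Cat E)) Z Q \<and>
      Cmp (Base (Cat E)) \<lparr>Fdom = Q, Fcod = A, F0 = \<pi>0, F1 = \<pi>1\<rparr> h = U \<and>
      Cmp (Base (Cat E)) \<lparr>Fdom = Q, Fcod = disc E X, F0 = \<rho>0, F1 = \<rho>1\<rparr> h = V"
  proof (rule ex1I[of _ ?W])
    show "?W \<in> hom (Base (Cat E)) Z Q \<and>
      Cmp (Base (Cat E)) \<lparr>Fdom = Q, Fcod = A, F0 = \<pi>0, F1 = \<pi>1\<rparr> ?W = U \<and>
      Cmp (Base (Cat E)) \<lparr>Fdom = Q, Fcod = disc E X, F0 = \<rho>0, F1 = \<rho>1\<rparr> ?W = V"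
      using pairing[OF Z U V w0 w1] Z int_cats U V w0 w1
      by (simp add: Cat_def hom_def int_comp_def)
    fix h assume h: "h \<in> hom (Base (Cat E)) Z Q \<and>
      Cmp (Base (Cat E)) \<lparr>Fdom = Q, Fcod = A, F0 = \<pi>0, F1 = \<pi>1\<rparr> h = U \<and>
      Cmp (Base (Cat E)) \<lparr>Fdom = Q, Fcod = disc E X, F0 = \<rho>0, F1 = \<rho>1\<rparr> h = V"
    then have hf: "int_functor E h" "Fdom h = Z" "Fcod h = Q" by (simp_all add: Cat_def hom_def)
    have hU: "int_comp E \<lparr>Fdom = Q, Fcod = A, F0 = \<pi>0, F1 = \<pi>1\<rparr> h = U"
      and hV: "int_comp E \<lparr>Fdom = Q, Fcod = disc E X, F0 = \<rho>0, F1 = \<rho>1\<rparr> h = V"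
      using h by (simp_all add: Cat_def)
    have "F0 h = w0"
      by (rule product_eqI[OF prods(1) int_functorD(1)[OF hf] w0(1)])
         (use w0 hU hV in \<open>auto simp: int_comp_def\<close>)
    moreover have "F1 h = w1"
      by (rule product_eqI[OF prods(2) int_functorD(2)[OF hf] w1(1)])
         (use w1 hU hV in \<open>auto simp: int_comp_def\<close>)
    ultimately show "h = ?W" using hf by (intro ifunc.equality) simp_all
  qed
qed

end

text \<open>\<open>Q\<close> is the componentwise product, with structure maps of the form
  \<open>f \<times> X\<close>. By \<open>copower_terminal_product\<close> its components are
  copowers of \<open>X\<close>, with injections \<open>(p i \<cdot> b, Idn E X)\<close> for
  \<open>b : X \<rightarrow> U\<close>.\<close>

lemma (in extensive_category) arrow_copower_times:
  assumes A: "arrow_copower E U A p0 p1 p2" and U: "is_terminal E U"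
    and lim: "has_finite_limits E" and X: "X \<in> Ob E"
  obtains Q j0 j1 j2 \<pi>0 \<pi>1 \<pi>2 \<rho>0 \<rho>1 \<rho>2
  where "arrow_copower E X Q j0 j1 j2" "product_with_disc E A Q X \<pi>0 \<pi>1 \<pi>2 \<rho>0 \<rho>1 \<rho>2"
proof -
  interpret A: arrow_copower E U A p0 p1 p2 by (rule A)
  obtain P0 \<pi>0 \<rho>0 where P0: "is_product E (C0 A) X P0 \<pi>0 \<rho>0"
    by (rule product_exists[OF lim A.arrows_simps(19) X])
  obtain P1 \<pi>1 \<rho>1 where P1: "is_product E (C1 A) X P1 \<pi>1 \<rho>1"
    by (rule product_exists[OF lim A.arrows_simps(20) X])
  obtain P2 \<pi>2 \<rho>2 where P2: "is_product E (C2 A) X P2 \<pi>2 \<rho>2"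
    by (rule product_exists[OF lim A.arrows_simps(21) X])
  obtain b where b: "b \<in> hom E X U" using U X unfolding is_terminal_def by blast
  note b' = b[unfolded mem_hom_iff]
  have I: "Idn E X \<in> hom E X X" by (rule Idn_in[OF X])
  have "\<exists>j. j \<in> hom E X P0 \<and> \<pi>0 \<cdot> j = p0 i \<cdot> b \<and> \<rho>0 \<cdot> j = Idn E X" if "i < 2" for i
    by (rule product_tuple[OF P0 _ I, of "p0 i \<cdot> b"]) (use that b' in \<open>auto simp: mem_hom_iff\<close>)
  then obtain j0 where j0: "\<And>i. i < 2 \<Longrightarrow> j0 i \<in> hom E X P0" "\<And>i. i < 2 \<Longrightarrow> \<pi>0 \<cdot> j0 i = p0 i \<cdot> b"
    "\<And>i. i < 2 \<Longrightarrow> \<rho>0 \<cdot> j0 i = Idn E X" by metis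
  have "\<exists>j. j \<in> hom E X P1 \<and> \<pi>1 \<cdot> j = p1 i \<cdot> b \<and> \<rho>1 \<cdot> j = Idn E X" if "i < 3" for i
    by (rule product_tuple[OF P1 _ I, of "p1 i \<cdot> b"]) (use that b' in \<open>auto simp: mem_hom_iff\<close>)
  then obtain j1 where j1: "\<And>i. i < 3 \<Longrightarrow> j1 i \<in> hom E X P1" "\<And>i. i < 3 \<Longrightarrow> \<pi>1 \<cdot> j1 i = p1 i \<cdot> b"
    "\<And>i. i < 3 \<Longrightarrow> \<rho>1 \<cdot> j1 i = Idn E X" by metis
  have "\<exists>j. j \<in> hom E X P2 \<and> \<pi>2 \<cdot> j = p2 i \<cdot> b \<and> \<rho>2 \<cdot> j = Idn E X" if "i < 4" for i
    by (rule product_tuple[OF P2 _ I, of "p2 i \<cdot> b"]) (use that b' in \<open>auto simp: mem_hom_iff\<close>)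
  then obtain j2 where j2: "\<And>i. i < 4 \<Longrightarrow> j2 i \<in> hom E X P2" "\<And>i. i < 4 \<Longrightarrow> \<pi>2 \<cdot> j2 i = p2 i \<cdot> b"
    "\<And>i. i < 4 \<Longrightarrow> \<rho>2 \<cdot> j2 i = Idn E X" by metis
  have times: "\<exists>g. g \<in> hom E P P' \<and> \<pi>' \<cdot> g = f \<cdot> \<pi> \<and> \<rho>' \<cdot> g = \<rho>"
    if P: "is_product E B X P \<pi> \<rho>" "is_product E B' X P' \<pi>' \<rho>'" and f: "f \<in> hom E B B'"
    for B B' P P' \<pi> \<pi>' \<rho> \<rho>' f
  proof -
    have "f \<cdot> \<pi> \<in> hom E P B'" "\<rho> \<in> hom E P X"
      using f product_proj[OF P(1)] by (simp_all add: mem_hom_iff)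
    from product_tuple[OF P(2) this] show ?thesis by metis
  qed
  \<comment> \<open>The map \<open>f \<times> X\<close> carries the injection over \<open>p\<close>
    to the one over \<open>f \<cdot> p\<close>, so the tables that hold for \<open>A\<close> hold
    for \<open>Q\<close> as well.\<close>
  have times_inj: "g \<cdot> j = j'"
    if P: "is_product E B X P \<pi> \<rho>" "is_product E B' X P' \<pi>' \<rho>'"
      and f: "f \<in> hom E B B'" and g: "g \<in> hom E P P'" "\<pi>' \<cdot> g = f \<cdot> \<pi>" "\<rho>' \<cdot> g = \<rho>"
      and j: "j \<in> hom E X P" "\<pi> \<cdot> j = p \<cdot> b" "\<rho> \<cdot> j = Idn E X"
      and j': "j' \<in> hom E X P'" "\<pi>' \<cdot> j' = p' \<cdot> b" "\<rho>' \<cdot> j' = Idn E X"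
      and p: "p \<in> hom E U B" "f \<cdot> p = p'"
    for B B' P P' \<pi> \<pi>' \<rho> \<rho>' f g j j' p p'
  proof (rule product_eqI[OF P(2) _ j'(1)])
    note ty = f[unfolded mem_hom_iff] g(1)[unfolded mem_hom_iff] j(1)[unfolded mem_hom_iff]
      p(1)[unfolded mem_hom_iff] product_proj[OF P(1)] product_proj[OF P(2)] b'
    show "g \<cdot> j \<in> hom E X P'" using ty by (simp add: mem_hom_iff)
    have "\<pi>' \<cdot> (g \<cdot> j) = f \<cdot> (\<pi> \<cdot> j)" by (rule square_reassoc[OF g(2)]) (use ty in simp_all)
    also have "\<dots> = p' \<cdot> b" unfolding j(2) by (rule reassoc[OF p(2)]) (use ty in simp_all)
    finally show "\<pi>' \<cdot> (g \<cdot> j) = \<pi>' \<cdot> j'" using j'(2) by simp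
    have "\<rho>' \<cdot> (g \<cdot> j) = \<rho> \<cdot> j" by (rule reassoc[OF g(3)]) (use ty in simp_all)
    then show "\<rho>' \<cdot> (g \<cdot> j) = \<rho>' \<cdot> j'" using j(3) j'(3) by simp
  qed
  obtain s where s: "s \<in> hom E P1 P0" "\<pi>0 \<cdot> s = src A \<cdot> \<pi>1" "\<rho>0 \<cdot> s = \<rho>1"
    using times[OF P1 P0 A.arrows(1)] by blast
  obtain t where t: "t \<in> hom E P1 P0" "\<pi>0 \<cdot> t = tgt A \<cdot> \<pi>1" "\<rho>0 \<cdot> t = \<rho>1"
    using times[OF P1 P0 A.arrows(2)] by blast
  obtain e where e: "e \<in> hom E P0 P1" "\<pi>1 \<cdot> e = idn A \<cdot> \<pi>0" "\<rho>1 \<cdot> e = \<rho>0"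
    using times[OF P0 P1 A.arrows(3)] by blast
  obtain u where u: "u \<in> hom E P2 P1" "\<pi>1 \<cdot> u = pr1 A \<cdot> \<pi>2" "\<rho>1 \<cdot> u = \<rho>2"
    using times[OF P2 P1 A.arrows(4)] by blast
  obtain v where v: "v \<in> hom E P2 P1" "\<pi>1 \<cdot> v = pr2 A \<cdot> \<pi>2" "\<rho>1 \<cdot> v = \<rho>2"
    using times[OF P2 P1 A.arrows(5)] by blast
  obtain m where m: "m \<in> hom E P2 P1" "\<pi>1 \<cdot> m = cmp A \<cdot> \<pi>2" "\<rho>1 \<cdot> m = \<rho>2"
    using times[OF P2 P1 A.arrows(6)] by blast
  have p_hom: "i < 2 \<Longrightarrow> p0 i \<in> hom E U (C0 A)" "i < 3 \<Longrightarrow> p1 i \<in> hom E U (C1 A)"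
    "i < 4 \<Longrightarrow> p2 i \<in> hom E U (C2 A)" for i by (simp_all add: mem_hom_iff)
  let ?Q = "\<lparr>C0 = P0, C1 = P1, C2 = P2, src = s, tgt = t, idn = e, pr1 = u, pr2 = v, cmp = m\<rparr>"
  have Q: "arrow_copower E X ?Q j0 j1 j2"
  proof (unfold_locales, unfold icat.simps)
    show "is_coproduct E {..<2} (\<lambda>_. X) P0 j0"
      by (rule copower_terminal_product[OF A.cop0 _ U P0 b j0]) simp_all
    show "is_coproduct E {..<3} (\<lambda>_. X) P1 j1"
      by (rule copower_terminal_product[OF A.cop1 _ U P1 b j1]) simp_all
    show "is_coproduct E {..<4} (\<lambda>_. X) P2 j2"
      by (rule copower_terminal_product[OF A.cop2 _ U P2 b j2]) simp_all
    show "s \<cdot> j1 i = j0 ([0, 1, 0] ! i)" if i: "i < 3" for i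
      by (rule times_inj[OF P1 P0 A.arrows(1) s j1[OF i] j0 p_hom(2)[OF i] A.src_inj[OF i]])
         (use i in \<open>simp_all add: tables_lt\<close>)
    show "t \<cdot> j1 i = j0 ([0, 1, 1] ! i)" if i: "i < 3" for i
      by (rule times_inj[OF P1 P0 A.arrows(2) t j1[OF i] j0 p_hom(2)[OF i] A.tgt_inj[OF i]])
         (use i in \<open>simp_all add: tables_lt\<close>)
    show "e \<cdot> j0 i = j1 ([0, 1] ! i)" if i: "i < 2" for i
      by (rule times_inj[OF P0 P1 A.arrows(3) e j0[OF i] j1 p_hom(1)[OF i] A.idn_inj[OF i]])
         (use i in \<open>simp_all add: tables_lt\<close>)
    show "u \<cdot> j2 i = j1 ([0, 1, 2, 1] ! i)" if i: "i < 4" for i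
      by (rule times_inj[OF P2 P1 A.arrows(4) u j2[OF i] j1 p_hom(3)[OF i] A.pr1_inj[OF i]])
         (use i in \<open>simp_all add: tables_lt\<close>)
    show "v \<cdot> j2 i = j1 ([0, 1, 0, 2] ! i)" if i: "i < 4" for i
      by (rule times_inj[OF P2 P1 A.arrows(5) v j2[OF i] j1 p_hom(3)[OF i] A.pr2_inj[OF i]])
         (use i in \<open>simp_all add: tables_lt\<close>)
    show "m \<cdot> j2 i = j1 ([0, 1, 2, 2] ! i)" if i: "i < 4" for i
      by (rule times_inj[OF P2 P1 A.arrows(6) m j2[OF i] j1 p_hom(3)[OF i] A.cmp_inj[OF i]])
         (use i in \<open>simp_all add: tables_lt\<close>)
  qed (rule s t e u v m)+
  have "product_with_disc E A ?Q X \<pi>0 \<pi>1 \<pi>2 \<rho>0 \<rho>1 \<rho>2"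
    by (unfold_locales, unfold icat.simps)
       (rule A.int_category arrow_copower.int_category[OF Q] P0 P1 P2 s t e u v m)+
  then show thesis using that Q by blast
qed

lemma (in category) int_functor_comp:
  assumes K: "int_functor C K" "Fdom K = A" "Fcod K = B"
    and L: "int_functor C L" "Fdom L = B" "Fcod L = D"
    and cats: "int_category C A" "int_category C B" "int_category C D"
  shows "int_functor C (int_comp C L K)"
proof -
  interpret A: internal_category C A by unfold_locales (rule cats)
  interpret B: internal_category C B by unfold_locales (rule cats)
  interpret D: internal_category C D by unfold_locales (rule cats)
  note k = int_functorD[OF K] and l = int_functorD[OF L]
  note ty = k(1,2)[unfolded mem_hom_iff] l(1,2)[unfolded mem_hom_iff]
  note pk = int_functor_composable[OF K cats(1,2)] and pl = int_functor_composable[OF L cats(2,3)]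
  define c where "c = comp_pair C B (F1 K \<cdot> pr1 A) (F1 K \<cdot> pr2 A)"
  note c = B.pair[OF pk, folded c_def]
  have s: "src D \<cdot> (F1 L \<cdot> F1 K) = F0 L \<cdot> (src B \<cdot> F1 K)"
    "tgt D \<cdot> (F1 L \<cdot> F1 K) = F0 L \<cdot> (tgt B \<cdot> F1 K)"
    "F1 L \<cdot> (idn B \<cdot> F0 K) = idn D \<cdot> (F0 L \<cdot> F0 K)"
    by (rule square_reassoc[OF l(3)] square_reassoc[OF l(4)] square_reassoc[OF l(5)];
        use ty in simp)+
  have "comp_pair C D (F1 L \<cdot> pr1 B) (F1 L \<cdot> pr2 B) \<cdot> c =
      comp_pair C D (F1 L \<cdot> (F1 K \<cdot> pr1 A)) (F1 L \<cdot> (F1 K \<cdot> pr2 A))"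
    using D.pair_comp[OF pl c(1)] c ty by (simp add: mem_hom_iff)
  moreover have "F1 L \<cdot> (cmp B \<cdot> c) = cmp D \<cdot> (comp_pair C D (F1 L \<cdot> pr1 B) (F1 L \<cdot> pr2 B) \<cdot> c)"
    by (rule square_reassoc[OF l(6)])
       (use ty c(1) D.pair(1)[OF pl] in \<open>simp_all add: mem_hom_iff\<close>)
  ultimately have "F1 L \<cdot> (F1 K \<cdot> cmp A) =
      cmp D \<cdot> comp_pair C D (F1 L \<cdot> (F1 K \<cdot> pr1 A)) (F1 L \<cdot> (F1 K \<cdot> pr2 A))"
    using k(6) c_def by simp
  then show ?thesis
    using K L ty s k(3,4,5) by (simp add: int_functor_def int_comp_def mem_hom_iff)
qed

section \<open>Finite sets\<close>

lemma FinSet_terminal: "is_terminal FinSet {..<1}"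
  unfolding is_terminal_def
proof (intro conjI ballI)
  show "{..<1} \<in> Ob FinSet" by (simp add: FinSet_def)
  fix A assume "A \<in> Ob FinSet"
  then have A: "finite A" by (simp add: FinSet_def)
  show "\<exists>!h. h \<in> hom FinSet A {..<1}"
  proof (rule ex1I)
    show "(A, \<lambda>x\<in>A. 0, {..<1}) \<in> hom FinSet A {..<1}"
      using A by (auto simp: FinSet_def hom_def)
    fix h assume "h \<in> hom FinSet A {..<1}"
    then obtain f where f: "h = (A, f, {..<1})" "f \<in> A \<rightarrow>\<^sub>E {..<1}"
      by (cases h) (auto simp: FinSet_def hom_def)
    have "f = (\<lambda>x\<in>A. 0)"
      by (rule extensionalityI[of _ A]) (use f(2) in \<open>auto simp: PiE_iff\<close>)
    then show "h = (A, \<lambda>x\<in>A. 0, {..<1})" using f(1) by simp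
  qed
qed

lemma tabulate_hom:
  "set xs \<subseteq> {..<n} \<Longrightarrow> tabulate xs n \<in> hom FinSet {..<length xs} {..<n}"
  by (auto simp: tabulate_def FinSet_def hom_def PiE_iff subset_iff)

lemma tabulate_comp:
  assumes "i < length xs"
  shows "tabulate xs n \<cdot>\<^bsub>FinSet\<^esub> tabulate [i] (length xs) = tabulate [xs ! i] n"
  using assms by (auto simp: tabulate_def FinSet_def compose_def fun_eq_iff)

text \<open>A coproduct-preserving functor \<open>F\<close> turns this into a copower of
  \<open>F {..<1}\<close>, which makes an abstract functor out of \<open>FinSet\<close> computable.
  The injections are the points of \<open>{..<n}\<close>, written as tables with one entry.\<close>

lemma FinSet_copower:
  "is_coproduct FinSet {..<n} (\<lambda>_. {..<1}) {..<n} (\<lambda>i. tabulate [i] n)"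
  unfolding is_coproduct_def
proof (intro conjI ballI allI impI)
  show "{..<n} \<in> Ob FinSet" by (simp add: FinSet_def)
  show "tabulate [i] n \<in> hom FinSet {..<1} {..<n}" if "i \<in> {..<n}" for i
    using tabulate_hom[of "[i]" n] that by simp
  fix T f assume Tf: "T \<in> Ob FinSet \<and> (\<forall>i\<in>{..<n}. f i \<in> hom FinSet {..<1} T)"
  have f: "\<exists>g. f i = ({..<1}, g, T) \<and> g \<in> {..<1} \<rightarrow>\<^sub>E T" if "i < n" for i
  proof -
    have "f i \<in> hom FinSet {..<1} T" using Tf that by simp
    then show ?thesis by (cases "f i") (auto simp: FinSet_def hom_def)
  qed
  then obtain g where g: "\<And>i. i < n \<Longrightarrow> f i = ({..<1}, g i, T)" "\<And>i. i < n \<Longrightarrow> g i \<in> {..<1} \<rightarrow>\<^sub>E T"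
    by metis
  have comp: "({..<n}, h, T) \<cdot>\<^bsub>FinSet\<^esub> tabulate [i] n = f i \<longleftrightarrow> h i = g i 0" if "i < n" for i h
  proof -
    have "compose {..<1::nat} h (\<lambda>k\<in>{..<1}. [i] ! k) = g i \<longleftrightarrow> h i = g i 0"
    proof
      assume "compose {..<1::nat} h (\<lambda>k\<in>{..<1}. [i] ! k) = g i"
      from fun_cong[OF this, of 0] show "h i = g i 0" by (simp add: compose_def)
    next
      assume "h i = g i 0"
      then show "compose {..<1::nat} h (\<lambda>k\<in>{..<1}. [i] ! k) = g i"
        by (intro extensionalityI[of _ "{..<1}"]) (use g(2)[OF that] in \<open>auto simp: compose_def PiE_iff\<close>)
    qed
    then show ?thesis using g(1)[OF that] by (simp add: FinSet_def tabulate_def)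
  qed
  show "\<exists>!h. h \<in> hom FinSet {..<n} T \<and> (\<forall>i\<in>{..<n}. h \<cdot>\<^bsub>FinSet\<^esub> tabulate [i] n = f i)"
  proof (rule ex1I[of _ "({..<n}, \<lambda>i\<in>{..<n}. g i 0, T)"])
    have "(\<lambda>i\<in>{..<n}. g i 0) \<in> {..<n} \<rightarrow>\<^sub>E T" using g(2) by (auto simp: PiE_iff)
    then show "({..<n}, \<lambda>i\<in>{..<n}. g i 0, T) \<in> hom FinSet {..<n} T \<and>
      (\<forall>i\<in>{..<n}. ({..<n}, \<lambda>i\<in>{..<n}. g i 0, T) \<cdot>\<^bsub>FinSet\<^esub> tabulate [i] n = f i)"
      using Tf comp by (simp add: FinSet_def hom_def)
    fix h assume h: "h \<in> hom FinSet {..<n} T \<and> (\<forall>i\<in>{..<n}. h \<cdot>\<^bsub>FinSet\<^esub> tabulate [i] n = f i)"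
    then obtain k where k: "h = ({..<n}, k, T)" "k \<in> {..<n} \<rightarrow>\<^sub>E T"
      by (cases h) (auto simp: FinSet_def hom_def)
    have "k = (\<lambda>i\<in>{..<n}. g i 0)"
      by (rule extensionalityI[of _ "{..<n}"]) (use k h comp in \<open>auto simp: PiE_iff\<close>)
    then show "h = ({..<n}, \<lambda>i\<in>{..<n}. g i 0, T)" using k(1) by simp
  qed
qed

text \<open>Every structure map of \<open>free_arrow\<close> is a table, and composing a table with
  a point looks up an entry; functoriality carries these equations to \<open>E\<close>.\<close>

lemma (in extensive_category) free_arrow_copower:
  assumes F: "is_functor FinSet E F" and cop: "preserves_finite_coproducts FinSet E F"
  shows "arrow_copower E (FOb F {..<1}) (Cat_map F free_arrow)
    (\<lambda>i. FAr F (tabulate [i] 2)) (\<lambda>i. FAr F (tabulate [i] 3)) (\<lambda>i. FAr F (tabulate [i] 4))"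
proof -
  have copower: "is_coproduct E {..<n} (\<lambda>_. FOb F {..<1}) (FOb F {..<n}) (\<lambda>i. FAr F (tabulate [i] n))"
    for n using cop FinSet_copower[of n] unfolding preserves_finite_coproducts_def by blast
  have hom: "FAr F (tabulate xs n) \<in> hom E (FOb F {..<k}) (FOb F {..<n})"
    if "set xs \<subseteq> {..<n}" "length xs = k" for xs n k
    using F tabulate_hom[OF that(1)] that(2) unfolding is_functor_def by (auto simp: hom_def)
  have comp: "FAr F (tabulate xs n) \<cdot> FAr F (tabulate [i] k) = FAr F (tabulate [xs ! i] n)"
    if "i < k" "set xs \<subseteq> {..<n}" "length xs = k" for i xs n k
  proof -
    have "tabulate xs n \<in> Ar FinSet" "tabulate [i] k \<in> Ar FinSet"
      "Tgt FinSet (tabulate [i] k) = Src FinSet (tabulate xs n)"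
      using tabulate_hom[of xs n] tabulate_hom[of "[i]" k] that by (simp_all add: hom_def)
    then have "FAr F (tabulate xs n \<cdot>\<^bsub>FinSet\<^esub> tabulate [i] k) =
        FAr F (tabulate xs n) \<cdot> FAr F (tabulate [i] k)"
      using F unfolding is_functor_def by blast
    then show ?thesis using tabulate_comp[of i xs n] that by simp
  qed
  show ?thesis
    by (unfold_locales; unfold Cat_map_def free_arrow_def icat.simps)
       (rule copower hom comp; simp)+
qed

section \<open>The generating family\<close>

text \<open>\<open>P\<close> is chosen by \<open>SOME\<close>. The explicit product \<open>Q\<close>
  shows that there is a product to choose, and the comparison of \<open>P\<close> with
  \<open>Q\<close> transports the copy of \<open>X\<close> at \<open>0 \<rightarrow> 1\<close>; this
  transported copy is the \<open>m\<close> of the second claim.\<close>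

lemma (in extensive_category) product_classifies_arrows:
  assumes lim: "has_finite_limits E" and F: "is_functor FinSet E F"
    and cop: "preserves_finite_coproducts FinSet E F" and pt: "preserves_terminal FinSet E F"
    and X: "X \<in> Ob E"
  defines "P \<equiv> prod_ob (Base (Cat E)) (Cat_map F free_arrow) (disc E X)"
  shows "int_category E P"
    and "int_category E A \<Longrightarrow> a \<in> hom E X (C1 A) \<Longrightarrow>
      \<exists>W m. int_functor E W \<and> Fdom W = P \<and> Fcod W = A \<and> m \<in> hom E X (C1 P) \<and> F1 W \<cdot> m = a"
proof -
  let ?B = "Base (Cat E)" and ?A = "Cat_map F free_arrow"
  have U: "is_terminal E (FOb F {..<1})"
    using pt FinSet_terminal by (simp add: preserves_terminal_def)
  obtain Q j0 j1 j2 \<pi>0 \<pi>1 \<pi>2 \<rho>0 \<rho>1 \<rho>2 where "arrow_copower E X Q j0 j1 j2"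
    "product_with_disc E ?A Q X \<pi>0 \<pi>1 \<pi>2 \<rho>0 \<rho>1 \<rho>2"
    by (rule arrow_copower_times[OF free_arrow_copower[OF F cop] U lim X])
  then interpret Q: arrow_copower E X Q j0 j1 j2
    + D: product_with_disc E ?A Q X \<pi>0 \<pi>1 \<pi>2 \<rho>0 \<rho>1 \<rho>2 .
  define \<pi> \<rho> where "\<pi> = \<lparr>Fdom = Q, Fcod = ?A, F0 = \<pi>0, F1 = \<pi>1\<rparr>"
    and "\<rho> = \<lparr>Fdom = Q, Fcod = disc E X, F0 = \<rho>0, F1 = \<rho>1\<rparr>"
  have Q: "is_product ?B ?A (disc E X) Q \<pi> \<rho>"
    unfolding \<pi>_def \<rho>_def by (rule D.is_product_Cat)
  then have "\<exists>P p q. is_product ?B ?A (disc E X) P p q" by blast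
  then have "\<exists>p q. is_product ?B ?A (disc E X) P p q"
    unfolding P_def prod_ob_def by (rule someI_ex)
  then obtain p q where P: "is_product ?B ?A (disc E X) P p q" by blast
  then show P_cat: "int_category E P" by (simp add: is_product_def Cat_def)
  have pq: "p \<in> hom ?B P ?A" "q \<in> hom ?B P (disc E X)" and "\<pi> \<in> hom ?B Q ?A" "\<rho> \<in> hom ?B Q (disc E X)"
    using P Q by (simp_all add: is_product_def)
  then obtain L where L: "L \<in> hom ?B Q P" "Cmp ?B p L = \<pi>" "Cmp ?B q L = \<rho>"
    using P unfolding is_product_def by metis
  obtain K where K: "K \<in> hom ?B P Q" "Cmp ?B \<pi> K = p" "Cmp ?B \<rho> K = q"
    using Q pq unfolding is_product_def by metis
  have Kf: "int_functor E K" "Fdom K = P" "Fcod K = Q" using K(1) by (simp_all add: Cat_def hom_def)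
  have Lf: "int_functor E L" "Fdom L = Q" "Fcod L = P" using L(1) by (simp_all add: Cat_def hom_def)
  have K1: "F1 K \<in> hom E (C1 P) (C1 Q)" and L1: "F1 L \<in> hom E (C1 Q) (C1 P)"
    using int_functorD(2)[OF Kf] int_functorD(2)[OF Lf] .
  note ty = K1[unfolded mem_hom_iff] L1[unfolded mem_hom_iff]
  have p1: "F1 p = \<pi>1 \<cdot> F1 K" "F1 q = \<rho>1 \<cdot> F1 K"
    using K(2,3) by (auto simp: Cat_def int_comp_def \<pi>_def \<rho>_def)
  have p2: "F1 p \<cdot> F1 L = \<pi>1" "F1 q \<cdot> F1 L = \<rho>1"
    using L(2,3) by (auto simp: Cat_def int_comp_def \<pi>_def \<rho>_def)
  \<comment> \<open>With this, \<open>W\<close> after \<open>K\<close> takes the transported copy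
    \<open>F1 L \<cdot> j1 2\<close> to the same value as \<open>W\<close> takes
    \<open>j1 2\<close>.\<close>
  have KL: "F1 K \<cdot> F1 L = Idn E (C1 Q)"
  proof (rule product_eqI[OF D.prods(2)])
    show "\<pi>1 \<cdot> (F1 K \<cdot> F1 L) = \<pi>1 \<cdot> Idn E (C1 Q)" "\<rho>1 \<cdot> (F1 K \<cdot> F1 L) = \<rho>1 \<cdot> Idn E (C1 Q)"
      using p2 ty unfolding p1 by simp_all
  qed (use ty in \<open>simp_all add: mem_hom_iff\<close>)
  show "\<exists>W m. int_functor E W \<and> Fdom W = P \<and> Fcod W = A \<and> m \<in> hom E X (C1 P) \<and> F1 W \<cdot> m = a"
    if A: "int_category E A" and a: "a \<in> hom E X (C1 A)"
  proof -
    obtain W where W: "int_functor E W" "Fdom W = Q" "Fcod W = A" "F1 W \<cdot> j1 2 = a"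
      by (rule Q.functor_of_arrow[OF A a])
    note w1 = int_functorD(2)[OF W(1-3), unfolded mem_hom_iff]
    have "F1 K \<cdot> (F1 L \<cdot> j1 2) = j1 2"
      using reassoc[OF KL, of "j1 2"] ty by simp
    then have "F1 (int_comp E W K) \<cdot> (F1 L \<cdot> j1 2) = a"
      using W(4) w1 ty by (simp add: int_comp_def)
    moreover have "int_functor E (int_comp E W K)"
      by (rule int_functor_comp[OF Kf W(1-3) P_cat Q.int_category A])
    moreover have "F1 L \<cdot> j1 2 \<in> hom E X (C1 P)" using ty by (simp add: mem_hom_iff)
    ultimately show ?thesis
      using Kf W by (intro exI[of _ "int_comp E W K"] exI[of _ "F1 L \<cdot> j1 2"]) (simp add: int_comp_def)
  qed
qed

lemma (in category) generating_eqI: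
  assumes "generating C \<G>" "f \<in> hom C A B" "g \<in> hom C A B"
    and "\<And>X x. X \<in> \<G> \<Longrightarrow> x \<in> hom C X A \<Longrightarrow> f \<cdot> x = g \<cdot> x"
  shows "f = g"
proof -
  have "rep C X f = rep C X g" if "X \<in> \<G>" for X
    using assms(2,3) assms(4)[OF that] by (auto simp: rep_def mem_hom_iff)
  then show ?thesis
    using assms(1-3) hom_Ob[OF assms(2)] unfolding generating_def by blast
qed

theorem corollary5p9:
  fixes E :: "('o, 'm) cat"
    and \<G> :: "'o set"
    and F\<^sub>E :: "(nat set, nat set \<times> (nat \<Rightarrow> nat) \<times> nat set, 'o, 'm) func"
  assumes "category E"
    and "has_finite_limits E"
    and "has_extensive_coproducts E"
    and "generating E \<G>"
    and "is_functor FinSet E F\<^sub>E"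
    and "preserves_finite_coproducts FinSet E F\<^sub>E"
    and "preserves_terminal FinSet E F\<^sub>E"
  shows "generating2 (Cat E)
           {prod_ob (Base (Cat E)) (Cat_map F\<^sub>E free_arrow) (disc E X) | X. X \<in> \<G>}"
proof -
  interpret extensive_category E
    using assms(1,3) by (simp add: extensive_category_def extensive_category_axioms_def)
  let ?P = "\<lambda>X. prod_ob (Base (Cat E)) (Cat_map F\<^sub>E free_arrow) (disc E X)"
  have \<G>: "X \<in> Ob E" if "X \<in> \<G>" for X using assms(4) that by (auto simp: generating_def)
  note cls = product_classifies_arrows[OF assms(2,5-7) \<G>]
  have Hom2: "Hom2 (Cat E) = int_hom E" "HCmp (Cat E) = int_hcomp E"
    by (simp_all add: Cat_def)
  have Ob_hom: "f \<in> Ob (Hom2 (Cat E) A B) \<longleftrightarrow> int_functor E f \<and> Fdom f = A \<and> Fcod f = B" for f A B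
    by (simp add: Hom2 int_hom_def)
  have Cmp: "Cmp (Base (Cat E)) = int_comp E" by (simp add: Cat_def)
  show ?thesis
    unfolding generating2_def
  proof (intro conjI ballI impI)
    show "{?P X | X. X \<in> \<G>} \<subseteq> Ob (Base (Cat E))" using cls(1) by (auto simp: Cat_def)
  next
    fix A B f g
    assume "A \<in> Ob (Base (Cat E))" "B \<in> Ob (Base (Cat E))"
      and "f \<in> Ob (Hom2 (Cat E) A B)" "g \<in> Ob (Hom2 (Cat E) A B)"
      and rep: "\<forall>P\<in>{?P X | X. X \<in> \<G>}. rep1 (Cat E) P A B f = rep1 (Cat E) P A B g"
    then have A: "int_category E A" and B: "int_category E B"
      and f: "int_functor E f" "Fdom f = A" "Fcod f = B"
      and g: "int_functor E g" "Fdom g = A" "Fcod g = B"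
      unfolding Ob_hom by (simp_all add: Cat_def)
    interpret A: internal_category E A by unfold_locales (rule A)
    interpret B: internal_category E B by unfold_locales (rule B)
    note f' = int_functorD[OF f] and g' = int_functorD[OF g]
    note ty = f'(1,2)[unfolded mem_hom_iff] g'(1,2)[unfolded mem_hom_iff]
    have F1: "F1 f = F1 g"
    proof (rule generating_eqI[OF assms(4) f'(2) g'(2)])
      fix X a assume X: "X \<in> \<G>" and a: "a \<in> hom E X (C1 A)"
      obtain W m where W: "int_functor E W" "Fdom W = ?P X" "Fcod W = A"
        and m: "m \<in> hom E X (C1 (?P X))" "F1 W \<cdot>\<^bsub>E\<^esub> m = a"
        using cls(2)[OF X A a] by blast
      have "rep1 (Cat E) (?P X) A B f = rep1 (Cat E) (?P X) A B g" using rep X by blast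
      then have "FOb (rep1 (Cat E) (?P X) A B f) W = FOb (rep1 (Cat E) (?P X) A B g) W" by simp
      then have "int_comp E f W = int_comp E g W"
        using W by (simp add: rep1_def Ob_hom Cmp)
      then have eq: "F1 f \<cdot>\<^bsub>E\<^esub> F1 W = F1 g \<cdot>\<^bsub>E\<^esub> F1 W" by (simp add: int_comp_def)
      note w = int_functorD(2)[OF W, unfolded mem_hom_iff]
      have "F1 f \<cdot>\<^bsub>E\<^esub> (F1 W \<cdot>\<^bsub>E\<^esub> m) = F1 g \<cdot>\<^bsub>E\<^esub> (F1 W \<cdot>\<^bsub>E\<^esub> m)"
        by (rule square_reassoc[OF eq]) (use ty w m(1) in \<open>simp_all add: mem_hom_iff\<close>)
      then show "F1 f \<cdot>\<^bsub>E\<^esub> a = F1 g \<cdot>\<^bsub>E\<^esub> a" using m(2) by simp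
    qed
    \<comment> \<open>The object part is recovered from the arrow part, as the source of the image
      of an identity.\<close>
    have F0: "F0 h = src B \<cdot>\<^bsub>E\<^esub> (F1 h \<cdot>\<^bsub>E\<^esub> idn A)" if "int_functor E h" "Fdom h = A" "Fcod h = B" for h
    proof -
      note h = int_functorD[OF that]
      show ?thesis
        using reassoc[OF B.source_identity, of "F0 h"] h(1,5) by (simp add: mem_hom_iff)
    qed
    show "f = g"
      using F0[OF f] F0[OF g] F1 f g by (intro ifunc.equality) simp_all
  next
    fix A B f g \<alpha> \<beta>
    assume "A \<in> Ob (Base (Cat E))" "B \<in> Ob (Base (Cat E))"
      and "f \<in> Ob (Hom2 (Cat E) A B)" "g \<in> Ob (Hom2 (Cat E) A B)"
      and \<alpha>: "\<alpha> \<in> hom (Hom2 (Cat E) A B) f g" and \<beta>: "\<beta> \<in> hom (Hom2 (Cat E) A B) f g"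
      and rep: "\<forall>P\<in>{?P X | X. X \<in> \<G>}. rep2 (Cat E) P A \<alpha> = rep2 (Cat E) P A \<beta>"
    then have A: "int_category E A" and B: "int_category E B"
      and f: "int_functor E f" "Fdom f = A" "Fcod f = B"
      unfolding Ob_hom by (simp_all add: Cat_def)
    interpret A: internal_category E A by unfold_locales (rule A)
    interpret B: internal_category E B by unfold_locales (rule B)
    note f' = int_functorD[OF f]
    note ty = f'(1,2)[unfolded mem_hom_iff]
    have trans: "Ndom \<gamma> = f" "Ncod \<gamma> = g" "Ncomp \<gamma> \<in> hom E (C0 A) (C1 B)" "src B \<cdot>\<^bsub>E\<^esub> Ncomp \<gamma> = F0 f"
      if "\<gamma> \<in> hom (Hom2 (Cat E) A B) f g" for \<gamma>
    proof -
      have "int_nat_trans E \<gamma>" and n: "Ndom \<gamma> = f" "Ncod \<gamma> = g"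
        using that by (simp_all add: Hom2 int_hom_def hom_def)
      then show "Ndom \<gamma> = f" "Ncod \<gamma> = g" "Ncomp \<gamma> \<in> hom E (C0 A) (C1 B)"
        "src B \<cdot>\<^bsub>E\<^esub> Ncomp \<gamma> = F0 f"
        unfolding int_nat_trans_def Let_def n f(2,3) by blast+
    qed
    \<comment> \<open>The second entry of the pair in \<open>int_hcomp\<close> is
      \<open>F1 f\<close> of an identity, hence an identity, and the right unit law removes
      it.\<close>
    have whisker: "Ncomp (int_hcomp E \<gamma> (Idn (Hom2 (Cat E) P A) W)) = Ncomp \<gamma> \<cdot>\<^bsub>E\<^esub> F0 W"
      if \<gamma>: "\<gamma> \<in> hom (Hom2 (Cat E) A B) f g" and W: "int_functor E W" "Fdom W = P" "Fcod W = A"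
      for \<gamma> P W
    proof -
      note t = trans[OF \<gamma>] and w = int_functorD(1)[OF W]
      note ty' = t(3)[unfolded mem_hom_iff] w[unfolded mem_hom_iff]
      have "src B \<cdot>\<^bsub>E\<^esub> (Ncomp \<gamma> \<cdot>\<^bsub>E\<^esub> F0 W) = F0 f \<cdot>\<^bsub>E\<^esub> F0 W"
        by (rule reassoc[OF t(4)]) (use ty' in simp_all)
      moreover have "F1 f \<cdot>\<^bsub>E\<^esub> (idn A \<cdot>\<^bsub>E\<^esub> F0 W) = idn B \<cdot>\<^bsub>E\<^esub> (F0 f \<cdot>\<^bsub>E\<^esub> F0 W)"
        by (rule square_reassoc[OF f'(5)]) (use ty ty' in simp_all)
      moreover have "Ncomp \<gamma> \<cdot>\<^bsub>E\<^esub> F0 W \<in> hom E (C0 P) (C1 B)" using ty' by (simp add: mem_hom_iff)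
      ultimately have "cmp B \<cdot>\<^bsub>E\<^esub> comp_pair E B (Ncomp \<gamma> \<cdot>\<^bsub>E\<^esub> F0 W) (F1 f \<cdot>\<^bsub>E\<^esub> (idn A \<cdot>\<^bsub>E\<^esub> F0 W)) = Ncomp \<gamma> \<cdot>\<^bsub>E\<^esub> F0 W"
        using B.identity_right by metis
      then show ?thesis using t(1) f(3) by (simp add: int_hcomp_def Hom2 int_hom_def)
    qed
    have "Ncomp \<alpha> = Ncomp \<beta>"
    proof (rule generating_eqI[OF assms(4) trans(3)[OF \<alpha>] trans(3)[OF \<beta>]])
      fix X x assume X: "X \<in> \<G>" and x: "x \<in> hom E X (C0 A)"
      have ix: "idn A \<cdot>\<^bsub>E\<^esub> x \<in> hom E X (C1 A)" using x by (simp add: mem_hom_iff)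
      obtain W m where W: "int_functor E W" "Fdom W = ?P X" "Fcod W = A"
        and m: "m \<in> hom E X (C1 (?P X))" "F1 W \<cdot>\<^bsub>E\<^esub> m = idn A \<cdot>\<^bsub>E\<^esub> x"
        using cls(2)[OF X A ix] by blast
      interpret P: internal_category E "?P X" by unfold_locales (rule cls(1)[OF X])
      note w = int_functorD[OF W]
      note wty = w(1,2)[unfolded mem_hom_iff] m(1)[unfolded mem_hom_iff] x[unfolded mem_hom_iff]
        trans(3)[OF \<alpha>, unfolded mem_hom_iff] trans(3)[OF \<beta>, unfolded mem_hom_iff]
      have "rep2 (Cat E) (?P X) A \<alpha> = rep2 (Cat E) (?P X) A \<beta>" using rep X by blast
      then have "rep2 (Cat E) (?P X) A \<alpha> W = rep2 (Cat E) (?P X) A \<beta> W" by simp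
      then have "Ncomp (int_hcomp E \<alpha> (Idn (Hom2 (Cat E) (?P X) A) W)) =
          Ncomp (int_hcomp E \<beta> (Idn (Hom2 (Cat E) (?P X) A) W))"
        using W by (simp add: rep2_def Ob_hom Hom2(2))
      then have eq: "Ncomp \<alpha> \<cdot>\<^bsub>E\<^esub> F0 W = Ncomp \<beta> \<cdot>\<^bsub>E\<^esub> F0 W"
        using whisker[OF \<alpha> W] whisker[OF \<beta> W] by simp
      \<comment> \<open>The whiskered equation is evaluated at the source of \<open>m\<close>: the
        functor \<open>W\<close> takes this to the source of the identity at \<open>x\<close>, which
        is \<open>x\<close> itself.\<close>
      have "F0 W \<cdot>\<^bsub>E\<^esub> (src (?P X) \<cdot>\<^bsub>E\<^esub> m) = src A \<cdot>\<^bsub>E\<^esub> (F1 W \<cdot>\<^bsub>E\<^esub> m)"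
        by (rule square_reassoc[OF w(3)[symmetric]]) (use wty in simp_all)
      also have "\<dots> = x"
        unfolding m(2) using reassoc[OF A.source_identity, of x] wty by simp
      finally have x_eq: "F0 W \<cdot>\<^bsub>E\<^esub> (src (?P X) \<cdot>\<^bsub>E\<^esub> m) = x" .
      have "Ncomp \<alpha> \<cdot>\<^bsub>E\<^esub> (F0 W \<cdot>\<^bsub>E\<^esub> (src (?P X) \<cdot>\<^bsub>E\<^esub> m)) = Ncomp \<beta> \<cdot>\<^bsub>E\<^esub> (F0 W \<cdot>\<^bsub>E\<^esub> (src (?P X) \<cdot>\<^bsub>E\<^esub> m))"
        by (rule square_reassoc[OF eq]) (use wty in simp_all)
      then show "Ncomp \<alpha> \<cdot>\<^bsub>E\<^esub> x = Ncomp \<beta> \<cdot>\<^bsub>E\<^esub> x" using x_eq by simp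
    qed
    then show "\<alpha> = \<beta>"
      using trans(1,2)[OF \<alpha>] trans(1,2)[OF \<beta>] by (intro itrans.equality) simp_all
  qed
qed

end
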